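(* Let $\Phi$ be an irreducible root system and $\omega$ a minuscule dominant weight. For every positive integer $M$, the diamond-colored distributive lattice $L(M\omega)=\mathbf J_{color}(P(\omega)\times\mathcal C_M)$ is a splitting distributive lattice for $\chi^\Phi_{M\omega}$; and $P(\omega)$ is Gaussian.
   Context: $\Phi$ is a finite (reduced, crystallographic) irreducible root system with simple roots $\{\alpha_i\}_{i\in I}$, $\alpha^\vee=2\alpha/\langle\alpha,\alpha\rangle$, fundamental weights $\omega_i$ dual to simple coroots, $\Lambda=\bigoplus\mathbb Z\omega_i$, Weyl group $W$, $\varrho=\sum\omega_i$. $\mathbb Z[\Lambda]$ is the group ring with basis $\{e^\mu\}$; $\mathcal A(e^\mu)=\sum_{w\in W}\det(w)e^{w(\mu)}$. The Weyl bialternant $\chi^\Phi_\lambda$ ($\lambda$ dominant) is the unique element of $\mathbb Z[\Lambda]$ with $\mathcal A(e^\varrho)\chi_\lambda=\mathcal A(e^{\lambda+\varrho})$. A nonzero weight $\omega$ is minuscule if $\langle\omega,\alpha^\vee\rangle\in\{0,\pm1\}$ for all $\alpha\in\Phi$. For $\omega$ dominant minuscule, the minuscule splitting distributive lattice $R(\omega)$ is the orbit $W\omega$ with Hasse edges $\mu\xrightarrow{i}\nu$ iff $\mu+\alpha_i=\nu$; it is known to be a diamond-colored distributive lattice (in any diamond of edges, parallel edges have the same color). $P(\omega)=\mathbf j_{color}(R(\omega))$ (the minuscule compression poset) is its poset of join irreducibles (elements covering exactly one element, with the induced order), each join irreducible colored by the color of the edge below it. $\mathcal C_M$ is a chain with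 $M$ elements; $(v,k)\in P(\omega)\times\mathcal C_M$ gets the color of $v$. For a vertex-colored poset $P$, $\mathbf J(P)$ is the lattice of order ideals of $P$ under inclusion, and $\mathbf J_{color}(P)$ is $\mathbf J(P)$ with the Hasse edge from $\mathcal X$ to $\mathcal X\cup\{y\}$ given the color of $y$. For a ranked poset $R$ (finite; there is a surjection $\rho:R\to\{0,\dots,l\}$ increasing by 1 along covering relations) with Hasse edges colored by $I$, $\mathrm{comp}_i(\mathbf x)$ is the connected component of $\mathbf x$ using only color $i$ edges; $\rho_i(\mathbf x)$ is the rank of $\mathbf x$ there, $l_i(\mathbf x)$ its length, $m_i=2\rho_i-l_i$, $wt(\mathbf x)=\sum_im_i(\mathbf x)\omega_i$. $R$ is a splitting poset for $\chi_\lambda$ (splitting distributive lattice if it is a distributive lattice) if $wt(\mathbf s)+\alpha_i=wt(\mathbf t)$ whenever $\mathbf s\xrightarrow{i}\mathbf t$ and $\sum_{\mathbf x\in R}e^{wt(\mathbf x)}=\chi_\lambda$. $\mathrm{RGF}(R,q)=\sum_{\mathbf x\in R}q^{\rho(\mathbf x)}$. A poset $P$ is Gaussian if there exist a positive integer $r$ and positive integers $h_1,\dots,h_r$ such that for every positive integer $M$, $\mathrm{RGF}(\mathbf J(P\times\mathcal C_M),q)=\prod_{i=1}^r\frac{1-q^{M+h_i}}{1-q^{h_i}}$. *)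

theory Defs
  imports
    "HOL-Analysis.Analysis"
    "HOL-Algebra.Lattice"
    "HOL-Library.Poly_Mapping"
    "HOL-Computational_Algebra.Polynomial"
    "HOL-Computational_Algebra.Fraction_Field"
begin

section \<open>Root systems\<close>

definition coroot :: "real ^ 'n \<Rightarrow> real ^ 'n" where
  "coroot \<beta> = (2 / (\<beta> \<bullet> \<beta>)) *\<^sub>R \<beta>"

definition root_reflection :: "real ^ 'n \<Rightarrow> real ^ 'n \<Rightarrow> real ^ 'n" where
  "root_reflection \<beta> x = x - (x \<bullet> coroot \<beta>) *\<^sub>R \<beta>"

text \<open>Finite, reduced and crystallographic.  The ambient space is the span of the roots, so its
  dimension is the rank.\<close>

definition root_system :: "(real ^ 'n) set \<Rightarrow> bool" where
  "root_system \<Phi> \<longleftrightarrow>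
     finite \<Phi> \<and> 0 \<notin> \<Phi> \<and> span \<Phi> = UNIV \<and>
     (\<forall>\<beta>\<in>\<Phi>. root_reflection \<beta> ` \<Phi> = \<Phi>) \<and>
     (\<forall>\<beta>\<in>\<Phi>. \<forall>\<gamma>\<in>\<Phi>. \<gamma> \<bullet> coroot \<beta> \<in> \<int>) \<and>
     (\<forall>\<beta>\<in>\<Phi>. \<forall>c. c *\<^sub>R \<beta> \<in> \<Phi> \<longrightarrow> c = 1 \<or> c = -1)"

definition irreducible_root_system :: "(real ^ 'n) set \<Rightarrow> bool" where
  "irreducible_root_system \<Phi> \<longleftrightarrow>
     root_system \<Phi> \<and> \<Phi> \<noteq> {} \<and>
     (\<nexists>\<Phi>\<^sub>1 \<Phi>\<^sub>2. \<Phi>\<^sub>1 \<noteq> {} \<and> \<Phi>\<^sub>2 \<noteq> {} \<and> \<Phi> = \<Phi>\<^sub>1 \<union> \<Phi>\<^sub>2 \<and> (\<forall>\<beta>\<in>\<Phi>\<^sub>1. \<forall>\<gamma>\<in>\<Phi>\<^sub>2. \<beta> \<bullet> \<gamma> = 0))"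

definition simple_system :: "(real ^ 'n) set \<Rightarrow> ('i::finite \<Rightarrow> real ^ 'n) \<Rightarrow> bool" where
  "simple_system \<Phi> \<alpha> \<longleftrightarrow>
     inj \<alpha> \<and> range \<alpha> \<subseteq> \<Phi> \<and> independent (range \<alpha>) \<and>
     (\<forall>\<beta>\<in>\<Phi>. \<exists>c :: 'i \<Rightarrow> nat.
        \<beta> = (\<Sum>i\<in>UNIV. real (c i) *\<^sub>R \<alpha> i) \<or> \<beta> = - (\<Sum>i\<in>UNIV. real (c i) *\<^sub>R \<alpha> i))"

text \<open>Closing under left multiplication by reflections already yields the generated group, since
  reflections are involutions.\<close>

inductive_set weyl_group :: "(real ^ 'n) set \<Rightarrow> (real ^ 'n \<Rightarrow> real ^ 'n) set"
  for \<Phi> :: "(real ^ 'n) set" where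
  weyl_id: "id \<in> weyl_group \<Phi>"
| weyl_reflection: "\<beta> \<in> \<Phi> \<Longrightarrow> w \<in> weyl_group \<Phi> \<Longrightarrow> root_reflection \<beta> \<circ> w \<in> weyl_group \<Phi>"

definition fundamental_weight :: "('i::finite \<Rightarrow> real ^ 'n) \<Rightarrow> 'i \<Rightarrow> real ^ 'n" where
  "fundamental_weight \<alpha> i = (THE \<mu>. \<forall>j. \<mu> \<bullet> coroot (\<alpha> j) = (if j = i then 1 else 0))"

definition weight_lattice :: "('i::finite \<Rightarrow> real ^ 'n) \<Rightarrow> (real ^ 'n) set" where
  "weight_lattice \<alpha> = range (\<lambda>c :: 'i \<Rightarrow> int. \<Sum>i\<in>UNIV. of_int (c i) *\<^sub>R fundamental_weight \<alpha> i)"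

definition weyl_vector :: "('i::finite \<Rightarrow> real ^ 'n) \<Rightarrow> real ^ 'n" where
  "weyl_vector \<alpha> = (\<Sum>i\<in>UNIV. fundamental_weight \<alpha> i)"

definition dominant_weight :: "('i::finite \<Rightarrow> real ^ 'n) \<Rightarrow> real ^ 'n \<Rightarrow> bool" where
  "dominant_weight \<alpha> \<mu> \<longleftrightarrow> \<mu> \<in> weight_lattice \<alpha> \<and> (\<forall>i. 0 \<le> \<mu> \<bullet> coroot (\<alpha> i))"

definition minuscule_weight ::
    "(real ^ 'n) set \<Rightarrow> ('i::finite \<Rightarrow> real ^ 'n) \<Rightarrow> real ^ 'n \<Rightarrow> bool" where
  "minuscule_weight \<Phi> \<alpha> \<mu> \<longleftrightarrow>
     \<mu> \<in> weight_lattice \<alpha> \<and> \<mu> \<noteq> 0 \<and> (\<forall>\<beta>\<in>\<Phi>. \<mu> \<bullet> coroot \<beta> \<in> {-1, 0, 1})"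

section \<open>Weyl bialternants\<close>

text \<open>The group ring of the weight lattice consists of the elements of \<open>(real ^ 'n) \<Rightarrow>\<^sub>0 int\<close>
  (whose multiplication is convolution) supported on the weight lattice.\<close>

definition group_ring_exp :: "real ^ 'n \<Rightarrow> (real ^ 'n) \<Rightarrow>\<^sub>0 int" where
  "group_ring_exp \<mu> = Poly_Mapping.single \<mu> 1"

text \<open>The floor only coerces to \<open>int\<close>: the determinant of a Weyl group element is \<open>1\<close> or \<open>-1\<close>.\<close>

definition alternant :: "(real ^ 'n) set \<Rightarrow> real ^ 'n \<Rightarrow> (real ^ 'n) \<Rightarrow>\<^sub>0 int" where
  "alternant \<Phi> \<mu> = (\<Sum>w\<in>weyl_group \<Phi>. of_int \<lfloor>det (matrix w)\<rfloor> * group_ring_exp (w \<mu>))"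

definition weyl_bialternant ::
    "(real ^ 'n) set \<Rightarrow> ('i::finite \<Rightarrow> real ^ 'n) \<Rightarrow> real ^ 'n \<Rightarrow> (real ^ 'n) \<Rightarrow>\<^sub>0 int" where
  "weyl_bialternant \<Phi> \<alpha> \<mu> =
     (THE f. Poly_Mapping.keys f \<subseteq> weight_lattice \<alpha> \<and>
        alternant \<Phi> (weyl_vector \<alpha>) * f = alternant \<Phi> (\<mu> + weyl_vector \<alpha>))"

section \<open>Posets and colored posets\<close>

text \<open>Only the values of the colorings on elements of the carrier, respectively on pairs related
  by a covering, are meaningful.\<close>

record ('a, 'i) vertex_colored_poset = "'a gorder" +
  vertex_color :: "'a \<Rightarrow> 'i"

record ('a, 'i) edge_colored_poset = "'a gorder" +
  edge_color :: "'a \<Rightarrow> 'a \<Rightarrow> 'i"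

definition covered_by :: "('a, 'm) gorder_scheme \<Rightarrow> 'a \<Rightarrow> 'a \<Rightarrow> bool" where
  "covered_by R x y \<longleftrightarrow>
     x \<in> carrier R \<and> y \<in> carrier R \<and> x \<sqsubset>\<^bsub>R\<^esub> y \<and> \<not> (\<exists>z\<in>carrier R. x \<sqsubset>\<^bsub>R\<^esub> z \<and> z \<sqsubset>\<^bsub>R\<^esub> y)"

definition colored_edge :: "('a, 'i) edge_colored_poset \<Rightarrow> 'i \<Rightarrow> 'a \<Rightarrow> 'a \<Rightarrow> bool" where
  "colored_edge R i x y \<longleftrightarrow> covered_by R x y \<and> edge_color R x y = i"

definition poset_of_edges :: "'a set \<Rightarrow> ('a \<Rightarrow> 'a \<Rightarrow> bool) \<Rightarrow> 'a gorder" where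
  "poset_of_edges A E =
     \<lparr>carrier = A, eq = (=), le = (\<lambda>x y. x \<in> A \<and> y \<in> A \<and> E x y)\<^sup>*\<^sup>*\<rparr>"

definition chain_poset :: "nat \<Rightarrow> nat gorder" where
  "chain_poset M = \<lparr>carrier = {..<M}, eq = (=), le = (\<le>)\<rparr>"

definition prod_poset ::
    "('a, 'm) gorder_scheme \<Rightarrow> ('b, 'k) gorder_scheme \<Rightarrow> ('a \<times> 'b) gorder" where
  "prod_poset P Q =
     \<lparr>carrier = carrier P \<times> carrier Q, eq = (=),
      le = (\<lambda>(x, k) (y, l). x \<sqsubseteq>\<^bsub>P\<^esub> y \<and> k \<sqsubseteq>\<^bsub>Q\<^esub> l)\<rparr>"

definition colored_prod_chain ::
    "('a, 'i) vertex_colored_poset \<Rightarrow> nat \<Rightarrow> ('a \<times> nat, 'i) vertex_colored_poset" where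
  "colored_prod_chain P M =
     gorder.extend (prod_poset P (chain_poset M))
       (vertex_colored_poset.fields (\<lambda>(v, k). vertex_color P v))"

definition order_ideals :: "('a, 'm) gorder_scheme \<Rightarrow> 'a set set" where
  "order_ideals P =
     {X. X \<subseteq> carrier P \<and> (\<forall>x\<in>X. \<forall>y\<in>carrier P. y \<sqsubseteq>\<^bsub>P\<^esub> x \<longrightarrow> y \<in> X)}"

definition ideal_lattice :: "('a, 'm) gorder_scheme \<Rightarrow> 'a set gorder" where
  "ideal_lattice P = \<lparr>carrier = order_ideals P, eq = (=), le = (\<subseteq>)\<rparr>"

definition colored_ideal_lattice ::
    "('a, 'i) vertex_colored_poset \<Rightarrow> ('a set, 'i) edge_colored_poset" where
  "colored_ideal_lattice P =
     gorder.extend (ideal_lattice P)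
       (edge_colored_poset.fields (\<lambda>X Y. vertex_color P (the_elem (Y - X))))"

text \<open>The inherited order is unchanged; only the carrier is restricted.\<close>

definition join_irreducibles ::
    "('a, 'i) edge_colored_poset \<Rightarrow> ('a, 'i) vertex_colored_poset" where
  "join_irreducibles R =
     \<lparr>carrier = {x \<in> carrier R. \<exists>!y. covered_by R y x}, eq = (=), le = le R,
      vertex_color = (\<lambda>x. edge_color R (THE y. covered_by R y x) x)\<rparr>"

definition distributive_lattice :: "('a, 'm) gorder_scheme \<Rightarrow> bool" where
  "distributive_lattice L \<longleftrightarrow>
     lattice L \<and>
     (\<forall>x\<in>carrier L. \<forall>y\<in>carrier L. \<forall>z\<in>carrier L.
        x \<sqinter>\<^bsub>L\<^esub> (y \<squnion>\<^bsub>L\<^esub> z) = (x \<sqinter>\<^bsub>L\<^esub> y) \<squnion>\<^bsub>L\<^esub> (x \<sqinter>\<^bsub>L\<^esub> z))"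

definition diamond_colored :: "('a, 'i) edge_colored_poset \<Rightarrow> bool" where
  "diamond_colored R \<longleftrightarrow>
     (\<forall>s t u v. t \<noteq> u \<and> covered_by R s t \<and> covered_by R s u \<and> covered_by R t v \<and> covered_by R u v \<longrightarrow>
        edge_color R s t = edge_color R u v \<and> edge_color R s u = edge_color R t v)"

section \<open>Ranks and weights\<close>

definition rank_function :: "('a, 'm) gorder_scheme \<Rightarrow> ('a \<Rightarrow> nat) \<Rightarrow> bool" where
  "rank_function R \<rho> \<longleftrightarrow>
     (\<exists>l. \<rho> ` carrier R = {0..l}) \<and> (\<forall>x y. covered_by R x y \<longrightarrow> \<rho> y = \<rho> x + 1)"

definition ranked_poset :: "('a, 'm) gorder_scheme \<Rightarrow> bool" where
  "ranked_poset R \<longleftrightarrow> partial_order R \<and> finite (carrier R) \<and> (\<exists>\<rho>. rank_function R \<rho>)"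

text \<open>On a ranked poset whose Hasse diagram is connected the rank function is unique on the carrier.
  Below it is only applied to such posets: lattices of order ideals and monochromatic components.\<close>

definition poset_rank :: "('a, 'm) gorder_scheme \<Rightarrow> 'a \<Rightarrow> nat" where
  "poset_rank R = (SOME \<rho>. rank_function R \<rho>)"

definition poset_length :: "('a, 'm) gorder_scheme \<Rightarrow> nat" where
  "poset_length R = Max (poset_rank R ` carrier R)"

definition color_component :: "('a, 'i) edge_colored_poset \<Rightarrow> 'i \<Rightarrow> 'a \<Rightarrow> 'a gorder" where
  "color_component R i x =
     poset_of_edges {y. (\<lambda>u v. colored_edge R i u v \<or> colored_edge R i v u)\<^sup>*\<^sup>* x y}
       (colored_edge R i)"

definition color_mass :: "('a, 'i) edge_colored_poset \<Rightarrow> 'i \<Rightarrow> 'a \<Rightarrow> int" where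
  "color_mass R i x =
     2 * int (poset_rank (color_component R i x) x) - int (poset_length (color_component R i x))"

definition poset_weight ::
    "('i::finite \<Rightarrow> real ^ 'n) \<Rightarrow> ('a, 'i) edge_colored_poset \<Rightarrow> 'a \<Rightarrow> real ^ 'n" where
  "poset_weight \<alpha> R x = (\<Sum>i\<in>UNIV. of_int (color_mass R i x) *\<^sub>R fundamental_weight \<alpha> i)"

definition splitting_poset ::
    "(real ^ 'n) set \<Rightarrow> ('i::finite \<Rightarrow> real ^ 'n) \<Rightarrow> real ^ 'n \<Rightarrow> ('a, 'i) edge_colored_poset \<Rightarrow> bool" where
  "splitting_poset \<Phi> \<alpha> \<mu> R \<longleftrightarrow>
     ranked_poset R \<and>
     (\<forall>i s t. colored_edge R i s t \<longrightarrow> poset_weight \<alpha> R s + \<alpha> i = poset_weight \<alpha> R t) \<and>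
     (\<Sum>x\<in>carrier R. group_ring_exp (poset_weight \<alpha> R x)) = weyl_bialternant \<Phi> \<alpha> \<mu>"

definition splitting_distributive_lattice ::
    "(real ^ 'n) set \<Rightarrow> ('i::finite \<Rightarrow> real ^ 'n) \<Rightarrow> real ^ 'n \<Rightarrow> ('a, 'i) edge_colored_poset \<Rightarrow> bool" where
  "splitting_distributive_lattice \<Phi> \<alpha> \<mu> R \<longleftrightarrow> splitting_poset \<Phi> \<alpha> \<mu> R \<and> distributive_lattice R"

section \<open>Minuscule compression posets and Gaussian posets\<close>

text \<open>The edges \<open>\<mu> \<rightarrow> \<mu> + \<alpha> i\<close> are exactly the covering relations of the order they generate,
  because each of them raises the height by one.\<close>

definition minuscule_splitting_lattice ::
    "(real ^ 'n) set \<Rightarrow> ('i::finite \<Rightarrow> real ^ 'n) \<Rightarrow> real ^ 'n \<Rightarrow> (real ^ 'n, 'i) edge_colored_poset" where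
  "minuscule_splitting_lattice \<Phi> \<alpha> \<omega> =
     gorder.extend
       (poset_of_edges ((\<lambda>w. w \<omega>) ` weyl_group \<Phi>) (\<lambda>\<mu> \<nu>. \<exists>i. \<mu> + \<alpha> i = \<nu>))
       (edge_colored_poset.fields (\<lambda>\<mu> \<nu>. THE i. \<mu> + \<alpha> i = \<nu>))"

definition minuscule_compression_poset ::
    "(real ^ 'n) set \<Rightarrow> ('i::finite \<Rightarrow> real ^ 'n) \<Rightarrow> real ^ 'n \<Rightarrow> (real ^ 'n, 'i) vertex_colored_poset" where
  "minuscule_compression_poset \<Phi> \<alpha> \<omega> = join_irreducibles (minuscule_splitting_lattice \<Phi> \<alpha> \<omega>)"

definition minuscule_multiple_lattice ::
    "(real ^ 'n) set \<Rightarrow> ('i::finite \<Rightarrow> real ^ 'n) \<Rightarrow> real ^ 'n \<Rightarrow> nat \<Rightarrow>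
      (((real ^ 'n) \<times> nat) set, 'i) edge_colored_poset" where
  "minuscule_multiple_lattice \<Phi> \<alpha> \<omega> M =
     colored_ideal_lattice (colored_prod_chain (minuscule_compression_poset \<Phi> \<alpha> \<omega>) M)"

definition RGF :: "('a, 'm) gorder_scheme \<Rightarrow> int poly" where
  "RGF R = (\<Sum>x\<in>carrier R. monom 1 (poset_rank R x))"

text \<open>The product formula is an identity in the field of rational functions in \<open>q\<close>.\<close>

definition gaussian_poset :: "('a, 'm) gorder_scheme \<Rightarrow> bool" where
  "gaussian_poset P \<longleftrightarrow>
     partial_order P \<and> finite (carrier P) \<and>
     (\<exists>(r :: nat) (h :: nat \<Rightarrow> nat). 0 < r \<and> (\<forall>i\<in>{1..r}. 0 < h i) \<and>
        (\<forall>M>0. Fract (RGF (ideal_lattice (prod_poset P (chain_poset M)))) 1 =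
           (\<Prod>i = 1..r. Fract (1 - monom 1 (M + h i)) (1 - monom 1 (h i)))))"

end

(*
The character. For minuscule omega, the ideals of P(omega) x C_M are the multichains
x_1 <= ... <= x_M in the orbit W omega, where x <= y means that y - x is a nonnegative combination
of simple roots, and the weight of an ideal is x_1 + ... + x_M. Let F_m(x) be the sum of
e^(x_1 + ... + x_m) over the multichains above x. If <x, alpha_i^v> = -1, then F_m(x) is the
Demazure operator D_i applied to F_m(x + alpha_i); this is proved by induction on m, using the
twisted Leibniz rule for D_i and the way in which the upper sets of x and of x + alpha_i meet the
alpha_i-strings of the orbit. In particular F_m(x) is then s_i-invariant. Hence the total sum is
W-invariant, and in the alternating sum of e^rho times the total sum every first element x other
than omega drops out, because e^(rho + x) F_m(x) is fixed by some s_i. What remains is the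
alternant of M omega + rho.

The weights. The orbit is closed under coordinatewise minima with respect to the simple roots. So a
join irreducible of color i lies below y if and only if its i-th coordinate is at most that of y,
which yields Birkhoff's correspondence between the orbit and the ideals of P(omega), with the
colors.

The Gaussian property. Under the principal specialisation e^mu -> q^<mu, rho^v> both alternants
factor by the Weyl denominator formula for the coroots; only the positive roots beta with
<omega, beta^v> = 1 survive in the quotient, with h = <rho, beta^v>.

Elements of the group ring are handled through the functions v -> sum of c_mu exp(mu . v), which
determine them because exponentials with distinct exponents are linearly independent.
*)
theory Submission
  imports Defs
begin

section \<open>Reflections\<close>

text \<open>The total sum is invariant only as a whole, whereas the cancellation against the
  alternating signs has to happen for each least element x separately. The Demazure relation serves
  both purposes: whatever D_i produces is fixed by s_i, and the pairing -1 of x with a simple coroot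
  is exactly offset by the pairing 1 of rho. Minuscule weights have strings of at most two elements,
  so the Leibniz rule leaves only two cases per string.

  No classification by type enters. Every descent, from roots to simple roots, along the edges of
  the orbit, or towards coordinatewise minima, rests on one fact about simple roots: a vector with
  some positive coordinate has a positive coordinate i for which its inner product with alpha_i is
  positive as well (\<open>exists_pos_cf_pos_inner\<close>).

  Coroots appear in the Gaussian property because an alternant is symmetric in exponent and
  argument. Evaluating it along rho^v turns it into the alternant of rho^v, and this is the one that
  factors. The leftover power of q is found from the behaviour as q tends to 0, so the lowest weight
  never has to be computed.\<close>

lemma inner_coroot: "x \<bullet> coroot \<beta> = 2 * (x \<bullet> \<beta>) / (\<beta> \<bullet> \<beta>)"
  by (simp add: coroot_def)

lemma linear_root_reflection: "linear (root_reflection \<beta>)"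
  unfolding root_reflection_def
  by (rule linearI) (auto simp: inner_add_left inner_scaleR_left algebra_simps)

lemma root_reflection_inner: "root_reflection \<beta> x \<bullet> root_reflection \<beta> y = x \<bullet> y"
proof (cases "\<beta> = 0")
  case False
  then have "\<beta> \<bullet> \<beta> \<noteq> 0" by simp
  then show ?thesis
    by (simp add: root_reflection_def inner_coroot inner_diff_left inner_diff_right
        inner_commute field_simps)
qed (simp add: root_reflection_def)

lemma root_reflection_involution [simp]: "root_reflection \<beta> (root_reflection \<beta> x) = x"
proof (cases "\<beta> = 0")
  case False
  then have "\<beta> \<bullet> \<beta> \<noteq> 0" by simp
  then show ?thesis
    by (simp add: root_reflection_def inner_coroot inner_diff_left field_simps flip: scaleR_left_distrib)
qed (simp add: root_reflection_def)

lemma root_reflection_comp_self [simp]: "root_reflection \<beta> \<circ> root_reflection \<beta> = id"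
  by (simp add: fun_eq_iff)

lemma orthogonal_root_reflection: "orthogonal_transformation (root_reflection \<beta>)"
  by (simp add: orthogonal_transformation_def linear_root_reflection root_reflection_inner)

lemma root_reflection_self_adjoint: "root_reflection \<beta> x \<bullet> y = x \<bullet> root_reflection \<beta> y"
  by (metis root_reflection_inner root_reflection_involution)

lemma coroot_orthogonal:
  assumes "orthogonal_transformation f"
  shows "coroot (f \<beta>) = f (coroot \<beta>)"
  using assms by (simp add: coroot_def orthogonal_transformation_def linear_scale)

lemma root_reflection_orthogonal:
  assumes "orthogonal_transformation f"
  shows "root_reflection (f \<beta>) (f x) = f (root_reflection \<beta> x)"
  using assms
  by (simp add: root_reflection_def coroot_orthogonal orthogonal_transformation_def
      linear_scale linear_diff)

lemma root_reflection_self: "\<beta> \<noteq> 0 \<Longrightarrow> root_reflection \<beta> \<beta> = - \<beta>"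
  by (simp add: root_reflection_def inner_coroot algebra_simps flip: scaleR_left_distrib)
     (simp add: scaleR_2)

text \<open>An orthogonal matrix carrying a basis vector to the unit vector along
  \<open>\<beta>\<close> conjugates the reflection to a diagonal matrix with a single entry -1. The
  conjugation contributes only the square of a determinant 1 or -1.\<close>

lemma det_root_reflection:
  fixes \<beta> :: "real ^ 'n"
  assumes "\<beta> \<noteq> 0"
  shows "det (matrix (root_reflection \<beta>)) = - 1"
proof -
  fix k :: 'n
  define a where "a = (1 / norm \<beta>) *\<^sub>R \<beta>"
  have na: "norm a = 1" using assms by (simp add: a_def)
  then obtain A where A: "orthogonal_matrix A" "A *v axis k 1 = a"
    using orthogonal_matrix_exists_basis by metis
  define e :: "real^'n" where "e = axis k 1"
  define D :: "real^'n^'n" where "D = (\<chi> i j. if i = j then (if i = k then -1 else 1) else 0)"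
  have "norm e = 1" by (simp add: e_def norm_axis_1)
  then have ee: "e \<bullet> e = 1" by (simp add: norm_eq_1)
  have D: "D *v x = root_reflection e x" for x
  proof -
    have "x \<bullet> e = x $ k" by (simp add: e_def inner_axis)
    moreover have "e $ i = (if i = k then 1 else 0)" for i by (simp add: e_def axis_def)
    ultimately show ?thesis
      by (auto simp: vec_eq_iff root_reflection_def inner_coroot ee D_def matrix_vector_mult_def
       if_distrib[where f = "\<lambda>z. z * _"] cong: if_cong)
  qed
  have oA: "orthogonal_transformation ((*v) A)" using A(1)
    using orthogonal_transformation_matrix matrix_of_matrix_vector_mul by (metis matrix_vector_mul_linear)
  have s: "root_reflection \<beta> = root_reflection a"
    using assms by (auto simp: fun_eq_iff root_reflection_def inner_coroot a_def dot_square_norm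
       power2_eq_square field_simps)
  have "root_reflection \<beta> x = A *v (D *v (transpose A *v x))" for x
  proof -
    have "A *v (transpose A *v x) = x"
      using A(1) by (simp add: matrix_vector_mul_assoc orthogonal_matrix_def del: transpose_matrix_vector)
    then have "root_reflection a x = root_reflection (A *v e) (A *v (transpose A *v x))"
      using A(2) by (simp add: e_def)
    also have "\<dots> = A *v (D *v (transpose A *v x))"
      using root_reflection_orthogonal[OF oA] D by simp
    finally show ?thesis using s by simp
  qed
  then have "root_reflection \<beta> = (\<lambda>x. (A ** D ** transpose A) *v x)"
    by (simp add: fun_eq_iff matrix_vector_mul_assoc matrix_mul_assoc del: transpose_matrix_vector)
  then have "matrix (root_reflection \<beta>) = A ** D ** transpose A"
    by simp
  then have "det (matrix (root_reflection \<beta>)) = det A * det D * det A"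
    by (simp add: det_mul det_transpose)
  moreover have "det A * det A = 1"
    using det_orthogonal_matrix[OF A(1)] by auto
  moreover have "det D = (\<Prod>i\<in>UNIV. D $ i $ i)"
    by (rule det_diagonal) (simp add: D_def)
  moreover have "(\<Prod>i\<in>UNIV. D $ i $ i) = -1"
    by (simp add: D_def prod.If_cases)
  ultimately show ?thesis by (simp add: mult.commute mult.left_commute)
qed

section \<open>Exponential sums\<close>

text \<open>Among the exponents with nonzero coefficient let \<open>m\<close> have the largest norm.
  The inner product with \<open>m\<close> is then maximal at \<open>m\<close> alone, so along the
  ray through \<open>m\<close>, after division by the dominant exponential, only \<open>c m\<close>
  survives in the limit.\<close>

lemma exp_sum_independent:
  fixes c :: "real ^ 'n \<Rightarrow> real"
  assumes fin: "finite S" and zero: "\<And>v. (\<Sum>\<mu>\<in>S. c \<mu> * exp (\<mu> \<bullet> v)) = 0" and "\<nu> \<in> S"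
  shows "c \<nu> = 0"
proof (rule ccontr)
  assume "c \<nu> \<noteq> 0"
  define T where "T = {\<mu>\<in>S. c \<mu> \<noteq> 0}"
  have T: "finite T" "T \<noteq> {}" using fin \<open>\<nu> \<in> S\<close> \<open>c \<nu> \<noteq> 0\<close> by (auto simp: T_def)
  obtain m where m: "m \<in> T" "\<And>\<mu>. \<mu> \<in> T \<Longrightarrow> norm \<mu> \<le> norm m"
  proof -
    have "Max (norm ` T) \<in> norm ` T" using T by (intro Max_in) auto
    then obtain m where "m \<in> T" "norm m = Max (norm ` T)" by auto
    then show thesis using T(1) that[of m] by simp
  qed
  have less: "\<mu> \<bullet> m < m \<bullet> m" if "\<mu> \<in> T" "\<mu> \<noteq> m" for \<mu>
  proof -
    have "0 < (\<mu> - m) \<bullet> (\<mu> - m)" using that by simp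
    also have "\<dots> = \<mu> \<bullet> \<mu> + m \<bullet> m - 2 * (\<mu> \<bullet> m)"
      by (simp add: inner_diff_left inner_diff_right inner_commute)
    also have "\<mu> \<bullet> \<mu> \<le> m \<bullet> m" using m(2)[OF that(1)] by (simp add: norm_le)
    finally show ?thesis by simp
  qed
  have "((\<lambda>t. \<Sum>\<mu>\<in>T. c \<mu> * exp (t * (\<mu> \<bullet> m - m \<bullet> m))) \<longlongrightarrow> (\<Sum>\<mu>\<in>T. if \<mu> = m then c m else 0)) at_top"
  proof (rule tendsto_sum)
    fix \<mu> assume \<mu>: "\<mu> \<in> T"
    show "((\<lambda>t. c \<mu> * exp (t * (\<mu> \<bullet> m - m \<bullet> m))) \<longlongrightarrow> (if \<mu> = m then c m else 0)) at_top"
    proof (cases "\<mu> = m")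
      case False
      define d where "d = \<mu> \<bullet> m - m \<bullet> m"
      have "d < 0" using less[OF \<mu> False] by (simp add: d_def)
      have "filterlim (\<lambda>t. d * t) at_bot at_top"
        by (rule filterlim_tendsto_neg_mult_at_bot[OF tendsto_const \<open>d < 0\<close> filterlim_ident])
      then have "((\<lambda>t. exp (d * t)) \<longlongrightarrow> 0) at_top"
        using exp_at_bot filterlim_compose by blast
      then have "((\<lambda>t. c \<mu> * exp (t * d)) \<longlongrightarrow> 0) at_top"
        using tendsto_mult_right_zero by (simp add: mult.commute[of d] tendsto_mult_right_zero)
      then show ?thesis using False by (simp add: d_def)
    qed simp
  qed
  moreover have "(\<Sum>\<mu>\<in>T. c \<mu> * exp (t * (\<mu> \<bullet> m - m \<bullet> m))) = 0" for t
  proof -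
    have "(\<Sum>\<mu>\<in>T. c \<mu> * exp (t * (\<mu> \<bullet> m - m \<bullet> m)))
        = exp (- (t * (m \<bullet> m))) * (\<Sum>\<mu>\<in>T. c \<mu> * exp (\<mu> \<bullet> (t *\<^sub>R m)))"
      by (simp add: sum_distrib_left mult_ac right_diff_distrib flip: exp_add)
    also have "(\<Sum>\<mu>\<in>T. c \<mu> * exp (\<mu> \<bullet> (t *\<^sub>R m))) = (\<Sum>\<mu>\<in>S. c \<mu> * exp (\<mu> \<bullet> (t *\<^sub>R m)))"
      unfolding T_def by (rule sum.mono_neutral_left) (use fin in auto)
    finally show ?thesis using zero[of "t *\<^sub>R m"] by simp
  qed
  ultimately have "((\<lambda>t::real. 0) \<longlongrightarrow> c m) at_top" using T(1) m(1) by simp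
  then have "c m = 0" by (simp add: tendsto_const_iff)
  then show False using m(1) by (simp add: T_def)
qed

definition expsum :: "((real ^ 'n) \<Rightarrow>\<^sub>0 int) \<Rightarrow> real ^ 'n \<Rightarrow> real" where
  "expsum f v = (\<Sum>\<mu>\<in>Poly_Mapping.keys f. of_int (Poly_Mapping.lookup f \<mu>) * exp (\<mu> \<bullet> v))"

lemma expsum_superset:
  assumes "finite A" "Poly_Mapping.keys f \<subseteq> A"
  shows "expsum f v = (\<Sum>\<mu>\<in>A. of_int (Poly_Mapping.lookup f \<mu>) * exp (\<mu> \<bullet> v))"
  unfolding expsum_def
  by (rule sum.mono_neutral_left) (use assms in \<open>auto simp: in_keys_iff\<close>)

lemma expsum_add: "expsum (f + g) v = expsum f v + expsum g v"
proof -
  let ?A = "Poly_Mapping.keys f \<union> Poly_Mapping.keys g"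
  have "expsum h v = (\<Sum>\<mu>\<in>?A. of_int (Poly_Mapping.lookup h \<mu>) * exp (\<mu> \<bullet> v))"
    if "h \<in> {f, g, f + g}" for h
    by (rule expsum_superset) (use that keys_add[of f g] in auto)
  then show ?thesis by (simp add: lookup_add sum.distrib distrib_right)
qed

lemma expsum_zero [simp]: "expsum 0 v = 0"
  by (simp add: expsum_def)

lemma expsum_sum: "expsum (\<Sum>x\<in>A. f x) v = (\<Sum>x\<in>A. expsum (f x) v)"
  by (induction A rule: infinite_finite_induct) (auto simp: expsum_add)

lemma expsum_single: "expsum (Poly_Mapping.single \<mu> c) v = of_int c * exp (\<mu> \<bullet> v)"
  by (cases "c = 0") (auto simp: expsum_def)

lemma poly_mapping_sum_single:
  "f = (\<Sum>k\<in>Poly_Mapping.keys f. Poly_Mapping.single k (Poly_Mapping.lookup f k))"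
  by (rule poly_mapping_eqI) (auto simp: lookup_sum lookup_single when_def in_keys_iff)

lemma expsum_mult: "expsum (f * g) v = expsum f v * expsum g v"
proof -
  have "f * g = (\<Sum>k\<in>Poly_Mapping.keys f. \<Sum>l\<in>Poly_Mapping.keys g.
      Poly_Mapping.single (k + l) (Poly_Mapping.lookup f k * Poly_Mapping.lookup g l))"
    by (subst poly_mapping_sum_single[of f], subst poly_mapping_sum_single[of g])
       (simp add: sum_product mult_single)
  then show ?thesis
    by (simp add: expsum_sum expsum_single inner_add_left exp_add)
       (simp add: expsum_def sum_product mult_ac)
qed

lemma expsum_inject:
  assumes "\<And>v. expsum f v = expsum g v"
  shows "f = g"
proof (rule poly_mapping_eqI)
  fix \<nu>
  let ?A = "insert \<nu> (Poly_Mapping.keys f \<union> Poly_Mapping.keys g)"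
  have "(\<Sum>\<mu>\<in>?A. (of_int (Poly_Mapping.lookup f \<mu>) - of_int (Poly_Mapping.lookup g \<mu>)) * exp (\<mu> \<bullet> v)) = 0" for v
  proof -
    have "expsum f v = (\<Sum>\<mu>\<in>?A. of_int (Poly_Mapping.lookup f \<mu>) * exp (\<mu> \<bullet> v))"
         "expsum g v = (\<Sum>\<mu>\<in>?A. of_int (Poly_Mapping.lookup g \<mu>) * exp (\<mu> \<bullet> v))"
      by (auto intro!: expsum_superset)
    then show ?thesis using assms[of v] by (simp only: left_diff_distrib sum_subtractf)
  qed
  from exp_sum_independent[OF _ this, of \<nu>]
  show "Poly_Mapping.lookup f \<nu> = Poly_Mapping.lookup g \<nu>"
    by simp
qed

section \<open>Simple roots and coordinates\<close>

locale simple_roots =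
  fixes \<Phi> :: "(real ^ 'n) set" and \<alpha> :: "'i::finite \<Rightarrow> real ^ 'n"
  assumes root_system: "root_system \<Phi>" and simple_system: "simple_system \<Phi> \<alpha>"
begin

abbreviation s :: "'i \<Rightarrow> real ^ 'n \<Rightarrow> real ^ 'n" where
  "s i \<equiv> root_reflection (\<alpha> i)"

lemma finite_roots: "finite \<Phi>"
  and zero_notin_roots: "0 \<notin> \<Phi>"
  and span_roots: "span \<Phi> = UNIV"
  and root_reflection_image: "\<beta> \<in> \<Phi> \<Longrightarrow> root_reflection \<beta> ` \<Phi> = \<Phi>"
  and crystallographic: "\<beta> \<in> \<Phi> \<Longrightarrow> \<gamma> \<in> \<Phi> \<Longrightarrow> \<gamma> \<bullet> coroot \<beta> \<in> \<int>"
  and reduced: "\<beta> \<in> \<Phi> \<Longrightarrow> c *\<^sub>R \<beta> \<in> \<Phi> \<Longrightarrow> c = 1 \<or> c = -1"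
  using root_system by (auto simp: root_system_def)

lemma inj_alpha: "inj \<alpha>"
  and alpha_root [simp]: "\<alpha> i \<in> \<Phi>"
  and independent_alpha: "independent (range \<alpha>)"
  using simple_system by (auto simp: simple_system_def)

lemma root_expansion:
  "\<beta> \<in> \<Phi> \<Longrightarrow> \<exists>c :: 'i \<Rightarrow> nat. \<beta> = (\<Sum>i\<in>UNIV. real (c i) *\<^sub>R \<alpha> i) \<or> \<beta> = - (\<Sum>i\<in>UNIV. real (c i) *\<^sub>R \<alpha> i)"
  using simple_system by (auto simp: simple_system_def)

lemma root_nonzero: "\<beta> \<in> \<Phi> \<Longrightarrow> \<beta> \<noteq> 0"
  using zero_notin_roots by auto

lemma alpha_nonzero [simp]: "\<alpha> i \<noteq> 0"
  using root_nonzero[OF alpha_root] .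

lemma alpha_eq_iff [simp]: "\<alpha> i = \<alpha> j \<longleftrightarrow> i = j"
  using inj_alpha by (auto simp: inj_def)

lemma root_reflection_root: "\<beta> \<in> \<Phi> \<Longrightarrow> \<gamma> \<in> \<Phi> \<Longrightarrow> root_reflection \<beta> \<gamma> \<in> \<Phi>"
  using root_reflection_image by blast

lemma minus_root: "\<beta> \<in> \<Phi> \<Longrightarrow> - \<beta> \<in> \<Phi>"
  using root_reflection_root[of \<beta> \<beta>] root_reflection_self[of \<beta>] root_nonzero by auto

lemma span_alpha: "span (range \<alpha>) = UNIV"
proof -
  have "\<Phi> \<subseteq> span (range \<alpha>)"
  proof
    fix \<beta> assume "\<beta> \<in> \<Phi>"
    moreover have "(\<Sum>i\<in>UNIV. real (c i) *\<^sub>R \<alpha> i) \<in> span (range \<alpha>)" for c :: "'i \<Rightarrow> nat"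
      by (intro span_sum span_scale span_base) auto
    ultimately show "\<beta> \<in> span (range \<alpha>)"
      using root_expansion[of \<beta>] by (auto intro: span_neg)
  qed
  then show ?thesis using span_minimal[of \<Phi> "span (range \<alpha>)"] span_roots by auto
qed

lemma eq_if_alpha_inner:
  assumes "\<And>j. x \<bullet> \<alpha> j = y \<bullet> \<alpha> j"
  shows "x = y"
proof -
  have "orthogonal (x - y) z" for z
    by (rule orthogonal_to_span[of z "range \<alpha>"])
       (use assms span_alpha in \<open>auto simp: orthogonal_def inner_diff_left\<close>)
  then have "orthogonal (x - y) (x - y)" .
  then show ?thesis by (simp add: orthogonal_self)
qed

lemma eq_if_coroot_inner:
  assumes "\<And>j. x \<bullet> coroot (\<alpha> j) = y \<bullet> coroot (\<alpha> j)"
  shows "x = y"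
  by (rule eq_if_alpha_inner) (use assms in \<open>simp add: inner_coroot\<close>)

text \<open>The definite description needs a witness. The functional reading off the
  \<open>\<alpha> i\<close>-coordinate is represented by its adjoint at 1, and the factor
  \<open>(\<alpha> i \<bullet> \<alpha> i) / 2\<close> passes from roots to coroots.\<close>

lemma fundamental_weight_inner:
  "fundamental_weight \<alpha> i \<bullet> coroot (\<alpha> j) = (if j = i then 1 else 0)"
proof -
  define f where "f = (\<lambda>x. representation (range \<alpha>) x (\<alpha> i))"
  have "linear f"
    unfolding f_def
    by (rule linearI) (use independent_alpha span_alpha in \<open>simp_all add: representation_add representation_scale\<close>)
  then have f: "x \<bullet> adjoint f 1 = f x" for x
    by (simp add: adjoint_works)
  have fa: "f (\<alpha> j) = (if j = i then 1 else 0)" for j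
    using representation_basis[OF independent_alpha, of "\<alpha> j"] by (auto simp: f_def)
  define \<mu> where "\<mu> = ((\<alpha> i \<bullet> \<alpha> i) / 2) *\<^sub>R adjoint f 1"
  have \<mu>: "\<forall>j. \<mu> \<bullet> coroot (\<alpha> j) = (if j = i then 1 else 0)"
    by (auto simp: \<mu>_def coroot_def inner_commute[of "adjoint f 1"] f fa)
  have "\<forall>j. fundamental_weight \<alpha> i \<bullet> coroot (\<alpha> j) = (if j = i then 1 else 0)"
    unfolding fundamental_weight_def
    by (rule theI[of _ \<mu>], rule \<mu>) (rule eq_if_coroot_inner, use \<mu> in simp)
  then show ?thesis by blast
qed

lemma weight_expansion: "(\<Sum>i\<in>UNIV. (x \<bullet> coroot (\<alpha> i)) *\<^sub>R fundamental_weight \<alpha> i) = x"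
  by (rule eq_if_coroot_inner) (simp add: inner_sum_left fundamental_weight_inner if_distrib cong: if_cong)

text \<open>The coefficient of \<open>\<alpha> i\<close> in the basis of simple roots, by
  \<open>cf_expansion\<close>. Written as the inner product with a fundamental coweight, it is
  visibly linear.\<close>

definition cf :: "'i \<Rightarrow> real ^ 'n \<Rightarrow> real" where
  "cf i x = x \<bullet> ((2 / (\<alpha> i \<bullet> \<alpha> i)) *\<^sub>R fundamental_weight \<alpha> i)"

lemma cf_add: "cf i (x + y) = cf i x + cf i y"
  and cf_diff: "cf i (x - y) = cf i x - cf i y"
  and cf_scale: "cf i (c *\<^sub>R x) = c * cf i x"
  and cf_minus: "cf i (- x) = - cf i x"
  and cf_zero [simp]: "cf i 0 = 0"
  by (simp_all add: cf_def inner_add_left inner_diff_left field_simps)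

lemma cf_sum: "cf i (\<Sum>x\<in>A. f x) = (\<Sum>x\<in>A. cf i (f x))"
  by (simp add: cf_def inner_sum_left sum_distrib_left sum_divide_distrib)

lemma cf_alpha [simp]: "cf i (\<alpha> j) = (if i = j then 1 else 0)"
proof -
  have "cf i (\<alpha> j) = (\<alpha> j \<bullet> \<alpha> j) / (\<alpha> i \<bullet> \<alpha> i) * (fundamental_weight \<alpha> i \<bullet> coroot (\<alpha> j))"
    by (simp add: cf_def coroot_def inner_commute)
  then show ?thesis by (simp add: fundamental_weight_inner)
qed

lemmas cf_simps = cf_add cf_diff cf_scale cf_minus cf_sum

lemma cf_combination [simp]: "cf j (\<Sum>i\<in>UNIV. c i *\<^sub>R \<alpha> i) = c j"
  by (simp add: cf_simps if_distrib cong: if_cong)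

lemma cf_expansion: "(\<Sum>i\<in>UNIV. cf i x *\<^sub>R \<alpha> i) = x"
proof -
  have "linear (\<lambda>x. \<Sum>i\<in>UNIV. cf i x *\<^sub>R \<alpha> i)"
    by (rule linearI) (simp_all add: cf_simps scaleR_left_distrib sum.distrib scaleR_sum_right)
  then have "(\<Sum>i\<in>UNIV. cf i x *\<^sub>R \<alpha> i) = id x"
    by (rule linear_eq_on_span[of _ id "range \<alpha>"])
       (auto simp: span_alpha linear_id if_distrib[of "\<lambda>c. c *\<^sub>R _"] cong: if_cong)
  then show ?thesis by simp
qed

lemma cf_eqI: "(\<And>i. cf i x = cf i y) \<Longrightarrow> x = y"
  by (rule trans[OF cf_expansion[symmetric] trans[OF sum.cong[OF refl] cf_expansion]]) simp

lemma inner_expansion: "x \<bullet> y = (\<Sum>i\<in>UNIV. cf i y * (x \<bullet> \<alpha> i))"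
  by (subst cf_expansion[of y, symmetric]) (simp add: inner_sum_right)

lemma root_cf: "\<beta> \<in> \<Phi> \<Longrightarrow> (\<forall>i. cf i \<beta> \<ge> 0) \<or> (\<forall>i. cf i \<beta> \<le> 0)"
  by (use root_expansion[of \<beta>] in \<open>auto simp: cf_minus\<close>)

section \<open>Positive roots and signs of inner products\<close>

definition pos_roots :: "(real ^ 'n) set" where
  "pos_roots = {\<beta> \<in> \<Phi>. \<forall>i. cf i \<beta> \<ge> 0}"

lemma pos_roots_root: "\<beta> \<in> pos_roots \<Longrightarrow> \<beta> \<in> \<Phi>"
  and pos_roots_cf: "\<beta> \<in> pos_roots \<Longrightarrow> cf i \<beta> \<ge> 0"
  by (auto simp: pos_roots_def)

lemma finite_pos_roots: "finite pos_roots"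
  using finite_roots by (simp add: pos_roots_def)

lemma alpha_pos [simp]: "\<alpha> i \<in> pos_roots"
  by (simp add: pos_roots_def)

lemma pos_or_neg: "\<beta> \<in> \<Phi> \<Longrightarrow> \<beta> \<in> pos_roots \<or> - \<beta> \<in> pos_roots"
  using root_cf[of \<beta>] minus_root[of \<beta>] by (auto simp: pos_roots_def cf_minus)

lemma pos_root_exists_cf: "\<beta> \<in> pos_roots \<Longrightarrow> \<exists>i. cf i \<beta> > 0"
proof (rule ccontr)
  assume "\<beta> \<in> pos_roots" "\<nexists>i. cf i \<beta> > 0"
  then have "cf i \<beta> = cf i 0" for i
    by (metis cf_zero order_le_less pos_roots_cf)
  then have "\<beta> = 0" by (rule cf_eqI)
  then show False using \<open>\<beta> \<in> pos_roots\<close> zero_notin_roots pos_roots_root by blast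
qed

lemma not_pos_and_neg: "\<beta> \<in> pos_roots \<Longrightarrow> - \<beta> \<notin> pos_roots"
  using pos_root_exists_cf[of \<beta>] pos_roots_cf[of "- \<beta>"] by (auto simp: cf_minus not_less[symmetric])

lemma root_pos_if_cf: "\<beta> \<in> \<Phi> \<Longrightarrow> cf i \<beta> > 0 \<Longrightarrow> \<beta> \<in> pos_roots"
  using root_cf[of \<beta>] by (auto simp: pos_roots_def not_less[symmetric])

lemma cf_simple_reflection: "j \<noteq> i \<Longrightarrow> cf j (s i x) = cf j x"
  by (simp add: root_reflection_def cf_simps)

text \<open>Only the \<open>i\<close>-th coordinate changes. Since \<open>\<Phi>\<close> is reduced,
  a positive root other than \<open>\<alpha> i\<close> has another positive coordinate; it survives
  and determines the sign of the whole root.\<close>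

lemma simple_reflection_pos:
  assumes "\<beta> \<in> pos_roots" "\<beta> \<noteq> \<alpha> i"
  shows "s i \<beta> \<in> pos_roots"
proof -
  have "\<exists>j. j \<noteq> i \<and> cf j \<beta> > 0"
  proof (rule ccontr)
    assume "\<not> ?thesis"
    then have "\<And>j. j \<noteq> i \<Longrightarrow> cf j \<beta> = 0"
      using pos_roots_cf[OF assms(1)] by (metis order_le_less)
    then have "\<beta> = cf i \<beta> *\<^sub>R \<alpha> i" by (intro cf_eqI) (auto simp: cf_scale)
    then have "cf i \<beta> = 1 \<or> cf i \<beta> = -1"
      using reduced[OF alpha_root[of i], of "cf i \<beta>"] pos_roots_root[OF assms(1)] by metis
    then have "cf i \<beta> = 1" using pos_roots_cf[OF assms(1), of i] by auto
    then show False using \<open>\<beta> = cf i \<beta> *\<^sub>R \<alpha> i\<close> assms(2) by simp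
  qed
  then obtain j where "j \<noteq> i" "cf j \<beta> > 0" by blast
  then show ?thesis
    using root_pos_if_cf[of "s i \<beta>" j] root_reflection_root[of "\<alpha> i" \<beta>] pos_roots_root[OF assms(1)]
    by (simp add: cf_simple_reflection)
qed

text \<open>The \<open>\<alpha> j\<close>-coordinate of the positive root
  \<open>s j (\<alpha> i)\<close> is minus the pairing of \<open>\<alpha> i\<close> with the coroot
  of \<open>\<alpha> j\<close>.\<close>

lemma alpha_inner_nonpos: "i \<noteq> j \<Longrightarrow> \<alpha> i \<bullet> \<alpha> j \<le> 0"
  using pos_roots_cf[OF simple_reflection_pos[OF alpha_pos, of i j], of j]
    inner_gt_zero_iff[of "\<alpha> j", unfolded not_le[symmetric]]
  by (simp add: root_reflection_def cf_simps inner_coroot divide_le_0_iff)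

text \<open>Let \<open>a\<close> be the positive part of \<open>d\<close>. If the conclusion failed,
  \<open>d \<bullet> a\<close> would be nonpositive. So is \<open>(a - d) \<bullet> a\<close>,
  because positive and negative part have disjoint supports and distinct simple roots have
  nonpositive inner product. Together this gives \<open>a = 0\<close>.\<close>

lemma exists_pos_cf_pos_inner:
  assumes "\<exists>i. cf i d > 0"
  shows "\<exists>i. cf i d > 0 \<and> d \<bullet> \<alpha> i > 0"
proof (rule ccontr)
  assume neg: "\<not> ?thesis"
  define a where "a = (\<Sum>i\<in>UNIV. max 0 (cf i d) *\<^sub>R \<alpha> i)"
  have cfa: "cf i a = max 0 (cf i d)" for i by (simp add: a_def)
  have "d \<bullet> a = (\<Sum>i\<in>UNIV. max 0 (cf i d) * (d \<bullet> \<alpha> i))"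
    by (subst inner_expansion) (simp add: cfa)
  also have "\<dots> \<le> 0"
    using neg by (intro sum_nonpos) (force simp: max_def mult_le_0_iff not_less)
  finally have "d \<bullet> a \<le> 0" .
  moreover have "(a - d) \<bullet> a \<le> 0"
  proof -
    have "(a - d) \<bullet> a = (\<Sum>i\<in>UNIV. cf i a * (\<Sum>j\<in>UNIV. cf j (a - d) * (\<alpha> i \<bullet> \<alpha> j)))"
      by (subst inner_expansion, subst inner_commute, subst inner_expansion) (simp add: inner_commute)
    also have "\<dots> \<le> 0"
    proof (unfold sum_distrib_left, intro sum_nonpos)
      fix i j
      have "cf i a * cf j (a - d) = 0 \<or> i \<noteq> j" "cf i a * cf j (a - d) \<ge> 0"
        by (auto simp: cfa cf_diff max_def)
      then show "cf i a * (cf j (a - d) * (\<alpha> i \<bullet> \<alpha> j)) \<le> 0"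
        using alpha_inner_nonpos[of i j] by (auto simp: mult_le_0_iff zero_le_mult_iff)
    qed
    finally show ?thesis .
  qed
  ultimately have "a \<bullet> a \<le> 0" by (simp add: inner_diff_left)
  then have "a = 0" by (metis inner_eq_zero_iff inner_ge_zero order_antisym)
  then have "cf i d \<le> 0" for i using cfa[of i] by simp
  then show False using assms by (metis leD)
qed

end

section \<open>The Weyl group\<close>

context simple_roots
begin

abbreviation W :: "(real ^ 'n \<Rightarrow> real ^ 'n) set" where
  "W \<equiv> weyl_group \<Phi>"

lemma weyl_orthogonal: "w \<in> W \<Longrightarrow> orthogonal_transformation w"
proof (induction rule: weyl_group.induct)
  case (weyl_reflection \<beta> w)
  then show ?case using orthogonal_transformation_compose orthogonal_root_reflection by blast
qed (simp add: id_def)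

lemma weyl_inner: "w \<in> W \<Longrightarrow> w x \<bullet> w y = x \<bullet> y"
  using weyl_orthogonal by (auto simp: orthogonal_transformation_def)

lemma weyl_linear: "w \<in> W \<Longrightarrow> linear w"
  using weyl_orthogonal by (auto simp: orthogonal_transformation_def)

lemma weyl_root: "w \<in> W \<Longrightarrow> \<beta> \<in> \<Phi> \<Longrightarrow> w \<beta> \<in> \<Phi>"
  by (induction rule: weyl_group.induct) (auto intro: root_reflection_root)

lemma weyl_comp: "w \<in> W \<Longrightarrow> w' \<in> W \<Longrightarrow> w \<circ> w' \<in> W"
  by (induction rule: weyl_group.induct) (auto simp: comp_assoc intro: weyl_reflection)

lemma reflection_weyl: "\<beta> \<in> \<Phi> \<Longrightarrow> root_reflection \<beta> \<in> W"
  using weyl_reflection[OF _ weyl_id, of \<beta>] by simp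

lemma weyl_inverse: "w \<in> W \<Longrightarrow> \<exists>w'\<in>W. w \<circ> w' = id \<and> w' \<circ> w = id"
proof (induction rule: weyl_group.induct)
  case (weyl_reflection \<beta> w)
  then obtain w' where w': "w' \<in> W" "w \<circ> w' = id" "w' \<circ> w = id" by blast
  have "w' \<circ> root_reflection \<beta> \<in> W"
    using w'(1) weyl_reflection by (intro weyl_comp reflection_weyl)
  moreover have "root_reflection \<beta> \<circ> w \<circ> (w' \<circ> root_reflection \<beta>) = id"
    "w' \<circ> root_reflection \<beta> \<circ> (root_reflection \<beta> \<circ> w) = id"
    using w'(2,3) by (simp_all add: fun_eq_iff)
  ultimately show ?case by blast
qed (rule bexI[OF _ weyl_id], simp)

lemma weyl_bij: "w \<in> W \<Longrightarrow> bij w"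
  using weyl_inverse o_bij by blast

lemma weyl_inv: "w \<in> W \<Longrightarrow> inv w \<in> W"
  using weyl_inverse by (metis inv_unique_comp)

lemma weyl_inv_inner: "w \<in> W \<Longrightarrow> w x \<bullet> y = x \<bullet> inv w y"
  by (metis weyl_inner weyl_inv weyl_bij bij_inv_eq_iff)

text \<open>The roots span the space, so an element is determined by its action on the finite set
  \<open>\<Phi>\<close>.\<close>

lemma finite_weyl: "finite W"
proof (rule finite_imageD)
  have "(\<lambda>w. restrict w \<Phi>) ` W \<subseteq> \<Phi> \<rightarrow>\<^sub>E \<Phi>"
    by (auto simp: weyl_root)
  then show "finite ((\<lambda>w. restrict w \<Phi>) ` W)"
    by (rule finite_subset) (simp add: finite_PiE finite_roots)
  show "inj_on (\<lambda>w. restrict w \<Phi>) W"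
  proof (rule inj_onI)
    fix w w' assume w: "w \<in> W" "w' \<in> W" "restrict w \<Phi> = restrict w' \<Phi>"
    then have "w \<beta> = w' \<beta>" if "\<beta> \<in> \<Phi>" for \<beta>
      using that by (metis restrict_apply')
    then show "w = w'"
      using linear_eq_on_span[OF weyl_linear[OF w(1)] weyl_linear[OF w(2)], of \<Phi>] span_roots
      by (auto simp: fun_eq_iff)
  qed
qed

section \<open>Words in the simple reflections and the exchange condition\<close>

primrec wd :: "'i list \<Rightarrow> real ^ 'n \<Rightarrow> real ^ 'n" where
  "wd [] = id"
| "wd (i # l) = s i \<circ> wd l"

lemma wd_append: "wd (l @ m) = wd l \<circ> wd m"
  by (induction l) auto

lemma wd_rev: "wd l \<circ> wd (rev l) = id"
proof (induction l)
  case (Cons i l)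
  have "wd (i # l) \<circ> wd (rev (i # l)) = s i \<circ> (wd l \<circ> wd (rev l)) \<circ> s i"
    by (simp add: wd_append comp_assoc)
  then show ?case by (simp only: Cons comp_id root_reflection_comp_self)
qed simp

lemma wd_weyl: "wd l \<in> W"
  by (induction l) (simp_all only: wd.simps weyl_id weyl_reflection alpha_root)

text \<open>Induction on the height. A positive root that is not simple has positive pairing with
  some simple coroot; reflecting there keeps it positive and lowers the height by a positive
  integer. The floor merely turns the real-valued height into a natural number.\<close>

lemma pos_root_eq_wd: "\<beta> \<in> pos_roots \<Longrightarrow> \<exists>l j. \<beta> = wd l (\<alpha> j)"
proof (induction "nat \<lfloor>\<Sum>i\<in>UNIV. cf i \<beta>\<rfloor>" arbitrary: \<beta> rule: less_induct)
  case less
  show ?case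
  proof (cases "\<beta> \<in> range \<alpha>")
    case True
    then show ?thesis by (metis wd.simps(1) id_apply rangeE)
  next
    case False
    obtain i where i: "cf i \<beta> > 0" "\<beta> \<bullet> \<alpha> i > 0"
      using exists_pos_cf_pos_inner pos_root_exists_cf less.prems by blast
    define k where "k = \<beta> \<bullet> coroot (\<alpha> i)"
    have "k > 0" using i by (simp add: k_def inner_coroot)
    moreover have "k \<in> \<int>" unfolding k_def
      using crystallographic pos_roots_root less.prems by simp
    ultimately have k1: "k \<ge> 1" by (auto elim!: Ints_cases)
    have p: "s i \<beta> \<in> pos_roots"
      using simple_reflection_pos less.prems False by blast
    have "cf j (s i \<beta>) = cf j \<beta> - (if j = i then k else 0)" for j
      by (simp add: root_reflection_def cf_simps k_def)
    then have sum: "(\<Sum>j\<in>UNIV. cf j (s i \<beta>)) = (\<Sum>j\<in>UNIV. cf j \<beta>) - k"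
      by (simp only: sum_subtractf) simp
    have "(\<Sum>j\<in>UNIV. cf j (s i \<beta>)) \<ge> 0"
      using pos_roots_cf[OF p] by (simp add: sum_nonneg)
    then have "nat \<lfloor>\<Sum>j\<in>UNIV. cf j (s i \<beta>)\<rfloor> < nat \<lfloor>\<Sum>j\<in>UNIV. cf j \<beta>\<rfloor>"
      using k1 sum by linarith
    from less.hyps[OF this p] obtain l j where "s i \<beta> = wd l (\<alpha> j)" by blast
    then have "\<beta> = wd (i # l) (\<alpha> j)"
      by (metis comp_apply root_reflection_involution wd.simps(2))
    then show ?thesis by blast
  qed
qed

lemma reflection_wd: "root_reflection (wd l (\<alpha> j)) = wd (l @ [j] @ rev l)"
proof -
  have "root_reflection (wd l (\<alpha> j)) (wd l x) = wd l (s j x)" for x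
    by (rule root_reflection_orthogonal[OF weyl_orthogonal[OF wd_weyl]])
  moreover have "wd l (wd (rev l) x) = x" for x
    using wd_rev by (metis comp_apply id_apply)
  ultimately have "root_reflection (wd l (\<alpha> j)) x = wd l (s j (wd (rev l) x))" for x
    by metis
  then show ?thesis by (simp add: fun_eq_iff wd_append)
qed

lemma root_reflection_minus: "root_reflection (- \<beta>) = root_reflection \<beta>"
  by (auto simp: root_reflection_def coroot_def)

lemma weyl_eq_wd: "w \<in> W \<Longrightarrow> \<exists>l. w = wd l"
proof (induction rule: weyl_group.induct)
  case weyl_id
  then show ?case by (metis wd.simps(1))
next
  case (weyl_reflection \<beta> w)
  then have "\<exists>\<gamma>\<in>pos_roots. root_reflection \<beta> = root_reflection \<gamma>"
    using pos_or_neg[of \<beta>] root_reflection_minus[of \<beta>] by metis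
  then obtain l j where "root_reflection \<beta> = wd (l @ [j] @ rev l)"
    using pos_root_eq_wd reflection_wd by metis
  moreover obtain m where "w = wd m" using weyl_reflection by blast
  ultimately have "root_reflection \<beta> \<circ> w = wd ((l @ [j] @ rev l) @ m)"
    by (simp only: wd_append)
  then show ?case by blast
qed

text \<open>Apply the letters to \<open>\<alpha> i\<close> from the right. The first letter
  \<open>j\<close> that makes the root negative must meet it as \<open>\<alpha> j\<close>, the only
  positive root negated by \<open>s j\<close>; there \<open>s j\<close> can be traded for
  \<open>s i\<close>, and the letter is deleted.\<close>

lemma wd_exchange:
  "- wd l (\<alpha> i) \<in> pos_roots \<Longrightarrow> \<exists>l'. length l' < length l \<and> wd l' = wd l \<circ> s i"
proof (induction l)
  case Nil
  then show ?case using not_pos_and_neg[OF alpha_pos] by simp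
next
  case (Cons j l)
  have "wd l (\<alpha> i) \<in> \<Phi>" by (simp add: weyl_root wd_weyl)
  then consider "wd l (\<alpha> i) \<in> pos_roots" | "- wd l (\<alpha> i) \<in> pos_roots"
    using pos_or_neg by blast
  then show ?case
  proof cases
    case 1
    have "wd l (\<alpha> i) = \<alpha> j"
      using simple_reflection_pos[OF 1, of j] not_pos_and_neg Cons.prems by auto
    then have "s j (wd l x) = wd l (s i x)" for x
      using root_reflection_orthogonal[OF weyl_orthogonal[OF wd_weyl[of l]], of "\<alpha> i" x] by simp
    then have "wd l = wd (j # l) \<circ> s i" by (simp add: fun_eq_iff)
    then show ?thesis by (intro exI[of _ l]) (simp only: length_Cons lessI simp_thms)
  next
    case 2
    then obtain l' where "length l' < length l" "wd l' = wd l \<circ> s i" using Cons.IH by blast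
    then have "length (j # l') < length (j # l)" "wd (j # l') = wd (j # l) \<circ> s i"
      by (simp_all add: comp_assoc)
    then show ?thesis by blast
  qed
qed

text \<open>Splitting off the last letter \<open>k\<close> of the word adds a nonnegative multiple
  of \<open>wd m (\<alpha> k)\<close> to the difference. If this root is negative, the word is not
  reduced and the exchange condition supplies a shorter one. The second part, for strictly dominant
  weights, yields trivial stabilisers.\<close>

lemma dominant_minus_wd:
  assumes "\<And>i. \<mu> \<bullet> \<alpha> i \<ge> 0"
  shows "(\<forall>i. cf i (\<mu> - wd l \<mu>) \<ge> 0) \<and>
    ((\<forall>i. \<mu> \<bullet> \<alpha> i > 0) \<longrightarrow> wd l = id \<or> (\<exists>i. cf i (\<mu> - wd l \<mu>) > 0))"
proof (induction l rule: length_induct)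
  case (1 l)
  show ?case
  proof (cases l rule: rev_cases)
    case Nil
    then show ?thesis by simp
  next
    case (snoc m k)
    have "wd m (\<alpha> k) \<in> \<Phi>" by (simp add: weyl_root wd_weyl)
    then consider "wd m (\<alpha> k) \<in> pos_roots" | "- wd m (\<alpha> k) \<in> pos_roots"
      using pos_or_neg by blast
    then show ?thesis
    proof cases
      case p: 1
      define c where "c = \<mu> \<bullet> coroot (\<alpha> k)"
      have c: "c \<ge> 0" using assms by (simp add: c_def inner_coroot)
      have "wd l \<mu> = wd m (\<mu> - c *\<^sub>R \<alpha> k)"
        by (simp add: snoc wd_append root_reflection_def c_def)
      also have "\<dots> = wd m \<mu> - c *\<^sub>R wd m (\<alpha> k)"
        using weyl_linear[OF wd_weyl[of m]] by (simp add: linear_diff linear_scale)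
      finally have eq: "cf i (\<mu> - wd l \<mu>) = cf i (\<mu> - wd m \<mu>) + c * cf i (wd m (\<alpha> k))" for i
        by (simp add: cf_simps)
      have m: "cf i (\<mu> - wd m \<mu>) \<ge> 0" for i
        using 1 by (simp add: snoc)
      have "\<exists>i. cf i (\<mu> - wd l \<mu>) > 0" if "\<forall>i. \<mu> \<bullet> \<alpha> i > 0"
      proof -
        have "c > 0" using that by (simp add: c_def inner_coroot)
        moreover obtain i where "cf i (wd m (\<alpha> k)) > 0" using pos_root_exists_cf[OF p] by blast
        ultimately have "cf i (\<mu> - wd l \<mu>) > 0" using eq[of i] m[of i] by (simp add: add_nonneg_pos)
        then show ?thesis by blast
      qed
      moreover have "cf i (\<mu> - wd l \<mu>) \<ge> 0" for i
        using eq[of i] m[of i] c pos_roots_cf[OF p, of i] by simp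
      ultimately show ?thesis by blast
    next
      case 2
      then obtain l' where "length l' < length m" "wd l' = wd m \<circ> s k" using wd_exchange by blast
      then have "length l' < length l" "wd l' = wd l" by (simp_all add: snoc wd_append)
      then show ?thesis using 1 by metis
    qed
  qed
qed

lemma dominant_minus_weyl:
  assumes "\<And>i. \<mu> \<bullet> \<alpha> i \<ge> 0" "w \<in> W"
  shows "cf i (\<mu> - w \<mu>) \<ge> 0"
  using dominant_minus_wd[of \<mu>] weyl_eq_wd[OF assms(2)] assms(1) by auto

lemma strictly_dominant_minus_weyl:
  assumes "\<And>i. \<mu> \<bullet> \<alpha> i > 0" "w \<in> W" "w \<noteq> id"
  shows "\<exists>i. cf i (\<mu> - w \<mu>) > 0"
  using dominant_minus_wd[of \<mu>] weyl_eq_wd[OF assms(2)] assms(1,3) by (auto simp: less_imp_le)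

end

section \<open>Alternants\<close>

context simple_roots
begin

definition sg :: "(real ^ 'n \<Rightarrow> real ^ 'n) \<Rightarrow> real" where
  "sg w = det (matrix w)"

lemma sg_comp: "w \<in> W \<Longrightarrow> w' \<in> W \<Longrightarrow> sg (w \<circ> w') = sg w * sg w'"
  by (simp add: sg_def matrix_compose weyl_linear det_mul)

lemma sg_simple [simp]: "sg (s i) = - 1"
  by (simp add: sg_def det_root_reflection)

lemma sg_id [simp]: "sg id = 1"
  by (simp only: sg_def matrix_id_mat_1 det_I)

lemma sg_sign: "w \<in> W \<Longrightarrow> sg w = 1 \<or> sg w = - 1"
  unfolding sg_def
  using weyl_orthogonal orthogonal_transformation_matrix det_orthogonal_matrix by blast

lemma sg_inv:
  assumes "w \<in> W"
  shows "sg (inv w) = sg w"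
proof -
  have "inv w \<circ> w = id" using weyl_bij[OF assms] by (simp add: bij_is_inj)
  then have "sg (inv w) * sg w = 1"
    using sg_comp[OF weyl_inv[OF assms] assms] by simp
  then show ?thesis using sg_sign[OF assms] by auto
qed

lemma of_int_floor_det: "w \<in> W \<Longrightarrow> of_int \<lfloor>det (matrix w)\<rfloor> = sg w"
  using sg_sign[of w] by (auto simp: sg_def simp del: of_int_floor_cancel)

text \<open>Antisymmetrisation of arbitrary functions, so that it also applies to products such as
  an exponential times \<open>chain_sum\<close>. On exponentials it is the evaluated alternant, by
  \<open>expsum_alternant\<close>.\<close>

definition alt_sum :: "(real ^ 'n \<Rightarrow> real) \<Rightarrow> real ^ 'n \<Rightarrow> real" where
  "alt_sum g v = (\<Sum>w\<in>W. sg w * g (w v))"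

text \<open>Composition with \<open>s i\<close> on the left is a sign-reversing involution of the
  group that preserves the values of \<open>g\<close>.\<close>

lemma alt_sum_eq_0:
  assumes "\<And>v. g (s i v) = g v"
  shows "alt_sum g v = 0"
proof -
  have inv: "s i \<circ> (s i \<circ> w) = w" for w by (simp add: fun_eq_iff)
  have "alt_sum g v = (\<Sum>w\<in>W. sg (s i \<circ> w) * g ((s i \<circ> w) v))"
    unfolding alt_sum_def
    by (rule sum.reindex_bij_witness[of _ "\<lambda>w. s i \<circ> w" "\<lambda>w. s i \<circ> w"])
       (simp_all only: inv weyl_reflection alpha_root)
  also have "\<dots> = (\<Sum>w\<in>W. - (sg w * g (w v)))"
    by (rule sum.cong) (simp_all add: assms sg_comp reflection_weyl)
  also have "\<dots> = - alt_sum g v"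
    by (simp add: alt_sum_def sum_negf)
  finally show ?thesis by simp
qed

lemma alt_sum_inv: "alt_sum g v = (\<Sum>w\<in>W. sg w * g (inv w v))"
  unfolding alt_sum_def
  by (rule sum.reindex_bij_witness[of _ inv inv])
     (simp_all add: weyl_inv sg_inv inv_inv_eq weyl_bij)

text \<open>Substitute the inverse group element, which has the same determinant. This symmetry is
  what makes the principal specialisation computable.\<close>

lemma alt_sum_exp_commute:
  "alt_sum (\<lambda>u. exp (x \<bullet> u)) y = alt_sum (\<lambda>u. exp (y \<bullet> u)) x"
  unfolding alt_sum_inv[of _ y]
  by (simp add: alt_sum_def inner_commute[of y] weyl_inv_inner)

lemma alternant_single:
  "alternant \<Phi> \<mu> = (\<Sum>w\<in>W. Poly_Mapping.single (w \<mu>) \<lfloor>det (matrix w)\<rfloor>)"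
  unfolding alternant_def group_ring_exp_def
  by (simp add: mult_single flip: single_of_int)

lemma expsum_alternant: "expsum (alternant \<Phi> \<mu>) v = alt_sum (\<lambda>u. exp (\<mu> \<bullet> u)) v"
  by (simp add: alternant_single expsum_sum expsum_single of_int_floor_det alt_sum_inv weyl_inv_inner)

lemma single_mult_lookup:
  fixes f :: "(real ^ 'n) \<Rightarrow>\<^sub>0 int"
  shows "Poly_Mapping.lookup (Poly_Mapping.single \<mu> 1 * f) (\<mu> + \<nu>) = Poly_Mapping.lookup f \<nu>"
proof -
  have "Poly_Mapping.single \<mu> 1 * f =
      (\<Sum>k\<in>Poly_Mapping.keys f. Poly_Mapping.single (\<mu> + k) (Poly_Mapping.lookup f k))"
    by (subst poly_mapping_sum_single[of f]) (simp add: sum_distrib_left mult_single)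
  then show ?thesis
    by (simp add: lookup_sum lookup_single when_def in_keys_iff)
qed

text \<open>Multiplication by an alternant is injective because its leading term, with respect to the
  height, has coefficient 1.\<close>

lemma alternant_mult_cancel:
  assumes dom: "\<And>i. \<mu> \<bullet> \<alpha> i > 0" and eq: "alternant \<Phi> \<mu> * f = alternant \<Phi> \<mu> * g"
  shows "f = g"
proof (rule ccontr)
  assume "f \<noteq> g"
  define d where "d = f - g"
  have "d \<noteq> 0" using \<open>f \<noteq> g\<close> by (simp add: d_def)
  have Ad: "alternant \<Phi> \<mu> * d = 0" using eq by (simp add: d_def right_diff_distrib)
  define h where "h x = (\<Sum>i\<in>UNIV. cf i x)" for x
  have h_add: "h (x + y) = h x + h y" for x y by (simp add: h_def cf_add sum.distrib)
  have h_less: "h (w \<mu>) < h \<mu>" if "w \<in> W" "w \<noteq> id" for w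
  proof -
    have "cf i (w \<mu>) \<le> cf i \<mu>" for i
      using dominant_minus_weyl[of \<mu> w i] less_imp_le[OF dom] that(1) by (simp add: cf_diff)
    moreover have "\<exists>i. cf i (\<mu> - w \<mu>) > 0"
      by (rule strictly_dominant_minus_weyl) (use dom that in auto)
    then obtain i where "cf i (w \<mu>) < cf i \<mu>" by (auto simp: cf_diff)
    ultimately show ?thesis unfolding h_def by (intro sum_strict_mono_ex1) auto
  qed
  define B where "B = (\<Sum>w\<in>W - {id}. Poly_Mapping.single (w \<mu>) \<lfloor>det (matrix w)\<rfloor>)"
  have AB: "alternant \<Phi> \<mu> = Poly_Mapping.single \<mu> 1 + B"
    unfolding alternant_single B_def
    by (subst sum.remove[OF finite_weyl weyl_id]) (simp add: matrix_id_mat_1)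
  have keysB: "Poly_Mapping.keys B \<subseteq> (\<lambda>w. w \<mu>) ` (W - {id})"
    unfolding B_def by (rule subset_trans[OF keys_sum]) (auto split: if_splits)
  have "Max (h ` Poly_Mapping.keys d) \<in> h ` Poly_Mapping.keys d"
    using \<open>d \<noteq> 0\<close> by (intro Max_in) auto
  then obtain \<nu> where \<nu>: "\<nu> \<in> Poly_Mapping.keys d" "h \<nu> = Max (h ` Poly_Mapping.keys d)" by auto
  \<comment> \<open>Keys of \<open>B\<close> have height below \<open>h \<mu>\<close> and keys of
    \<open>d\<close> have height at most \<open>h \<nu>\<close>, so only the leading term of the
    alternant can contribute at \<open>\<mu> + \<nu>\<close>.\<close>
  have "\<mu> + \<nu> \<notin> Poly_Mapping.keys (B * d)"
  proof
    assume "\<mu> + \<nu> \<in> Poly_Mapping.keys (B * d)"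
    then obtain a b where ab: "\<mu> + \<nu> = a + b" "a \<in> Poly_Mapping.keys B" "b \<in> Poly_Mapping.keys d"
      using keys_mult by blast
    then have "h a < h \<mu>" using keysB h_less by blast
    moreover have "h b \<le> h \<nu>" using ab \<nu> by simp
    ultimately show False using h_add[of \<mu> \<nu>] h_add[of a b] ab(1) by simp
  qed
  then have "Poly_Mapping.lookup (alternant \<Phi> \<mu> * d) (\<mu> + \<nu>) = Poly_Mapping.lookup d \<nu>"
    by (simp add: AB distrib_right lookup_add single_mult_lookup in_keys_iff)
  then show False using Ad \<nu>(1) by (simp add: in_keys_iff)
qed

lemma weyl_vector_coroot: "weyl_vector \<alpha> \<bullet> coroot (\<alpha> i) = 1"
  by (simp add: weyl_vector_def inner_sum_left fundamental_weight_inner)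

lemma inner_alpha: "x \<bullet> \<alpha> i = (\<alpha> i \<bullet> \<alpha> i) / 2 * (x \<bullet> coroot (\<alpha> i))"
  by (simp add: inner_coroot)

lemma weyl_vector_pos: "weyl_vector \<alpha> \<bullet> \<alpha> i > 0"
  by (subst inner_alpha) (simp add: weyl_vector_coroot)

lemma weyl_bialternant_eqI:
  assumes "Poly_Mapping.keys f \<subseteq> weight_lattice \<alpha>"
    and "alternant \<Phi> (weyl_vector \<alpha>) * f = alternant \<Phi> (\<mu> + weyl_vector \<alpha>)"
  shows "weyl_bialternant \<Phi> \<alpha> \<mu> = f"
proof -
  have "g = f" if "alternant \<Phi> (weyl_vector \<alpha>) * g = alternant \<Phi> (\<mu> + weyl_vector \<alpha>)" for g
  proof (rule alternant_mult_cancel)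
    show "0 < weyl_vector \<alpha> \<bullet> \<alpha> i" for i by (rule weyl_vector_pos)
    show "alternant \<Phi> (weyl_vector \<alpha>) * g = alternant \<Phi> (weyl_vector \<alpha>) * f"
      by (rule trans[OF that assms(2)[symmetric]])
  qed
  then show ?thesis unfolding weyl_bialternant_def
    by (intro the_equality conjI assms) (elim conjE)
qed

lemma weight_lattice_iff: "x \<in> weight_lattice \<alpha> \<longleftrightarrow> (\<forall>i. x \<bullet> coroot (\<alpha> i) \<in> \<int>)"
proof
  assume "x \<in> weight_lattice \<alpha>"
  then show "\<forall>i. x \<bullet> coroot (\<alpha> i) \<in> \<int>"
    by (auto simp: weight_lattice_def inner_sum_left fundamental_weight_inner if_distrib cong: if_cong)
next
  assume "\<forall>i. x \<bullet> coroot (\<alpha> i) \<in> \<int>"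
  then have "x = (\<Sum>i\<in>UNIV. of_int \<lfloor>x \<bullet> coroot (\<alpha> i)\<rfloor> *\<^sub>R fundamental_weight \<alpha> i)"
    by (subst weight_expansion[of x, symmetric]) simp
  then show "x \<in> weight_lattice \<alpha>" unfolding weight_lattice_def by (rule range_eqI[of _ _ "\<lambda>i. \<lfloor>x \<bullet> coroot (\<alpha> i)\<rfloor>"])
qed

end

section \<open>The Weyl denominator formula\<close>

context simple_roots
begin

text \<open>Pairing with this vector is the height.\<close>

definition \<rho>v :: "real ^ 'n" where
  "\<rho>v = (1 / 2) *\<^sub>R (\<Sum>\<beta>\<in>pos_roots. coroot \<beta>)"

lemma coroot_simple_reflection: "coroot (s i \<beta>) = s i (coroot \<beta>)"
  by (rule coroot_orthogonal[OF orthogonal_root_reflection])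

lemma simple_reflection_bij: "bij_betw (s i) (pos_roots - {\<alpha> i}) (pos_roots - {\<alpha> i})"
proof -
  have sub: "s i ` (pos_roots - {\<alpha> i}) \<subseteq> pos_roots - {\<alpha> i}"
  proof safe
    fix \<beta> assume \<beta>: "\<beta> \<in> pos_roots" "\<beta> \<noteq> \<alpha> i"
    then show "s i \<beta> \<in> pos_roots" by (rule simple_reflection_pos)
    assume "s i \<beta> = \<alpha> i"
    then have "\<beta> = s i (\<alpha> i)" by (metis root_reflection_involution)
    then have "\<beta> = - \<alpha> i" by (simp add: root_reflection_self)
    then show False using \<beta>(1) not_pos_and_neg[OF alpha_pos] by simp
  qed
  show ?thesis
    by (rule bij_betw_byWitness[where f' = "s i", OF _ _ sub sub]) simp_all
qed

text \<open>\<open>s i\<close> permutes the positive roots other than \<open>\<alpha> i\<close> and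
  negates \<open>\<alpha> i\<close>, so half the sum of the coroots loses exactly one copy of that
  coroot.\<close>

lemma \<rho>v_reflection: "s i \<rho>v = \<rho>v - coroot (\<alpha> i)"
proof -
  have lin: "linear (s i)" by (rule linear_root_reflection)
  have split: "(\<Sum>\<beta>\<in>pos_roots. f \<beta>) = f (\<alpha> i) + (\<Sum>\<beta>\<in>pos_roots - {\<alpha> i}. f \<beta>)" for f :: "real ^ 'n \<Rightarrow> real ^ 'n"
    by (rule sum.remove[OF finite_pos_roots alpha_pos])
  have "s i (\<Sum>\<beta>\<in>pos_roots. coroot \<beta>) = (\<Sum>\<beta>\<in>pos_roots. coroot (s i \<beta>))"
    by (simp add: linear_sum[OF lin] coroot_simple_reflection)
  also have "\<dots> = coroot (s i (\<alpha> i)) + (\<Sum>\<beta>\<in>pos_roots - {\<alpha> i}. coroot (s i \<beta>))"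
    by (rule split)
  also have "(\<Sum>\<beta>\<in>pos_roots - {\<alpha> i}. coroot (s i \<beta>)) = (\<Sum>\<beta>\<in>pos_roots - {\<alpha> i}. coroot \<beta>)"
    by (rule sum.reindex_bij_betw[OF simple_reflection_bij])
  also have "coroot (s i (\<alpha> i)) = - coroot (\<alpha> i)"
    by (simp add: root_reflection_self coroot_def)
  also have "- coroot (\<alpha> i) + (\<Sum>\<beta>\<in>pos_roots - {\<alpha> i}. coroot \<beta>) = (\<Sum>\<beta>\<in>pos_roots. coroot \<beta>) - 2 *\<^sub>R coroot (\<alpha> i)"
    unfolding split[of coroot] by (simp add: scaleR_2)
  finally show ?thesis
    unfolding \<rho>v_def linear_scale[OF lin] by (simp add: scaleR_right_diff_distrib)
qed

lemma \<rho>v_alpha: "\<rho>v \<bullet> \<alpha> i = 1"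
proof -
  have "(\<rho>v \<bullet> coroot (\<alpha> i)) *\<^sub>R \<alpha> i = coroot (\<alpha> i)"
    using \<rho>v_reflection[of i] by (simp add: root_reflection_def)
  then have "(\<rho>v \<bullet> coroot (\<alpha> i)) *\<^sub>R \<alpha> i \<bullet> \<alpha> i = coroot (\<alpha> i) \<bullet> \<alpha> i"
    by simp
  then show ?thesis by (simp add: inner_coroot coroot_def)
qed

lemma coroot_cf: "cf i (coroot \<beta>) = 2 / (\<beta> \<bullet> \<beta>) * cf i \<beta>"
  by (simp add: coroot_def cf_scale)

lemma coroot_cf_nonneg: "\<beta> \<in> pos_roots \<Longrightarrow> cf i (coroot \<beta>) \<ge> 0"
  by (simp add: coroot_cf pos_roots_cf)

lemma inner_nonneg_if_cf:
  assumes "\<And>i. cf i x \<ge> 0" "\<And>i. y \<bullet> \<alpha> i \<ge> 0"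
  shows "y \<bullet> x \<ge> 0"
  by (subst inner_expansion) (simp add: assms sum_nonneg)

lemma sum_coroot_eq_0:
  assumes "S \<subseteq> pos_roots" "(\<Sum>\<beta>\<in>S. coroot \<beta>) = 0"
  shows "S = {}"
proof (rule ccontr)
  assume "S \<noteq> {}"
  then obtain \<beta> where \<beta>: "\<beta> \<in> S" by blast
  then obtain i where i: "cf i \<beta> > 0" using assms(1) pos_root_exists_cf by blast
  have "\<beta> \<noteq> 0" using i by auto
  then have "0 < cf i (coroot \<beta>)" using i by (simp add: coroot_cf)
  also have "\<dots> \<le> (\<Sum>\<beta>\<in>S. cf i (coroot \<beta>))"
    by (rule member_le_sum[OF \<beta>]) (use assms(1) finite_subset[OF assms(1) finite_pos_roots] coroot_cf_nonneg in auto)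
  also have "\<dots> = cf i (\<Sum>\<beta>\<in>S. coroot \<beta>)" by (simp add: cf_sum)
  finally show False using assms(2) by simp
qed

text \<open>The Weyl denominator of the dual root system in its symmetric form, evaluated at
  \<open>v\<close>.\<close>

definition denominator :: "real ^ 'n \<Rightarrow> real" where
  "denominator v = (\<Prod>\<beta>\<in>pos_roots. exp (coroot \<beta> \<bullet> v / 2) - exp (- (coroot \<beta> \<bullet> v / 2)))"

lemma denominator_reflection: "denominator (s i v) = - denominator v"
proof -
  let ?f = "\<lambda>v \<beta>. exp (coroot \<beta> \<bullet> v / 2) - exp (- (coroot \<beta> \<bullet> v / 2))"
  have split: "denominator v = ?f v (\<alpha> i) * (\<Prod>\<beta>\<in>pos_roots - {\<alpha> i}. ?f v \<beta>)" for v
    unfolding denominator_def by (rule prod.remove[OF finite_pos_roots alpha_pos])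
  have f: "?f (s i v) \<beta> = ?f v (s i \<beta>)" for \<beta>
    by (simp add: coroot_simple_reflection root_reflection_self_adjoint)
  have prod: "(\<Prod>\<beta>\<in>pos_roots - {\<alpha> i}. ?f (s i v) \<beta>) = (\<Prod>\<beta>\<in>pos_roots - {\<alpha> i}. ?f v \<beta>)"
    unfolding f by (rule prod.reindex_bij_betw[OF simple_reflection_bij])
  have self: "?f (s i v) (\<alpha> i) = - ?f v (\<alpha> i)"
    unfolding f by (simp add: root_reflection_self coroot_def)
  have "denominator (s i v) = - ?f v (\<alpha> i) * (\<Prod>\<beta>\<in>pos_roots - {\<alpha> i}. ?f v \<beta>)"
    unfolding split[of "s i v"] prod self by (rule refl)
  then show ?thesis unfolding split[of v] by (simp only: mult_minus_left)
qed

text \<open>Multiplying out the denominator, \<open>S\<close> is the set of roots whose factor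
  contributes the negative exponential; it produces the exponent
  \<open>\<rho>v - (\<Sum>\<beta>\<in>S. coroot \<beta>)\<close> and the sign.\<close>

definition denominator_coeff :: "real ^ 'n \<Rightarrow> real" where
  "denominator_coeff \<nu> = (\<Sum>S\<in>{S\<in>Pow pos_roots. \<rho>v - (\<Sum>\<beta>\<in>S. coroot \<beta>) = \<nu>}. (-1) ^ card S)"

lemma denominator_expansion:
  assumes "finite N" "(\<lambda>S. \<rho>v - (\<Sum>\<beta>\<in>S. coroot \<beta>)) ` Pow pos_roots \<subseteq> N"
  shows "denominator v = (\<Sum>\<nu>\<in>N. denominator_coeff \<nu> * exp (\<nu> \<bullet> v))"
proof -
  have "denominator v = (\<Prod>\<beta>\<in>pos_roots. - exp (- (coroot \<beta> \<bullet> v / 2)) + exp (coroot \<beta> \<bullet> v / 2))"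
    by (simp add: denominator_def)
  also have "\<dots> = (\<Sum>S\<in>Pow pos_roots. (\<Prod>\<beta>\<in>S. - exp (- (coroot \<beta> \<bullet> v / 2))) *
      (\<Prod>\<beta>\<in>pos_roots - S. exp (coroot \<beta> \<bullet> v / 2)))"
    by (rule prod_add[OF finite_pos_roots])
  also have "\<dots> = (\<Sum>S\<in>Pow pos_roots. (-1) ^ card S * exp ((\<rho>v - (\<Sum>\<beta>\<in>S. coroot \<beta>)) \<bullet> v))"
  proof (rule sum.cong[OF refl])
    fix S assume "S \<in> Pow pos_roots"
    then have S: "S \<subseteq> pos_roots" "finite S" using finite_subset finite_pos_roots by auto
    have "(\<Sum>\<beta>\<in>pos_roots. coroot \<beta>) = (\<Sum>\<beta>\<in>pos_roots - S. coroot \<beta>) + (\<Sum>\<beta>\<in>S. coroot \<beta>)"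
      by (rule sum.subset_diff[OF S(1) finite_pos_roots])
    then have "(\<rho>v - (\<Sum>\<beta>\<in>S. coroot \<beta>)) \<bullet> v =
        - (\<Sum>\<beta>\<in>S. coroot \<beta> \<bullet> v / 2) + (\<Sum>\<beta>\<in>pos_roots - S. coroot \<beta> \<bullet> v / 2)"
      by (simp add: \<rho>v_def inner_diff_left inner_add_left inner_sum_left field_simps
          flip: sum_divide_distrib)
    then show "(\<Prod>\<beta>\<in>S. - exp (- (coroot \<beta> \<bullet> v / 2))) * (\<Prod>\<beta>\<in>pos_roots - S. exp (coroot \<beta> \<bullet> v / 2))
        = (-1) ^ card S * exp ((\<rho>v - (\<Sum>\<beta>\<in>S. coroot \<beta>)) \<bullet> v)"
      using S(2) finite_pos_roots
      by (simp add: prod_uminus exp_add exp_sum flip: sum_negf)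
  qed
  also have "\<dots> = (\<Sum>\<nu>\<in>N. \<Sum>S\<in>{S\<in>Pow pos_roots. \<rho>v - (\<Sum>\<beta>\<in>S. coroot \<beta>) = \<nu>}.
      (-1) ^ card S * exp ((\<rho>v - (\<Sum>\<beta>\<in>S. coroot \<beta>)) \<bullet> v))"
    by (rule sum.group[symmetric]) (use assms finite_pos_roots in auto)
  also have "\<dots> = (\<Sum>\<nu>\<in>N. denominator_coeff \<nu> * exp (\<nu> \<bullet> v))"
    unfolding denominator_coeff_def sum_distrib_right by (intro sum.cong refl) auto
  finally show ?thesis .
qed

lemma denominator_coeff_nonzero:
  "denominator_coeff \<nu> \<noteq> 0 \<Longrightarrow> \<exists>S\<subseteq>pos_roots. \<nu> = \<rho>v - (\<Sum>\<beta>\<in>S. coroot \<beta>)"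
proof (rule ccontr)
  assume "denominator_coeff \<nu> \<noteq> 0" "\<not> (\<exists>S\<subseteq>pos_roots. \<nu> = \<rho>v - (\<Sum>\<beta>\<in>S. coroot \<beta>))"
  then have "{S \<in> Pow pos_roots. \<rho>v - (\<Sum>\<beta>\<in>S. coroot \<beta>) = \<nu>} = {}" by auto
  with \<open>denominator_coeff \<nu> \<noteq> 0\<close> show False unfolding denominator_coeff_def by (simp only: sum.empty)
qed

text \<open>The product changes sign under \<open>s i\<close>, and independence of exponentials
  transfers this to the individual coefficients.\<close>

lemma denominator_coeff_reflection: "denominator_coeff (s i \<nu>) = - denominator_coeff \<nu>"
proof -
  define N0 where "N0 = (\<lambda>S. \<rho>v - (\<Sum>\<beta>\<in>S. coroot \<beta>)) ` Pow pos_roots"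
  \<comment> \<open>Closing the exponents under \<open>s i\<close> lets both expansions run over one
    index set; \<open>\<nu>\<close> is included because it need not occur as an exponent.\<close>
  define N where "N = insert \<nu> N0 \<union> s i ` insert \<nu> N0"
  have N: "finite N" "N0 \<subseteq> N" "\<nu> \<in> N"
    by (auto simp: N_def N0_def finite_pos_roots)
  have bij: "bij_betw (s i) N N"
    by (rule bij_betw_byWitness[where f' = "s i"]) (auto simp: N_def image_iff)
  have exp: "denominator v = (\<Sum>\<nu>\<in>N. denominator_coeff \<nu> * exp (\<nu> \<bullet> v))" for v
    using denominator_expansion[OF N(1)] N(2) by (simp add: N0_def)
  have "(\<Sum>\<nu>\<in>N. (denominator_coeff \<nu> + denominator_coeff (s i \<nu>)) * exp (\<nu> \<bullet> v)) = 0" for v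
  proof -
    have "denominator (s i v) = (\<Sum>\<nu>\<in>N. denominator_coeff (s i \<nu>) * exp (s i \<nu> \<bullet> s i v))"
      unfolding exp by (rule sum.reindex_bij_betw[OF bij, symmetric])
    then have "denominator (s i v) = (\<Sum>\<nu>\<in>N. denominator_coeff (s i \<nu>) * exp (\<nu> \<bullet> v))"
      by (simp only: root_reflection_inner)
    then show ?thesis
      using denominator_reflection[of i v] exp[of v] by (simp add: distrib_right sum.distrib)
  qed
  from exp_sum_independent[OF N(1) this N(3)] show ?thesis by simp
qed

lemma denominator_coeff_weyl:
  assumes "w \<in> W"
  shows "denominator_coeff (w \<nu>) = sg w * denominator_coeff \<nu>"
proof -
  have "denominator_coeff (wd l \<nu>) = sg (wd l) * denominator_coeff \<nu>" for l
  proof (induction l)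
    case Nil
    show ?case unfolding wd.simps sg_id by simp
  next
    case (Cons i l)
    have sgl: "sg (wd (i # l)) = - sg (wd l)"
      unfolding wd.simps by (subst sg_comp) (simp_all only: sg_simple reflection_weyl alpha_root wd_weyl mult_minus1)
    show ?case unfolding sgl using Cons by (simp add: denominator_coeff_reflection)
  qed
  then show ?thesis using weyl_eq_wd[OF assms] by blast
qed

text \<open>Choose the conjugate with the largest pairing with the Weyl vector; a negative pairing
  with some \<open>\<alpha> i\<close> could be improved by \<open>s i\<close>.\<close>

lemma exists_dominant_conjugate: "\<exists>w\<in>W. \<forall>i. w \<nu> \<bullet> \<alpha> i \<ge> 0"
proof -
  let ?h = "\<lambda>w. w \<nu> \<bullet> weyl_vector \<alpha>"
  have "Max (?h ` W) \<in> ?h ` W" using finite_weyl weyl_id by (intro Max_in) auto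
  then obtain w where w: "w \<in> W" "?h w = Max (?h ` W)" by auto
  have "w \<nu> \<bullet> \<alpha> i \<ge> 0" for i
  proof -
    have "s i \<circ> w \<in> W" using w(1) by (intro weyl_reflection alpha_root)
    then have "?h (s i \<circ> w) \<le> ?h w" unfolding w(2)
      by (intro Max_ge finite_imageI finite_weyl) (rule image_eqI[of _ _ "s i \<circ> w"], rule refl)
    then have "(w \<nu> \<bullet> coroot (\<alpha> i)) * (\<alpha> i \<bullet> weyl_vector \<alpha>) \<ge> 0"
      by (simp add: root_reflection_def inner_diff_left)
    then have "w \<nu> \<bullet> coroot (\<alpha> i) \<ge> 0"
      using weyl_vector_pos[of i] by (simp add: inner_commute zero_le_mult_iff)
    then show ?thesis by (subst inner_alpha) simp
  qed
  then show ?thesis using w(1) by blast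
qed

lemma denominator_coeff_\<rho>v: "denominator_coeff \<rho>v = 1"
proof -
  have "{S \<in> Pow pos_roots. \<rho>v - (\<Sum>\<beta>\<in>S. coroot \<beta>) = \<rho>v} = {{}}"
    using sum_coroot_eq_0 by auto
  then show ?thesis by (simp add: denominator_coeff_def)
qed

text \<open>For a dominant conjugate \<open>\<kappa>\<close>, antisymmetry keeps
  \<open>\<kappa>\<close> off the walls, and by integrality \<open>\<kappa> - \<rho>v\<close> is
  still dominant. Its negative is a sum of positive coroots, so its inner product with that sum is
  nonnegative and at the same time minus its own square norm. Hence
  \<open>\<kappa> = \<rho>v\<close>.\<close>

lemma denominator_coeff_support:
  assumes "denominator_coeff \<nu> \<noteq> 0"
  shows "\<exists>w\<in>W. \<nu> = w \<rho>v"
proof -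
  obtain w where w: "w \<in> W" "\<And>i. w \<nu> \<bullet> \<alpha> i \<ge> 0" using exists_dominant_conjugate by blast
  define \<kappa> where "\<kappa> = w \<nu>"
  have nz: "denominator_coeff \<kappa> \<noteq> 0"
    using assms sg_sign[OF w(1)] by (auto simp: \<kappa>_def denominator_coeff_weyl[OF w(1)])
  then obtain S where S: "S \<subseteq> pos_roots" "\<kappa> = \<rho>v - (\<Sum>\<beta>\<in>S. coroot \<beta>)"
    using denominator_coeff_nonzero by blast
  have "(\<kappa> - \<rho>v) \<bullet> \<alpha> i \<ge> 0" for i
  proof -
    have "s i \<kappa> \<noteq> \<kappa>" using denominator_coeff_reflection[of i \<kappa>] nz by auto
    then have "\<kappa> \<bullet> \<alpha> i \<noteq> 0" by (auto simp: root_reflection_def inner_coroot)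
    then have "\<kappa> \<bullet> \<alpha> i > 0" using w(2)[of i] by (simp add: \<kappa>_def)
    moreover have "\<kappa> \<bullet> \<alpha> i \<in> \<int>"
    proof -
      have "coroot \<beta> \<bullet> \<alpha> i \<in> \<int>" if "\<beta> \<in> S" for \<beta>
        using crystallographic[of \<beta> "\<alpha> i"] that S(1) pos_roots_root by (auto simp: inner_commute)
      then have "(\<Sum>\<beta>\<in>S. coroot \<beta> \<bullet> \<alpha> i) \<in> \<int>" by (rule Ints_sum)
      then show ?thesis by (simp add: S(2) inner_diff_left inner_sum_left \<rho>v_alpha)
    qed
    ultimately have "\<kappa> \<bullet> \<alpha> i \<ge> 1" by (auto elim!: Ints_cases)
    then show ?thesis by (simp add: inner_diff_left \<rho>v_alpha)
  qed
  moreover have "cf i (\<Sum>\<beta>\<in>S. coroot \<beta>) \<ge> 0" for i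
    unfolding cf_sum by (rule sum_nonneg) (use S(1) coroot_cf_nonneg in blast)
  ultimately have "(\<kappa> - \<rho>v) \<bullet> (\<Sum>\<beta>\<in>S. coroot \<beta>) \<ge> 0"
    by (rule inner_nonneg_if_cf[rotated])
  moreover have "(\<Sum>\<beta>\<in>S. coroot \<beta>) = - (\<kappa> - \<rho>v)" using S(2) by simp
  ultimately have "(\<kappa> - \<rho>v) \<bullet> (\<kappa> - \<rho>v) \<le> 0"
    by (simp only: inner_minus_right neg_0_le_iff_le)
  then have "\<kappa> - \<rho>v = 0" by (metis inner_eq_zero_iff inner_ge_zero order_antisym)
  then have "\<nu> = inv w \<rho>v" using weyl_bij[OF w(1)] by (simp add: \<kappa>_def bij_inv_eq_iff)
  then show ?thesis using weyl_inv[OF w(1)] by blast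
qed

lemma \<rho>v_inj_on: "inj_on (\<lambda>w. w \<rho>v) W"
proof (rule inj_onI)
  fix w w' assume w: "w \<in> W" "w' \<in> W" "w \<rho>v = w' \<rho>v"
  then have stab: "(inv w' \<circ> w) \<rho>v = \<rho>v"
    using weyl_bij[OF w(2)] by (simp add: bij_is_inj)
  have "inv w' \<circ> w = id"
  proof (rule ccontr)
    assume ne: "inv w' \<circ> w \<noteq> id"
    have "inv w' \<circ> w \<in> W" using w weyl_inv weyl_comp by blast
    then have "\<exists>i. cf i (\<rho>v - (inv w' \<circ> w) \<rho>v) > 0"
      by (intro strictly_dominant_minus_weyl[OF _ _ ne]) (simp add: \<rho>v_alpha)
    then show False unfolding stab by simp
  qed
  then have "w' ((inv w' \<circ> w) x) = w' x" for x by simp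
  then show "w = w'" using weyl_bij[OF w(2)] by (simp add: fun_eq_iff bij_is_surj surj_f_inv_f)
qed

text \<open>The coefficients of the product are antisymmetric, supported on the orbit of
  \<open>\<rho>v\<close>, and equal to 1 at \<open>\<rho>v\<close>, where only the empty set
  contributes.\<close>

theorem weyl_denominator: "alt_sum (\<lambda>u. exp (\<rho>v \<bullet> u)) v = denominator v"
proof -
  define N where "N = (\<lambda>S. \<rho>v - (\<Sum>\<beta>\<in>S. coroot \<beta>)) ` Pow pos_roots \<union> (\<lambda>w. w \<rho>v) ` W"
  have N: "finite N" by (simp add: N_def finite_pos_roots finite_weyl)
  have "denominator v = (\<Sum>\<nu>\<in>N. denominator_coeff \<nu> * exp (\<nu> \<bullet> v))"
    by (rule denominator_expansion[OF N]) (simp add: N_def)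
  also have "\<dots> = (\<Sum>\<nu>\<in>(\<lambda>w. w \<rho>v) ` W. denominator_coeff \<nu> * exp (\<nu> \<bullet> v))"
    by (rule sum.mono_neutral_right[OF N]) (use denominator_coeff_support in \<open>auto simp: N_def\<close>)
  also have "\<dots> = (\<Sum>w\<in>W. sg w * exp (w \<rho>v \<bullet> v))"
    by (simp add: sum.reindex[OF \<rho>v_inj_on] denominator_coeff_weyl denominator_coeff_\<rho>v)
  also have "\<dots> = alt_sum (\<lambda>u. exp (\<rho>v \<bullet> u)) v"
    by (simp add: alt_sum_inv weyl_inv_inner)
  finally show ?thesis ..
qed

end

section \<open>Minuscule orbits\<close>

locale minuscule_orbit = simple_roots \<Phi> \<alpha>
  for \<Phi> :: "(real ^ 'n) set" and \<alpha> :: "'i::finite \<Rightarrow> real ^ 'n" +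
  fixes \<omega> :: "real ^ 'n"
  assumes dominant: "dominant_weight \<alpha> \<omega>" and minuscule: "minuscule_weight \<Phi> \<alpha> \<omega>"
begin

definition orb :: "(real ^ 'n) set" where
  "orb = (\<lambda>w. w \<omega>) ` W"

abbreviation pr :: "'i \<Rightarrow> real ^ 'n \<Rightarrow> real" where
  "pr i x \<equiv> x \<bullet> coroot (\<alpha> i)"

lemma pr_alpha [simp]: "pr i (\<alpha> i) = 2"
  by (simp add: inner_coroot)

lemma finite_orb: "finite orb"
  by (simp add: orb_def finite_weyl)

lemma omega_orb: "\<omega> \<in> orb"
  unfolding orb_def by (rule image_eqI[OF _ weyl_id]) simp

lemma weyl_orb: "w \<in> W \<Longrightarrow> x \<in> orb \<Longrightarrow> w x \<in> orb"
proof -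
  assume w: "w \<in> W" and "x \<in> orb"
  then obtain w' where "w' \<in> W" "x = w' \<omega>" by (auto simp: orb_def)
  then show "w x \<in> orb"
    unfolding orb_def using weyl_comp[OF w] by (intro image_eqI[of _ _ "w \<circ> w'"]) simp_all
qed

lemma simple_reflection_orb: "x \<in> orb \<Longrightarrow> s i x \<in> orb"
  by (rule weyl_orb[OF reflection_weyl[OF alpha_root]])

text \<open>The pairing of \<open>w \<omega>\<close> with a coroot is the pairing of
  \<open>\<omega>\<close> with another one. Consequently every \<open>\<alpha> i\<close>-string in
  the orbit has one or two elements.\<close>

lemma pr_orb:
  assumes "x \<in> orb"
  shows "pr i x = - 1 \<or> pr i x = 0 \<or> pr i x = 1"
proof -
  obtain w where w: "w \<in> W" "x = w \<omega>" using assms by (auto simp: orb_def)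
  have "pr i x = \<omega> \<bullet> coroot (inv w (\<alpha> i))"
    using w coroot_orthogonal[OF weyl_orthogonal[OF weyl_inv[OF w(1)]]] by (simp add: weyl_inv_inner)
  moreover have "inv w (\<alpha> i) \<in> \<Phi>" using weyl_root[OF weyl_inv[OF w(1)]] by simp
  ultimately show ?thesis using minuscule by (auto simp: minuscule_weight_def)
qed

lemma orb_up: "x \<in> orb \<Longrightarrow> pr i x = - 1 \<Longrightarrow> x + \<alpha> i \<in> orb"
  using simple_reflection_orb[of x i] by (simp add: root_reflection_def)

lemma orb_down: "x \<in> orb \<Longrightarrow> pr i x = 1 \<Longrightarrow> x - \<alpha> i \<in> orb"
  using simple_reflection_orb[of x i] by (simp add: root_reflection_def)

lemma pr_up: "x \<in> orb \<Longrightarrow> x + \<alpha> i \<in> orb \<Longrightarrow> pr i x = - 1"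
  using pr_orb[of x i] pr_orb[of "x + \<alpha> i" i] by (auto simp: inner_add_left)

lemma pr_down: "x \<in> orb \<Longrightarrow> x - \<alpha> i \<in> orb \<Longrightarrow> pr i x = 1"
  using pr_orb[of x i] pr_orb[of "x - \<alpha> i" i] by (auto simp: inner_diff_left)

text \<open>Each letter of a word moves the weight by an integral multiple of a simple root.\<close>

lemma cf_diff_int:
  assumes "x \<in> orb" "y \<in> orb"
  shows "cf i (x - y) \<in> \<int>"
proof -
  have "cf i (\<omega> - wd l \<omega>) \<in> \<int>" for l
  proof (induction l)
    case (Cons j l)
    have orb: "wd l \<omega> \<in> orb" by (rule weyl_orb[OF wd_weyl omega_orb])
    have "cf i (\<omega> - wd (j # l) \<omega>) = cf i (\<omega> - wd l \<omega>) + pr j (wd l \<omega>) * (if i = j then 1 else 0)"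
      by (simp add: root_reflection_def cf_simps)
    moreover have "pr j (wd l \<omega>) \<in> \<int>" using pr_orb[OF orb, of j] by (metis Ints_0 Ints_1 Ints_minus)
    ultimately show ?case using Cons by simp
  qed simp
  then have "cf i (\<omega> - z) \<in> \<int>" if "z \<in> orb" for z
    using that weyl_eq_wd by (auto simp: orb_def)
  from this[OF assms(2)] this[OF assms(1)]
  have "cf i (\<omega> - y) - cf i (\<omega> - x) \<in> \<int>" by (rule Ints_diff)
  then show ?thesis by (simp add: cf_diff)
qed

text \<open>Comparing real coordinates suffices: on the orbit their differences are integral by
  \<open>cf_diff_int\<close>, and \<open>le_R\<close> shows that this is the order generated by the
  edges.\<close>

definition ple :: "real ^ 'n \<Rightarrow> real ^ 'n \<Rightarrow> bool" (infix "\<preceq>" 50) where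
  "x \<preceq> y \<longleftrightarrow> (\<forall>i. cf i x \<le> cf i y)"

lemma ple_refl [simp]: "x \<preceq> x"
  and ple_trans: "x \<preceq> y \<Longrightarrow> y \<preceq> z \<Longrightarrow> x \<preceq> z"
  and ple_add_alpha [simp]: "x \<preceq> x + \<alpha> i"
  and ple_add_mono [simp]: "x + z \<preceq> y + z \<longleftrightarrow> x \<preceq> y"
  by (auto simp: ple_def cf_add intro: order_trans)

lemma ple_antisym: "x \<preceq> y \<Longrightarrow> y \<preceq> x \<Longrightarrow> x = y"
  by (intro cf_eqI) (simp add: ple_def order_antisym)

lemma inner_alpha_nonpos:
  assumes "\<And>j. cf j d \<ge> 0" "cf i d = 0"
  shows "d \<bullet> \<alpha> i \<le> 0"
proof -
  have "\<alpha> i \<bullet> d = (\<Sum>j\<in>UNIV. cf j d * (\<alpha> i \<bullet> \<alpha> j))" by (rule inner_expansion)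
  also have "\<dots> \<le> 0"
  proof (rule sum_nonpos)
    fix j
    show "cf j d * (\<alpha> i \<bullet> \<alpha> j) \<le> 0"
      using assms alpha_inner_nonpos[of i j] by (cases "i = j") (auto intro: mult_nonneg_nonpos)
  qed
  finally show ?thesis by (simp add: inner_commute)
qed

text \<open>With equal \<open>i\<close>-th coordinates, \<open>inner_alpha_nonpos\<close> would
  prevent the pairing from growing; by integrality the coordinates then differ by at least 1. This
  is the only way in which growing pairings are exploited.\<close>

lemma ple_cf_ge_1:
  assumes "x \<in> orb" "y \<in> orb" "x \<preceq> y" "pr i x < pr i y"
  shows "cf i x + 1 \<le> cf i y"
proof -
  have "cf i (y - x) \<noteq> 0"
  proof
    assume "cf i (y - x) = 0"
    then have "(y - x) \<bullet> \<alpha> i \<le> 0"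
      using assms(3) by (intro inner_alpha_nonpos) (auto simp: ple_def cf_diff)
    then have "pr i (y - x) \<le> 0" by (simp add: inner_coroot divide_le_0_iff)
    then show False using assms(4) by (simp add: inner_diff_left)
  qed
  moreover have "cf i (y - x) \<ge> 0" using assms(3) by (simp add: ple_def cf_diff)
  ultimately have "cf i (y - x) \<ge> 1"
    using cf_diff_int[OF assms(2,1), of i] by (auto elim!: Ints_cases)
  then show ?thesis by (simp add: cf_diff)
qed

lemma ple_up:
  assumes "x \<in> orb" "y \<in> orb" "x \<preceq> y" "pr i x < pr i y"
  shows "x + \<alpha> i \<preceq> y"
  using ple_cf_ge_1[OF assms] assms(3) by (auto simp: ple_def cf_add)

lemma ple_down:
  assumes "x \<in> orb" "y \<in> orb" "x \<preceq> y" "pr i x < pr i y"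
  shows "x \<preceq> y - \<alpha> i"
  using ple_cf_ge_1[OF assms] assms(3) by (auto simp: ple_def cf_diff)

text \<open>The pairing grows from \<open>x\<close> to the upper end \<open>y + \<alpha> i\<close>,
  so \<open>ple_down\<close> applies. Thus the upper set of such an \<open>x\<close> contains
  two-element strings entirely or not at all.\<close>

lemma ple_string:
  assumes x: "x \<in> orb" "pr i x \<le> 0" and y: "y \<in> orb" "pr i y = - 1"
  shows "x \<preceq> y + \<alpha> i \<longleftrightarrow> x \<preceq> y"
proof
  assume "x \<preceq> y + \<alpha> i"
  moreover have "pr i x < pr i (y + \<alpha> i)" using x(2) y(2) by (simp add: inner_add_left)
  ultimately show "x \<preceq> y" using ple_down[OF x(1) orb_up[OF y], of i] by simp
qed (rule ple_trans[OF _ ple_add_alpha])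

lemma orb_ple_omega:
  assumes "x \<in> orb"
  shows "x \<preceq> \<omega>"
proof -
  have "\<omega> \<bullet> \<alpha> i \<ge> 0" for i
    using dominant by (subst inner_alpha) (simp add: dominant_weight_def)
  then show ?thesis
    using assms dominant_minus_weyl[of \<omega>] by (auto simp: orb_def ple_def cf_diff)
qed

text \<open>Otherwise \<open>x\<close> would be dominant and hence above all its conjugates,
  including \<open>\<omega>\<close>.\<close>

lemma exists_pr_minus_1:
  assumes "x \<in> orb" "x \<noteq> \<omega>"
  shows "\<exists>i. pr i x = - 1"
proof (rule ccontr)
  assume "\<not> ?thesis"
  then have "pr i x \<ge> 0" for i using pr_orb[OF assms(1), of i] by auto
  then have pos: "x \<bullet> \<alpha> i \<ge> 0" for i by (subst inner_alpha) simp
  obtain w where w: "w \<in> W" "x = w \<omega>" using assms(1) by (auto simp: orb_def)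
  then have "\<omega> = inv w x" using weyl_bij[OF w(1)] by (simp add: bij_is_inj)
  then have "\<omega> \<preceq> x"
    using dominant_minus_weyl[OF pos weyl_inv[OF w(1)]] by (simp add: ple_def cf_diff)
  then show False using ple_antisym orb_ple_omega assms by blast
qed

section \<open>Characters of multichains\<close>

text \<open>This is F_m(x): \<open>x\<close> only bounds the multichain from below and contributes
  no factor of its own.\<close>

primrec chain_sum :: "nat \<Rightarrow> real ^ 'n \<Rightarrow> real ^ 'n \<Rightarrow> real" where
  "chain_sum 0 x v = 1"
| "chain_sum (Suc m) x v = (\<Sum>y\<in>{y \<in> orb. x \<preceq> y}. exp (y \<bullet> v) * chain_sum m y v)"

text \<open>The relation \<open>G = D H\<close> for the Demazure operator
  \<open>D = (1 - e\<^bsup>-\<alpha>\<^esup> s) / (1 - e\<^bsup>-\<alpha>\<^esup>)\<close>, with the denominator cleared.\<close>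

definition demazure :: "'i \<Rightarrow> (real ^ 'n \<Rightarrow> real) \<Rightarrow> (real ^ 'n \<Rightarrow> real) \<Rightarrow> bool" where
  "demazure i G H \<longleftrightarrow>
    (\<forall>v. (1 - exp (- (\<alpha> i \<bullet> v))) * G v = H v - exp (- (\<alpha> i \<bullet> v)) * H (s i v))"

lemma alpha_inner_reflection: "\<alpha> i \<bullet> s i v = - (\<alpha> i \<bullet> v)"
  by (simp add: root_reflection_self_adjoint[symmetric] root_reflection_self)

text \<open>Compare the relation at \<open>v\<close> with the one at \<open>s i v\<close>. The
  cleared denominator vanishes only when \<open>\<alpha> i \<bullet> v = 0\<close>, and then
  \<open>s i\<close> fixes \<open>v\<close>.\<close>

lemma demazure_invariant:
  assumes "demazure i G H"
  shows "G (s i v) = G v"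
proof (cases "\<alpha> i \<bullet> v = 0")
  case True
  then have "s i v = v" by (simp add: root_reflection_def inner_coroot inner_commute)
  then show ?thesis by simp
next
  case False
  define E where "E = exp (\<alpha> i \<bullet> v)"
  have E: "E > 0" "E \<noteq> 1" using False by (simp_all add: E_def)
  have "(1 - inverse E) * G v = H v - inverse E * H (s i v)"
    using assms by (simp add: demazure_def E_def exp_minus)
  moreover have "(1 - E) * G (s i v) = H (s i v) - E * H v"
    using assms[unfolded demazure_def, rule_format, of "s i v"]
    by (simp add: alpha_inner_reflection E_def)
  ultimately have "(1 - E) * G (s i v) = (1 - E) * G v"
    using E(1) by (simp add: field_simps)
  then show ?thesis using E(2) by simp
qed

lemma demazure_self: "(\<And>v. H (s i v) = H v) \<Longrightarrow> demazure i H H"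
  by (simp add: demazure_def left_diff_distrib)

lemma demazure_sum:
  assumes "\<And>y. y \<in> A \<Longrightarrow> demazure i (G y) (H y)"
  shows "demazure i (\<lambda>v. \<Sum>y\<in>A. G y v) (\<lambda>v. \<Sum>y\<in>A. H y v)"
  using assms by (simp add: demazure_def sum_distrib_left flip: sum_subtractf)

lemma demazure_add:
  "demazure i G H \<Longrightarrow> demazure i G' H' \<Longrightarrow> demazure i (\<lambda>v. G v + G' v) (\<lambda>v. H v + H' v)"
  by (simp add: demazure_def distrib_left)

text \<open>The twisted Leibniz rule on a two-element string: since \<open>s i\<close> exchanges its
  ends, D maps e^(y + alpha_i) H to e^y (D H) + e^(y + alpha_i) H.\<close>

lemma demazure_pair:
  assumes "demazure i G H" "pr i y = - 1"
  shows "demazure i (\<lambda>v. exp (y \<bullet> v) * G v + exp ((y + \<alpha> i) \<bullet> v) * H v) (\<lambda>v. exp ((y + \<alpha> i) \<bullet> v) * H v)"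
  unfolding demazure_def
proof
  fix v
  let ?e = "exp (- (\<alpha> i \<bullet> v))"
  have "s i (y + \<alpha> i) = y"
    using assms(2) by (simp add: root_reflection_def inner_add_left algebra_simps flip: scaleR_2)
  then have 1: "exp ((y + \<alpha> i) \<bullet> s i v) = exp (y \<bullet> v)"
    by (simp flip: root_reflection_self_adjoint)
  have 2: "?e * exp ((y + \<alpha> i) \<bullet> v) = exp (y \<bullet> v)"
    by (simp add: inner_add_left flip: exp_add)
  have G: "?e * H (s i v) = H v - (1 - ?e) * G v"
    using assms(1) by (simp add: demazure_def)
  have "exp ((y + \<alpha> i) \<bullet> v) * H v - ?e * (exp ((y + \<alpha> i) \<bullet> s i v) * H (s i v))
      = exp ((y + \<alpha> i) \<bullet> v) * H v - exp (y \<bullet> v) * (?e * H (s i v))"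
    unfolding 1 by (simp add: mult_ac)
  also have "\<dots> = exp ((y + \<alpha> i) \<bullet> v) * H v - ?e * exp ((y + \<alpha> i) \<bullet> v) * H v
      + (1 - ?e) * (exp (y \<bullet> v) * G v)"
    unfolding G 2 by (simp add: algebra_simps)
  also have "\<dots> = (1 - ?e) * (exp (y \<bullet> v) * G v + exp ((y + \<alpha> i) \<bullet> v) * H v)"
    by (simp add: algebra_simps)
  finally show "(1 - ?e) * (exp (y \<bullet> v) * G v + exp ((y + \<alpha> i) \<bullet> v) * H v) =
      exp ((y + \<alpha> i) \<bullet> v) * H v - ?e * (exp ((y + \<alpha> i) \<bullet> s i v) * H (s i v))" ..
qed

text \<open>Two-element strings are indexed by their lower end \<open>y\<close>. An upward closed
  set may contain only the upper end, which is why the lower summand is conditional.\<close>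

lemma sum_strings:
  fixes g :: "real ^ 'n \<Rightarrow> real"
  assumes T: "T \<subseteq> orb" and up: "\<And>y. y \<in> T \<Longrightarrow> pr i y = - 1 \<Longrightarrow> y + \<alpha> i \<in> T"
  shows "(\<Sum>y\<in>T. g y) = (\<Sum>y\<in>{y \<in> T. pr i y = 0}. g y) +
    (\<Sum>y\<in>{y \<in> orb. pr i y = - 1 \<and> y + \<alpha> i \<in> T}. (if y \<in> T then g y else 0) + g (y + \<alpha> i))"
proof -
  let ?A = "{y \<in> orb. pr i y = - 1 \<and> y + \<alpha> i \<in> T}"
  have fin: "finite T" "finite ?A" using T finite_orb finite_subset by auto
  have T_eq: "T = {y \<in> T. pr i y = 0} \<union> ({y \<in> ?A. y \<in> T} \<union> (\<lambda>y. y + \<alpha> i) ` ?A)"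
  proof (intro equalityI subsetI)
    fix y assume y: "y \<in> T"
    then have "y \<in> orb" using T by blast
    then consider "pr i y = 0" | "pr i y = - 1" | "pr i y = 1" using pr_orb by blast
    then show "y \<in> {y \<in> T. pr i y = 0} \<union> ({y \<in> ?A. y \<in> T} \<union> (\<lambda>y. y + \<alpha> i) ` ?A)"
    proof cases
      case 3
      then have "y - \<alpha> i \<in> ?A" using y \<open>y \<in> orb\<close> orb_down by (simp add: inner_diff_left)
      then show ?thesis by (auto intro!: image_eqI[of _ _ "y - \<alpha> i"])
    qed (use y \<open>y \<in> orb\<close> up in auto)
  qed auto
  have "(\<Sum>y\<in>T. g y) = (\<Sum>y\<in>{y \<in> T. pr i y = 0}. g y) +
      ((\<Sum>y\<in>{y \<in> ?A. y \<in> T}. g y) + (\<Sum>y\<in>(\<lambda>y. y + \<alpha> i) ` ?A. g y))"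
    by (subst T_eq, subst sum.union_disjoint, use fin in \<open>auto simp: inner_add_left\<close>,
        subst sum.union_disjoint, use fin in \<open>auto simp: inner_add_left\<close>)
  also have "(\<Sum>y\<in>(\<lambda>y. y + \<alpha> i) ` ?A. g y) = (\<Sum>y\<in>?A. g (y + \<alpha> i))"
    by (subst sum.reindex) (auto simp: inj_on_def)
  also have "(\<Sum>y\<in>{y \<in> ?A. y \<in> T}. g y) = (\<Sum>y\<in>?A. if y \<in> T then g y else 0)"
    by (rule sum.inter_filter[OF fin(2)])
  finally show ?thesis by (simp only: sum.distrib)
qed

lemma exp_reflection: "pr i y = 0 \<Longrightarrow> exp (y \<bullet> s i v) = exp (y \<bullet> v)"
  using root_reflection_self_adjoint[of "\<alpha> i" y v] by (simp add: root_reflection_def[of _ y])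

text \<open>\<open>T\<close> is a union of entire strings. A string with two elements contributes an
  image of the Demazure operator, and a single element with pairing 0 contributes invariant
  factors.\<close>

lemma stable_sum_invariant:
  assumes f: "\<And>x. x \<in> orb \<Longrightarrow> pr i x = - 1 \<Longrightarrow> demazure i (f x) (f (x + \<alpha> i))"
    "\<And>x v. x \<in> orb \<Longrightarrow> pr i x = 0 \<Longrightarrow> f x (s i v) = f x v"
    and T: "T \<subseteq> orb" "\<And>y. y \<in> orb \<Longrightarrow> pr i y = - 1 \<Longrightarrow> y \<in> T \<longleftrightarrow> y + \<alpha> i \<in> T"
  shows "(\<Sum>y\<in>T. exp (y \<bullet> s i v) * f y (s i v)) = (\<Sum>y\<in>T. exp (y \<bullet> v) * f y v)"
proof -
  have up: "\<And>y. y \<in> T \<Longrightarrow> pr i y = - 1 \<Longrightarrow> y + \<alpha> i \<in> T" using T by blast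
  have A: "(\<Sum>y\<in>{y \<in> T. pr i y = 0}. exp (y \<bullet> s i v) * f y (s i v)) =
    (\<Sum>y\<in>{y \<in> T. pr i y = 0}. exp (y \<bullet> v) * f y v)"
    by (rule sum.cong[OF refl]) (use T(1) f(2) exp_reflection in auto)
  have B: "(if y \<in> T then exp (y \<bullet> s i v) * f y (s i v) else 0) + exp ((y + \<alpha> i) \<bullet> s i v) * f (y + \<alpha> i) (s i v)
    = (if y \<in> T then exp (y \<bullet> v) * f y v else 0) + exp ((y + \<alpha> i) \<bullet> v) * f (y + \<alpha> i) v"
    if "y \<in> {y \<in> orb. pr i y = - 1 \<and> y + \<alpha> i \<in> T}" for y
  proof -
    have y: "y \<in> orb" "pr i y = - 1" "y \<in> T" using that T(2)[of y] by auto
    show ?thesis using demazure_invariant[OF demazure_pair[OF f(1)[OF y(1,2)] y(2)], of v] y(3) by simp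
  qed
  show ?thesis
    by (subst (1 2) sum_strings[OF T(1) up]) (simp_all only: A sum.cong[OF refl B])
qed

text \<open>The upper sets of \<open>x\<close> and \<open>x + \<alpha> i\<close> share their
  elements of pairing 0 and meet the same two-element strings; they differ only in which lower ends
  they contain. Invariance for pairing 0 is carried through the induction to handle the single
  elements.\<close>

lemma chain_sum_demazure:
  "(\<forall>x\<in>orb. pr i x = - 1 \<longrightarrow> demazure i (chain_sum m x) (chain_sum m (x + \<alpha> i))) \<and>
   (\<forall>x\<in>orb. pr i x = 0 \<longrightarrow> (\<forall>v. chain_sum m x (s i v) = chain_sum m x v))"
proof (induction m)
  case 0
  then show ?case by (auto intro: demazure_self)
next
  case (Suc m)
  then have IH: "\<And>x. x \<in> orb \<Longrightarrow> pr i x = - 1 \<Longrightarrow> demazure i (chain_sum m x) (chain_sum m (x + \<alpha> i))"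
    "\<And>x v. x \<in> orb \<Longrightarrow> pr i x = 0 \<Longrightarrow> chain_sum m x (s i v) = chain_sum m x v" by auto
  let ?T = "\<lambda>x. {y \<in> orb. x \<preceq> y}"
  have "demazure i (chain_sum (Suc m) x) (chain_sum (Suc m) (x + \<alpha> i))" if x: "x \<in> orb" "pr i x = - 1" for x
  proof -
    let ?A = "{y \<in> orb. pr i y = - 1 \<and> x \<preceq> y}" and ?Z = "{y \<in> orb. x \<preceq> y \<and> pr i y = 0}"
    let ?g = "\<lambda>y v. exp (y \<bullet> v) * chain_sum m y v"
    have up: "\<And>y. y \<in> ?T x' \<Longrightarrow> pr i y = - 1 \<Longrightarrow> y + \<alpha> i \<in> ?T x'" for x'
      using orb_up ple_trans by auto
    have sub: "?T x' \<subseteq> orb" for x' by blast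
    have e1: "{y \<in> orb. pr i y = - 1 \<and> y + \<alpha> i \<in> ?T x} = ?A"
    proof -
      have "y + \<alpha> i \<in> orb \<and> (x \<preceq> y + \<alpha> i \<longleftrightarrow> x \<preceq> y)" if "y \<in> orb" "pr i y = - 1" for y
        using ple_string[OF x(1) _ that] orb_up[OF that] x(2) by simp
      then show ?thesis by blast
    qed
    have e2: "{y \<in> orb. pr i y = - 1 \<and> y + \<alpha> i \<in> ?T (x + \<alpha> i)} = ?A"
      using orb_up by auto
    have e3: "{y \<in> ?T x. pr i y = 0} = ?Z" by auto
    have e4: "{y \<in> ?T (x + \<alpha> i). pr i y = 0} = ?Z"
    proof -
      have "x + \<alpha> i \<preceq> y \<longleftrightarrow> x \<preceq> y" if "y \<in> orb" "pr i y = 0" for y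
        using ple_up[OF x(1) that(1), of i] that(2) x(2) ple_trans[OF ple_add_alpha[of x i], of y] by auto
      then show ?thesis by blast
    qed
    have F1: "chain_sum (Suc m) x v = (\<Sum>y\<in>?Z. ?g y v) + (\<Sum>y\<in>?A. (if y \<in> ?T x then ?g y v else 0) + ?g (y + \<alpha> i) v)" for v
      unfolding chain_sum.simps by (subst sum_strings[OF sub, where i = i], erule up, assumption, intro arg_cong2[where f = "(+)"] sum.cong[OF e3 refl] sum.cong[OF e1 refl])
    have F2: "chain_sum (Suc m) (x + \<alpha> i) v = (\<Sum>y\<in>?Z. ?g y v) + (\<Sum>y\<in>?A. (if y \<in> ?T (x + \<alpha> i) then ?g y v else 0) + ?g (y + \<alpha> i) v)" for v
      unfolding chain_sum.simps by (subst sum_strings[OF sub, where i = i], erule up, assumption, intro arg_cong2[where f = "(+)"] sum.cong[OF e4 refl] sum.cong[OF e2 refl])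
    have A: "demazure i (\<lambda>v. (if y \<in> ?T x then ?g y v else 0) + ?g (y + \<alpha> i) v)
        (\<lambda>v. (if y \<in> ?T (x + \<alpha> i) then ?g y v else 0) + ?g (y + \<alpha> i) v)" if "y \<in> ?A" for y
    proof -
      have y: "y \<in> orb" "pr i y = - 1" "x \<preceq> y" using that by auto
      have p: "demazure i (\<lambda>v. ?g y v + ?g (y + \<alpha> i) v) (\<lambda>v. ?g (y + \<alpha> i) v)"
        by (rule demazure_pair[OF IH(1)[OF y(1,2)] y(2)])
      have q: "demazure i (\<lambda>v. ?g y v + ?g (y + \<alpha> i) v) (\<lambda>v. ?g y v + ?g (y + \<alpha> i) v)"
        by (rule demazure_self) (rule demazure_invariant[OF p])
      \<comment> \<open>If \<open>x + \<alpha> i \<preceq> y\<close>, both upper sets contain the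
        whole string, an invariant sum, and \<open>q\<close> applies. Otherwise the upper set of
        \<open>x + \<alpha> i\<close> contains only the upper end, and \<open>p\<close> restores the
        missing one.\<close>
      show ?thesis
        using y p q by (cases "x + \<alpha> i \<preceq> y") simp_all
    qed
    have Z: "demazure i (\<lambda>v. ?g y v) (\<lambda>v. ?g y v)" if "y \<in> ?Z" for y
      using that IH(2) exp_reflection by (intro demazure_self) auto
    show ?thesis
      unfolding F1[abs_def] F2[abs_def]
      by (rule demazure_add, rule demazure_sum, erule Z, rule demazure_sum, erule A)
  qed
  moreover have "chain_sum (Suc m) x (s i v) = chain_sum (Suc m) x v" if x: "x \<in> orb" "pr i x = 0" for x v
    unfolding chain_sum.simps
  proof (rule stable_sum_invariant[where f = "chain_sum m"])
    show "demazure i (chain_sum m x) (chain_sum m (x + \<alpha> i))" if "x \<in> orb" "pr i x = - 1" for x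
      using that by (rule IH(1))
    show "chain_sum m x (s i v) = chain_sum m x v" if "x \<in> orb" "pr i x = 0" for x v
      using that by (rule IH(2))
    show "?T x \<subseteq> orb" by blast
    fix y assume y: "y \<in> orb" "pr i y = - 1"
    show "y \<in> ?T x \<longleftrightarrow> y + \<alpha> i \<in> ?T x"
      using ple_string[OF x(1) _ y] orb_up[OF y] y(1) x(2) by simp
  qed
  ultimately show ?case by blast
qed

lemma chain_sum_omega: "chain_sum m \<omega> v = exp (real m * (\<omega> \<bullet> v))"
proof (induction m)
  case (Suc m)
  have "{y \<in> orb. \<omega> \<preceq> y} = {\<omega>}"
    using omega_orb orb_ple_omega ple_antisym by auto
  then show ?case using Suc by (simp add: algebra_simps flip: exp_add)
qed simp

text \<open>The index \<open>m\<close> counts the elements after the least one, so the multichains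
  have length \<open>m + 1\<close>.\<close>

definition multichain_sum :: "nat \<Rightarrow> real ^ 'n \<Rightarrow> real" where
  "multichain_sum m v = (\<Sum>x\<in>orb. exp (x \<bullet> v) * chain_sum m x v)"

lemma multichain_sum_weyl:
  assumes "w \<in> W"
  shows "multichain_sum m (w v) = multichain_sum m v"
proof -
  have inv: "multichain_sum m (s i v) = multichain_sum m v" for i v
    unfolding multichain_sum_def
    by (rule stable_sum_invariant[where f = "chain_sum m"]) (use chain_sum_demazure orb_up in blast)+
  have "multichain_sum m (wd l v) = multichain_sum m v" for l
    by (induction l) (simp_all add: inv)
  then show ?thesis using weyl_eq_wd[OF assms] by blast
qed

theorem multichain_sum_character:
  "alt_sum (\<lambda>u. exp (weyl_vector \<alpha> \<bullet> u)) v * multichain_sum m v =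
   alt_sum (\<lambda>u. exp ((real (Suc m) *\<^sub>R \<omega> + weyl_vector \<alpha>) \<bullet> u)) v"
proof -
  let ?g = "\<lambda>x u. exp ((weyl_vector \<alpha> + x) \<bullet> u) * chain_sum m x u"
  have "alt_sum (\<lambda>u. exp (weyl_vector \<alpha> \<bullet> u)) v * multichain_sum m v
      = (\<Sum>w\<in>W. sg w * exp (weyl_vector \<alpha> \<bullet> w v) * multichain_sum m (w v))"
    by (simp add: alt_sum_def sum_distrib_right multichain_sum_weyl)
  also have "\<dots> = (\<Sum>w\<in>W. \<Sum>x\<in>orb. sg w * ?g x (w v))"
    by (simp add: multichain_sum_def sum_distrib_left exp_add inner_add_left mult_ac)
  also have "\<dots> = (\<Sum>x\<in>orb. alt_sum (?g x) v)"
    unfolding alt_sum_def by (rule sum.swap)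
  also have "\<dots> = (\<Sum>x\<in>{\<omega>}. alt_sum (?g x) v)"
  proof (rule sum.mono_neutral_right[OF finite_orb])
    show "\<forall>x\<in>orb - {\<omega>}. alt_sum (?g x) v = 0"
    proof
      fix x assume "x \<in> orb - {\<omega>}"
      then obtain i where i: "x \<in> orb" "pr i x = - 1" using exists_pr_minus_1 by blast
      have "?g x (s i u) = ?g x u" for u
      proof -
        have "demazure i (chain_sum m x) (chain_sum m (x + \<alpha> i))" using i chain_sum_demazure by blast
        then have "chain_sum m x (s i u) = chain_sum m x u" by (rule demazure_invariant)
        \<comment> \<open>The pairing 1 of the Weyl vector cancels the pairing -1 of
          \<open>x\<close>; the shift by the Weyl vector is needed exactly here.\<close>
        moreover have "pr i (weyl_vector \<alpha> + x) = 0"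
          using i(2) by (simp add: inner_add_left weyl_vector_coroot)
        then have "exp ((weyl_vector \<alpha> + x) \<bullet> s i u) = exp ((weyl_vector \<alpha> + x) \<bullet> u)"
          by (rule exp_reflection)
        ultimately show ?thesis by (simp only:)
      qed
      then show "alt_sum (?g x) v = 0" by (rule alt_sum_eq_0)
    qed
  qed (use omega_orb in auto)
  also have "\<dots> = alt_sum (\<lambda>u. exp ((real (Suc m) *\<^sub>R \<omega> + weyl_vector \<alpha>) \<bullet> u)) v"
    by (simp add: chain_sum_omega inner_add_left algebra_simps flip: exp_add)
  finally show ?thesis .
qed

end

section \<open>Lattices of order ideals\<close>

locale finite_poset =
  fixes Q :: "('a, 'm) gorder_scheme"
  assumes finite_carrier: "finite (carrier Q)"
    and le_refl: "x \<in> carrier Q \<Longrightarrow> x \<sqsubseteq>\<^bsub>Q\<^esub> x"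
    and le_antisym: "x \<in> carrier Q \<Longrightarrow> y \<in> carrier Q \<Longrightarrow> x \<sqsubseteq>\<^bsub>Q\<^esub> y \<Longrightarrow> y \<sqsubseteq>\<^bsub>Q\<^esub> x \<Longrightarrow> x = y"
    and le_trans: "x \<in> carrier Q \<Longrightarrow> y \<in> carrier Q \<Longrightarrow> z \<in> carrier Q \<Longrightarrow>
      x \<sqsubseteq>\<^bsub>Q\<^esub> y \<Longrightarrow> y \<sqsubseteq>\<^bsub>Q\<^esub> z \<Longrightarrow> x \<sqsubseteq>\<^bsub>Q\<^esub> z"
begin

lemma ideal_subset: "X \<in> order_ideals Q \<Longrightarrow> X \<subseteq> carrier Q"
  by (simp add: order_ideals_def)

lemma ideal_closed: "X \<in> order_ideals Q \<Longrightarrow> x \<in> X \<Longrightarrow> y \<in> carrier Q \<Longrightarrow> y \<sqsubseteq>\<^bsub>Q\<^esub> x \<Longrightarrow> y \<in> X"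
  unfolding order_ideals_def by blast

lemma finite_ideal: "X \<in> order_ideals Q \<Longrightarrow> finite X"
  using ideal_subset finite_carrier finite_subset by blast

lemma finite_ideals: "finite (order_ideals Q)"
  by (rule finite_subset[of _ "Pow (carrier Q)"]) (auto simp: order_ideals_def finite_carrier)

lemma empty_ideal [simp]: "{} \<in> order_ideals Q"
  and carrier_ideal [simp]: "carrier Q \<in> order_ideals Q"
  by (auto simp: order_ideals_def)

text \<open>An element of \<open>Y - X\<close> with the largest principal ideal is maximal in
  \<open>Y - X\<close>. Nothing in \<open>X\<close> lies above it because \<open>X\<close> is an
  ideal, so it is maximal in \<open>Y\<close>.\<close>

lemma remove_maximal:
  assumes "X \<in> order_ideals Q" "Y \<in> order_ideals Q" "X \<subset> Y"
  shows "\<exists>y\<in>Y - X. Y - {y} \<in> order_ideals Q"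
proof -
  let ?d = "\<lambda>y. card {z \<in> carrier Q. z \<sqsubseteq>\<^bsub>Q\<^esub> y}"
  have fin: "finite (Y - X)" using finite_ideal[OF assms(2)] by simp
  have "Max (?d ` (Y - X)) \<in> ?d ` (Y - X)" using fin assms(3) by (intro Max_in) auto
  then obtain y where y: "y \<in> Y - X" "?d y = Max (?d ` (Y - X))" by auto
  have yc: "y \<in> carrier Q" using y(1) ideal_subset[OF assms(2)] by blast
  have max: "z = y" if z: "z \<in> Y - X" "y \<sqsubseteq>\<^bsub>Q\<^esub> z" for z
  proof (rule ccontr)
    assume "z \<noteq> y"
    have zc: "z \<in> carrier Q" using z(1) ideal_subset[OF assms(2)] by blast
    have "{u \<in> carrier Q. u \<sqsubseteq>\<^bsub>Q\<^esub> y} \<subset> {u \<in> carrier Q. u \<sqsubseteq>\<^bsub>Q\<^esub> z}"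
    proof
      show "{u \<in> carrier Q. u \<sqsubseteq>\<^bsub>Q\<^esub> y} \<subseteq> {u \<in> carrier Q. u \<sqsubseteq>\<^bsub>Q\<^esub> z}"
        using le_trans[OF _ yc zc _ z(2)] by blast
      have "z \<in> {u \<in> carrier Q. u \<sqsubseteq>\<^bsub>Q\<^esub> z}" using zc le_refl by blast
      moreover have "z \<notin> {u \<in> carrier Q. u \<sqsubseteq>\<^bsub>Q\<^esub> y}"
        using \<open>z \<noteq> y\<close> le_antisym[OF zc yc _ z(2)] by blast
      ultimately show "{u \<in> carrier Q. u \<sqsubseteq>\<^bsub>Q\<^esub> y} \<noteq> {u \<in> carrier Q. u \<sqsubseteq>\<^bsub>Q\<^esub> z}" by blast
    qed
    then have "?d y < ?d z" by (rule psubset_card_mono[rotated]) (simp add: finite_carrier)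
    moreover have "?d z \<le> ?d y" unfolding y(2) using fin z(1) by (intro Max_ge) auto
    ultimately show False by simp
  qed
  have "Y - {y} \<in> order_ideals Q"
    unfolding order_ideals_def
  proof (safe, goal_cases)
    case (1 x)
    then show ?case using ideal_subset[OF assms(2)] by blast
  next
    case (2 x z)
    then show ?case using ideal_closed[OF assms(2)] by blast
  next
    case (3 x z)
    then have "x \<notin> X" using y(1) ideal_closed[OF assms(1)] by blast
    then show ?case using max[of x] 3 by blast
  qed
  then show ?thesis using y(1) by blast
qed

lemma ideal_induct [consumes 1, case_names empty insert]:
  assumes "X \<in> order_ideals Q" and "P {}"
    and ins: "\<And>y X. X \<in> order_ideals Q \<Longrightarrow> y \<notin> X \<Longrightarrow> insert y X \<in> order_ideals Q \<Longrightarrow> P X \<Longrightarrow> P (insert y X)"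
  shows "P X"
  using assms(1)
proof (induction "card X" arbitrary: X)
  case 0
  then show ?case using finite_ideal[of X] assms(2) by auto
next
  case (Suc n)
  then have "{} \<subset> X" by auto
  then obtain y where y: "y \<in> X" "X - {y} \<in> order_ideals Q"
    using remove_maximal[OF empty_ideal Suc.prems] by blast
  have "n = card (X - {y})" using Suc.hyps(2) y(1) finite_ideal[OF Suc.prems] by simp
  then have "P (X - {y})" using Suc.hyps(1) y(2) by blast
  then have "P (insert y (X - {y}))" using y Suc.prems by (intro ins) (auto simp: insert_absorb)
  then show ?case using y(1) by (simp add: insert_absorb)
qed

end

text \<open>Only carrier, order and equality of \<open>L\<close> are fixed, so that the plain and
  the coloured lattice are both instances.\<close>

locale ideal_lattice_structure = finite_poset Q for Q :: "('a, 'm) gorder_scheme" +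
  fixes L :: "('a set, 'k) gorder_scheme"
  assumes L_carrier [simp]: "carrier L = order_ideals Q"
    and L_le [simp]: "gorder.le L = (\<subseteq>)"
    and L_eq [simp]: "eq L = (=)"
begin

lemma covered_by_iff:
  "covered_by L X Y \<longleftrightarrow>
    X \<in> order_ideals Q \<and> Y \<in> order_ideals Q \<and> (\<exists>y. y \<notin> X \<and> Y = insert y X)"
proof
  assume "covered_by L X Y"
  then have XY: "X \<in> order_ideals Q" "Y \<in> order_ideals Q" "X \<subset> Y"
    and cov: "\<And>Z. Z \<in> order_ideals Q \<Longrightarrow> X \<subset> Z \<Longrightarrow> \<not> Z \<subset> Y"
    by (auto simp: covered_by_def lless_def psubset_eq)
  obtain y where y: "y \<in> Y - X" "Y - {y} \<in> order_ideals Q" using remove_maximal[OF XY] by blast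
  have "Y - {y} = X" using cov[OF y(2)] XY(3) y(1) by blast
  then show "X \<in> order_ideals Q \<and> Y \<in> order_ideals Q \<and> (\<exists>y. y \<notin> X \<and> Y = insert y X)"
    using XY y(1) by (intro conjI exI[of _ y]) auto
next
  assume "X \<in> order_ideals Q \<and> Y \<in> order_ideals Q \<and> (\<exists>y. y \<notin> X \<and> Y = insert y X)"
  then show "covered_by L X Y"
    by (auto simp: covered_by_def lless_def)
qed

lemma L_partial_order: "partial_order L"
  by unfold_locales (auto simp: order_ideals_def)

lemma Un_ideal: "X \<in> order_ideals Q \<Longrightarrow> Y \<in> order_ideals Q \<Longrightarrow> X \<union> Y \<in> order_ideals Q"
  and Int_ideal: "X \<in> order_ideals Q \<Longrightarrow> Y \<in> order_ideals Q \<Longrightarrow> X \<inter> Y \<in> order_ideals Q"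
  unfolding order_ideals_def by blast+

lemma least_Un:
  "X \<in> order_ideals Q \<Longrightarrow> Y \<in> order_ideals Q \<Longrightarrow> least L (X \<union> Y) (Upper L {X, Y})"
  by (auto simp: least_def Upper_def Un_ideal)

lemma greatest_Int:
  "X \<in> order_ideals Q \<Longrightarrow> Y \<in> order_ideals Q \<Longrightarrow> greatest L (X \<inter> Y) (Lower L {X, Y})"
  by (auto simp: greatest_def Lower_def Int_ideal)

lemma join_eq: 
  assumes "X \<in> order_ideals Q" "Y \<in> order_ideals Q"
  shows "X \<squnion>\<^bsub>L\<^esub> Y = X \<union> Y"
  unfolding join_def sup_def
proof (rule some_equality, rule least_Un[OF assms])
  fix Z assume "least L Z (Upper L {X, Y})"
  then show "Z = X \<union> Y"
    using least_Un[OF assms] by (auto simp: least_def)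
qed

lemma meet_eq:
  assumes "X \<in> order_ideals Q" "Y \<in> order_ideals Q"
  shows "X \<sqinter>\<^bsub>L\<^esub> Y = X \<inter> Y"
  unfolding meet_def inf_def
proof (rule some_equality, rule greatest_Int[OF assms])
  fix Z assume "greatest L Z (Lower L {X, Y})"
  then show "Z = X \<inter> Y"
    using greatest_Int[OF assms] by (auto simp: greatest_def)
qed

lemma L_distributive: "distributive_lattice L"
  unfolding distributive_lattice_def
proof (intro conjI ballI)
  interpret partial_order L by (rule L_partial_order)
  show "lattice L"
    by unfold_locales (metis L_carrier least_Un, metis L_carrier greatest_Int)
qed (auto simp: join_eq meet_eq Un_ideal Int_ideal)

text \<open>Every cardinality occurs because maximal elements can be deleted from the full ideal one
  by one. Truncated subtraction keeps the count at 0 once the empty ideal is reached.\<close>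

lemma L_rank_function: "rank_function L card"
  unfolding rank_function_def
proof (intro conjI exI[of _ "card (carrier Q)"] allI impI)
  have "\<exists>X\<in>order_ideals Q. card X = card (carrier Q) - n" for n
  proof (induction n)
    case (Suc n)
    then obtain X where X: "X \<in> order_ideals Q" "card X = card (carrier Q) - n" by blast
    show ?case
    proof (cases "X = {}")
      case False
      then obtain y where "y \<in> X" "X - {y} \<in> order_ideals Q"
        using remove_maximal[OF empty_ideal X(1)] by blast
      then show ?thesis using X finite_ideal[OF X(1)] by (intro bexI[of _ "X - {y}"]) auto
    qed (use X in \<open>auto intro: bexI[of _ "{}"]\<close>)
  qed auto
  from this[of "card (carrier Q) - _"]
  have "\<exists>X\<in>order_ideals Q. card X = k" if "k \<le> card (carrier Q)" for k
    using that by (metis diff_diff_cancel)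
  then show "card ` carrier L = {0..card (carrier Q)}"
    using ideal_subset finite_carrier by (fastforce intro: card_mono)
  show "card Y = card X + 1" if "covered_by L X Y" for X Y
    using that finite_ideal unfolding covered_by_iff by auto
qed

lemma L_ranked: "ranked_poset L"
  unfolding ranked_poset_def using L_partial_order finite_ideals L_rank_function by auto

text \<open>The rank is an arbitrary choice, but it grows by 1 with each added element, and the
  value 0 has to occur, which pins it down at the empty ideal.\<close>

lemma poset_rank_L:
  assumes "X \<in> order_ideals Q"
  shows "poset_rank L X = card X"
proof -
  have r: "rank_function L (poset_rank L)"
    unfolding poset_rank_def by (rule someI[of "rank_function L"]) (rule L_rank_function)
  have eq: "poset_rank L Y = poset_rank L {} + card Y" if "Y \<in> order_ideals Q" for Y
    using that
  proof (induction rule: ideal_induct)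
    case (insert y X)
    then have "covered_by L X (insert y X)" unfolding covered_by_iff by blast
    then have "poset_rank L (insert y X) = poset_rank L X + 1"
      using r by (simp add: rank_function_def)
    then show ?case using insert finite_ideal[of X] by simp
  qed simp
  have "0 \<in> poset_rank L ` carrier L" using r by (auto simp: rank_function_def)
  then obtain Y where "Y \<in> order_ideals Q" "poset_rank L Y = 0" by auto
  then have "poset_rank L {} = 0" using eq[of Y] by simp
  then show ?thesis using eq[OF assms] by simp
qed

end

lemma ideal_lattice_simps [simp]:
  "carrier (ideal_lattice P) = order_ideals P"
  "gorder.le (ideal_lattice P) = (\<subseteq>)"
  "eq (ideal_lattice P) = (=)"
  by (simp_all add: ideal_lattice_def)

lemma colored_ideal_lattice_simps [simp]:
  "carrier (colored_ideal_lattice P) = order_ideals P"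
  "gorder.le (colored_ideal_lattice P) = (\<subseteq>)"
  "eq (colored_ideal_lattice P) = (=)"
  "edge_color (colored_ideal_lattice P) X Y = vertex_color P (the_elem (Y - X))"
  by (simp_all add: colored_ideal_lattice_def ideal_lattice_def gorder.defs edge_colored_poset.defs)

lemma colored_prod_chain_simps [simp]:
  "carrier (colored_prod_chain P M) = carrier P \<times> {..<M}"
  "gorder.le (colored_prod_chain P M) (x, k) (y, l) \<longleftrightarrow> gorder.le P x y \<and> k \<le> l"
  "vertex_color (colored_prod_chain P M) (v, k) = vertex_color P v"
  by (simp_all add: colored_prod_chain_def prod_poset_def chain_poset_def gorder.defs vertex_colored_poset.defs)

lemma prod_chain_simps [simp]:
  "carrier (prod_poset P (chain_poset M)) = carrier P \<times> {..<M}"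
  "gorder.le (prod_poset P (chain_poset M)) (x, k) (y, l) \<longleftrightarrow> gorder.le P x y \<and> k \<le> l"
  by (simp_all add: prod_poset_def chain_poset_def)

context finite_poset
begin

lemma ideal_lattice_structure: "ideal_lattice_structure Q (ideal_lattice Q)"
  by unfold_locales simp_all

end

lemma colored_ideal_lattice_structure:
  "finite_poset Q \<Longrightarrow> ideal_lattice_structure Q (colored_ideal_lattice Q)"
  by (simp add: ideal_lattice_structure_def ideal_lattice_structure_axioms_def)

lemma colored_edge_ideal_lattice:
  assumes "finite_poset Q"
  shows "colored_edge (colored_ideal_lattice Q) i X Y \<longleftrightarrow>
    X \<in> order_ideals Q \<and> Y \<in> order_ideals Q \<and> (\<exists>y. y \<notin> X \<and> Y = insert y X \<and> vertex_color Q y = i)"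
proof -
  interpret ideal_lattice_structure Q "colored_ideal_lattice Q"
    by (rule colored_ideal_lattice_structure[OF assms])
  have "insert y X - X = {y}" if "y \<notin> X" for y using that by auto
  then show ?thesis unfolding colored_edge_def covered_by_iff by auto
qed

text \<open>Parallel edges of a diamond adjoin the same element.\<close>

lemma diamond_colored_ideal_lattice:
  assumes "finite_poset Q"
  shows "diamond_colored (colored_ideal_lattice Q)"
proof -
  interpret ideal_lattice_structure Q "colored_ideal_lattice Q"
    by (rule colored_ideal_lattice_structure[OF assms])
  show ?thesis
    unfolding diamond_colored_def
  proof (intro allI impI, elim conjE)
    fix S T U V
    assume ne: "T \<noteq> U" and cov: "covered_by (colored_ideal_lattice Q) S T" "covered_by (colored_ideal_lattice Q) S U"
      "covered_by (colored_ideal_lattice Q) T V" "covered_by (colored_ideal_lattice Q) U V"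
    obtain a b c d where abcd: "a \<notin> S" "T = insert a S" "b \<notin> S" "U = insert b S"
      "c \<notin> T" "V = insert c T" "d \<notin> U" "V = insert d U"
      using cov unfolding covered_by_iff by blast
    have "a \<noteq> b" using abcd ne by auto
    then have "b \<in> V - T" "a \<in> V - U" using abcd by auto
    then have "c = b" "d = a" using abcd by blast+
    then have "T - S = {a}" "U - S = {b}" "V - T = {b}" "V - U = {a}" using abcd by auto
    then show "edge_color (colored_ideal_lattice Q) S T = edge_color (colored_ideal_lattice Q) U V \<and>
        edge_color (colored_ideal_lattice Q) S U = edge_color (colored_ideal_lattice Q) T V"
      by simp
  qed
qed

text \<open>Along edges of color \<open>i\<close> the sum of \<open>\<delta>\<close> and
  \<open>\<epsilon>\<close> is constant. On a component \<open>\<delta>\<close> is therefore the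
  rank and the sum is the length, and twice the rank minus the length is
  \<open>\<delta> - \<epsilon>\<close>.\<close>

lemma color_mass_eq:
  fixes R :: "('a, 'i) edge_colored_poset" and \<delta> \<epsilon> :: "'a \<Rightarrow> nat"
  assumes edge: "\<And>x y. colored_edge R i x y \<Longrightarrow> \<delta> y = Suc (\<delta> x) \<and> \<epsilon> x = Suc (\<epsilon> y)"
    and down: "\<And>x. x \<in> carrier R \<Longrightarrow> \<delta> x > 0 \<Longrightarrow> \<exists>y. colored_edge R i y x"
    and up: "\<And>x. x \<in> carrier R \<Longrightarrow> \<epsilon> x > 0 \<Longrightarrow> \<exists>y. colored_edge R i x y"
    and x: "x \<in> carrier R"
  shows "color_mass R i x = int (\<delta> x) - int (\<epsilon> x)"
proof -
  let ?E = "colored_edge R i"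
  define C where "C = {y. (\<lambda>u v. ?E u v \<or> ?E v u)\<^sup>*\<^sup>* x y}"
  define K where "K = color_component R i x"
  define l where "l = \<delta> x + \<epsilon> x"
  have K: "carrier K = C" "eq K = (=)" "gorder.le K = (\<lambda>u v. u \<in> C \<and> v \<in> C \<and> ?E u v)\<^sup>*\<^sup>*"
    by (simp_all add: K_def color_component_def poset_of_edges_def C_def)
  have xC: "x \<in> C" by (simp add: C_def)
  have Cstep: "v \<in> C" if "u \<in> C" "?E u v \<or> ?E v u" for u v
    using that unfolding C_def by (simp add: rtranclp.rtrancl_into_rtrancl)
  have C: "y \<in> carrier R \<and> \<delta> y + \<epsilon> y = l" if "y \<in> C" for y
  proof -
    have "(\<lambda>u v. ?E u v \<or> ?E v u)\<^sup>*\<^sup>* x y" using that by (simp add: C_def)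
    then show ?thesis
    proof (induction rule: rtranclp_induct)
      case (step u v)
      then have "u \<in> carrier R \<and> v \<in> carrier R" by (auto simp: colored_edge_def covered_by_def)
      then show ?case using step edge[of u v] edge[of v u] by auto
    qed (use x l_def in auto)
  qed
  have lower: "\<exists>z\<in>C. \<delta> z + k = \<delta> y" if "y \<in> C" "k \<le> \<delta> y" for y k
    using that(2)
  proof (induction k)
    case (Suc k)
    then obtain z where z: "z \<in> C" "\<delta> z + k = \<delta> y" by auto
    then obtain z' where "?E z' z" using down[of z] C Suc.prems by auto
    then show ?case using z edge[of z' z] Cstep[of z z'] by (intro bexI[of _ z']) auto
  qed (use that in auto)
  have upper: "\<exists>z\<in>C. \<epsilon> z + k = \<epsilon> y" if "y \<in> C" "k \<le> \<epsilon> y" for y k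
    using that(2)
  proof (induction k)
    case (Suc k)
    then obtain z where z: "z \<in> C" "\<epsilon> z + k = \<epsilon> y" by auto
    then obtain z' where "?E z z'" using up[of z] C Suc.prems by auto
    then show ?case using z edge[of z z'] Cstep[of z z'] by (intro bexI[of _ z']) auto
  qed (use that in auto)
  \<comment> \<open>At the end of an ascent \<open>\<epsilon>\<close> vanishes, so
    \<open>\<delta>\<close> attains the constant sum \<open>l\<close>, and descending from there
    takes all smaller values.\<close>
  obtain t where t: "t \<in> C" "\<epsilon> t = 0" using upper[OF xC order_refl] by auto
  then have tl: "\<delta> t = l" using C[of t] by simp
  have img: "\<delta> ` C = {0..l}"
  proof (intro equalityI subsetI)
    fix k assume "k \<in> {0..l}"
    then obtain z where "z \<in> C" "\<delta> z + (l - k) = l" using lower[OF t(1), of "l - k"] tl by auto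
    then show "k \<in> \<delta> ` C" using \<open>k \<in> {0..l}\<close> by (intro image_eqI[of _ _ z]) auto
  qed (use C in force)
  have mono: "u = v \<or> \<delta> u < \<delta> v" if "gorder.le K u v" for u v
    using that unfolding K by (induction rule: rtranclp_induct) (use edge in \<open>auto dest: edge\<close>)
  \<comment> \<open>Each edge raises \<open>\<delta>\<close> by exactly 1, which leaves no room
    between its ends.\<close>
  have cov: "covered_by K u v \<longleftrightarrow> u \<in> C \<and> ?E u v" for u v
  proof
    assume c: "covered_by K u v"
    then have uv: "u \<in> C" "v \<in> C" "u \<noteq> v" "gorder.le K u v"
      by (auto simp: covered_by_def lless_def K(1,2))
    then obtain w where w: "u \<in> C" "w \<in> C" "?E u w" "gorder.le K w v"
      unfolding K(3) by (metis (no_types, lifting) converse_rtranclpE)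
    have "w = v"
    proof (rule ccontr)
      assume "w \<noteq> v"
      moreover have "gorder.le K u w" unfolding K(3) using w by blast
      moreover have "u \<noteq> w" using edge[OF w(3)] by auto
      ultimately show False using c w by (auto simp: covered_by_def lless_def K(1,2))
    qed
    then show "u \<in> C \<and> ?E u v" using w by simp
  next
    assume uv: "u \<in> C \<and> ?E u v"
    then have vC: "v \<in> C" using Cstep by blast
    have e: "\<delta> v = Suc (\<delta> u)" using edge uv by blast
    have "gorder.le K u v" unfolding K(3) using uv vC by blast
    moreover have "\<not> (gorder.le K u z \<and> u \<noteq> z \<and> gorder.le K z v \<and> z \<noteq> v)" for z
      using mono[of u z] mono[of z v] e by auto
    ultimately show "covered_by K u v"
      using uv vC e by (auto simp: covered_by_def lless_def K(1,2))
  qed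
  have "rank_function K \<delta>"
    unfolding rank_function_def K(1) img cov using edge by auto
  then have r: "rank_function K (poset_rank K)"
    unfolding poset_rank_def by (rule someI[of "rank_function K"])
  then obtain l' where l': "poset_rank K ` C = {0..l'}"
    and step: "\<And>u v. u \<in> C \<Longrightarrow> ?E u v \<Longrightarrow> poset_rank K v = poset_rank K u + 1"
    unfolding rank_function_def K(1) cov by blast
  \<comment> \<open>The chosen rank and \<open>\<delta>\<close> differ by a constant on the
    component; as both attain 0, the constant is 0.\<close>
  have eq: "int (poset_rank K y) - int (\<delta> y) = int (poset_rank K x) - int (\<delta> x)" if "y \<in> C" for y
  proof -
    have "(\<lambda>u v. ?E u v \<or> ?E v u)\<^sup>*\<^sup>* x y" using that by (simp add: C_def)
    then show ?thesis
    proof (induction rule: rtranclp_induct)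
      case (step u v)
      then have uv: "u \<in> C" "v \<in> C" using Cstep[of u v] by (auto simp: C_def)
      then show ?case
        using step.IH step.hyps(2) edge[of u v] edge[of v u] \<open>\<And>u v. u \<in> C \<Longrightarrow> ?E u v \<Longrightarrow> poset_rank K v = poset_rank K u + 1\<close>[of u v]
          \<open>\<And>u v. u \<in> C \<Longrightarrow> ?E u v \<Longrightarrow> poset_rank K v = poset_rank K u + 1\<close>[of v u]
        by auto
    qed simp
  qed
  have "0 \<in> \<delta> ` C" "0 \<in> poset_rank K ` C" using img l' by auto
  then obtain y z where "y \<in> C" "\<delta> y = 0" "z \<in> C" "poset_rank K z = 0" by auto
  then have same: "poset_rank K x = \<delta> x" using eq[of y] eq[of z] by simp
  then have "poset_rank K y = \<delta> y" if "y \<in> C" for y using eq[OF that] by simp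
  then have "poset_rank K ` C = {0..l}" unfolding img[symmetric] by (rule image_cong[OF refl])
  moreover have "Max {0..l} = l" by (rule Max_eqI) auto
  ultimately have "poset_length K = l" by (simp only: poset_length_def K(1))
  then show ?thesis
    using same by (simp add: color_mass_def K_def[symmetric] l_def)
qed

section \<open>The minuscule splitting lattice\<close>

lemma Ints_between_0_1:
  fixes c :: real
  shows "c \<in> \<int> \<Longrightarrow> 0 \<le> c \<Longrightarrow> c \<le> 1 \<Longrightarrow> c = 0 \<or> c = 1"
  by (auto elim!: Ints_cases)

context minuscule_orbit
begin

abbreviation R :: "(real ^ 'n, 'i) edge_colored_poset" where
  "R \<equiv> minuscule_splitting_lattice \<Phi> \<alpha> \<omega>"

abbreviation P :: "(real ^ 'n, 'i) vertex_colored_poset" where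
  "P \<equiv> minuscule_compression_poset \<Phi> \<alpha> \<omega>"

lemma R_simps:
  "carrier R = orb" "eq R = (=)"
  "gorder.le R = (\<lambda>x y. x \<in> orb \<and> y \<in> orb \<and> (\<exists>i. x + \<alpha> i = y))\<^sup>*\<^sup>*"
  "edge_color R x y = (THE i. x + \<alpha> i = y)"
  by (simp_all add: minuscule_splitting_lattice_def poset_of_edges_def orb_def
      gorder.defs edge_colored_poset.defs)

lemma ple_if_min:
  assumes "\<And>j. cf j x = min (cf j x) (cf j y)"
  shows "x \<preceq> y"
  unfolding ple_def by (rule allI, subst assms) (rule min.cobounded2)

text \<open>In a direction where both the coordinate and the pairing grow, the pairings -1, 0, 1
  force \<open>x\<close> to be a lower end or \<open>y\<close> to be an upper end of a
  string.\<close>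

lemma ple_step:
  assumes "x \<in> orb" "y \<in> orb" "x \<preceq> y" "x \<noteq> y"
  shows "\<exists>i. (x + \<alpha> i \<in> orb \<and> x + \<alpha> i \<preceq> y) \<or> (y - \<alpha> i \<in> orb \<and> x \<preceq> y - \<alpha> i)"
proof -
  have "\<exists>i. cf i (y - x) > 0"
  proof (rule ccontr)
    assume "\<not> ?thesis"
    then have "y \<preceq> x" by (simp add: ple_def cf_diff not_less)
    then show False using ple_antisym assms by blast
  qed
  then obtain i where i: "cf i (y - x) > 0" "(y - x) \<bullet> \<alpha> i > 0"
    using exists_pos_cf_pos_inner by blast
  then have "pr i (y - x) > 0" by (simp add: inner_coroot)
  then have less: "pr i x < pr i y" by (simp add: inner_diff_left)
  then consider "pr i x = - 1" | "pr i y = 1"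
    using pr_orb[OF assms(1), of i] pr_orb[OF assms(2), of i] by auto
  then show ?thesis
  proof cases
    case 1
    then show ?thesis using orb_up[OF assms(1) 1] ple_up[OF assms(1-3) less] by blast
  next
    case 2
    then show ?thesis using orb_down[OF assms(2) 2] ple_down[OF assms(1-3) less] by blast
  qed
qed

section \<open>The order and its coverings in the orbit\<close>

definition ht :: "real ^ 'n \<Rightarrow> real" where
  "ht x = (\<Sum>i\<in>UNIV. cf i x)"

lemma ht_add: "ht (x + y) = ht x + ht y"
  and ht_diff: "ht (x - y) = ht x - ht y"
  and ht_alpha [simp]: "ht (\<alpha> i) = 1"
  by (simp_all add: ht_def cf_add cf_diff sum.distrib sum_subtractf)

lemma ht_mono: "x \<preceq> y \<Longrightarrow> ht x \<le> ht y"
  by (simp add: ht_def ple_def sum_mono)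

text \<open>Induction on the height difference: \<open>ple_step\<close> shortens the interval at one
  of its ends, without control over which one.\<close>

lemma le_R:
  assumes "x \<in> orb" "y \<in> orb"
  shows "x \<sqsubseteq>\<^bsub>R\<^esub> y \<longleftrightarrow> x \<preceq> y"
proof
  assume "x \<sqsubseteq>\<^bsub>R\<^esub> y"
  then show "x \<preceq> y"
    unfolding R_simps
  proof (induction rule: rtranclp_induct)
    case (step y z)
    then show ?case using ple_trans[OF step.IH] by auto
  qed simp
next
  assume "x \<preceq> y"
  then show "x \<sqsubseteq>\<^bsub>R\<^esub> y"
    using assms
  proof (induction "nat \<lfloor>ht (y - x)\<rfloor>" arbitrary: x y rule: less_induct)
    case less
    show ?case
    proof (cases "x = y")
      case True
      then show ?thesis by (simp add: R_simps)
    next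
      case False
      then obtain i where i: "(x + \<alpha> i \<in> orb \<and> x + \<alpha> i \<preceq> y) \<or> (y - \<alpha> i \<in> orb \<and> x \<preceq> y - \<alpha> i)"
        using ple_step less.prems by blast
      then show ?thesis
      proof
        assume a: "x + \<alpha> i \<in> orb \<and> x + \<alpha> i \<preceq> y"
        then have "ht (x + \<alpha> i) \<le> ht y" using ht_mono by blast
        then have "nat \<lfloor>ht (y - (x + \<alpha> i))\<rfloor> < nat \<lfloor>ht (y - x)\<rfloor>"
          by (simp add: ht_add ht_diff) linarith
        then have "x + \<alpha> i \<sqsubseteq>\<^bsub>R\<^esub> y" using less.hyps a less.prems by blast
        then show ?thesis
          unfolding R_simps using a less.prems by (blast intro: converse_rtranclp_into_rtranclp)
      next
        assume a: "y - \<alpha> i \<in> orb \<and> x \<preceq> y - \<alpha> i"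
        then have "ht x \<le> ht (y - \<alpha> i)" using ht_mono by blast
        then have "nat \<lfloor>ht (y - \<alpha> i - x)\<rfloor> < nat \<lfloor>ht (y - x)\<rfloor>"
          by (simp add: ht_diff) linarith
        then have "x \<sqsubseteq>\<^bsub>R\<^esub> y - \<alpha> i" using less.hyps a less.prems by blast
        moreover have "y - \<alpha> i \<in> orb \<and> y \<in> orb \<and> (\<exists>j. y - \<alpha> i + \<alpha> j = y)"
          using a less.prems by (auto intro: exI[of _ i])
        ultimately show ?thesis
          unfolding R_simps by (rule rtranclp.rtrancl_into_rtrancl)
      qed
    qed
  qed
qed

text \<open>Unlike \<open>ple_step\<close>, this shortens at the upper end: a path of edges provided
  by \<open>le_R\<close> has a last edge.\<close>

lemma ple_last_step:
  assumes "x \<in> orb" "y \<in> orb" "x \<preceq> y" "x \<noteq> y"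
  obtains i where "y - \<alpha> i \<in> orb" "x \<preceq> y - \<alpha> i"
proof -
  have "x \<sqsubseteq>\<^bsub>R\<^esub> y" using le_R assms by blast
  then show thesis
    unfolding R_simps(3)
  proof (cases rule: rtranclp.cases)
    case (rtrancl_into_rtrancl z)
    then obtain i where z: "z \<in> orb" "z + \<alpha> i = y" by blast
    then have zy: "z = y - \<alpha> i" by auto
    have "x \<sqsubseteq>\<^bsub>R\<^esub> z" unfolding R_simps(3) by (rule rtrancl_into_rtrancl(1))
    then show thesis using that le_R assms(1) z(1) zy by blast
  qed (use assms in auto)
qed

text \<open>A covering is the last edge of a path. Conversely, the ends of an edge differ by 1 in a
  single coordinate, and integrality excludes anything in between.\<close>

lemma covered_by_R: "covered_by R x y \<longleftrightarrow> x \<in> orb \<and> y \<in> orb \<and> (\<exists>i. x + \<alpha> i = y)"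
proof
  assume c: "covered_by R x y"
  then have xy: "x \<in> orb" "y \<in> orb" "x \<preceq> y" "x \<noteq> y"
    by (auto simp: covered_by_def lless_def R_simps(1,2) le_R)
  then obtain i where i: "y - \<alpha> i \<in> orb" "x \<preceq> y - \<alpha> i" by (rule ple_last_step)
  have "y - \<alpha> i \<preceq> y" using ple_add_alpha[of "y - \<alpha> i" i] by simp
  moreover have "y - \<alpha> i \<noteq> y" using alpha_nonzero by simp
  ultimately have "x = y - \<alpha> i"
    using c xy i by (auto simp: covered_by_def lless_def R_simps(1,2) le_R)
  then show "x \<in> orb \<and> y \<in> orb \<and> (\<exists>i. x + \<alpha> i = y)" using xy by auto
next
  assume "x \<in> orb \<and> y \<in> orb \<and> (\<exists>i. x + \<alpha> i = y)"
  then obtain i where xy: "x \<in> orb" "y \<in> orb" "y = x + \<alpha> i" by blast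
  have "z = x \<or> z = y" if z: "z \<in> orb" "x \<preceq> z" "z \<preceq> y" for z
  proof -
    have "cf i (z - x) \<in> \<int>" "0 \<le> cf i (z - x)" "cf i (z - x) \<le> 1"
      using cf_diff_int z xy by (auto simp: ple_def cf_simps dest: spec[of _ i])
    then have "cf i (z - x) = 0 \<or> cf i (z - x) = 1"
      by (rule Ints_between_0_1)
    then have "cf i z = cf i x \<or> cf i z = cf i y"
      by (auto simp: cf_simps xy(3))
    moreover have "cf j z = cf j x" "cf j z = cf j y" if "j \<noteq> i" for j
      using z that by (auto simp: ple_def cf_add xy(3) intro: order_antisym dest!: spec[of _ j])
    ultimately show ?thesis by (metis cf_eqI)
  qed
  then show "covered_by R x y"
    using xy alpha_nonzero by (auto simp: covered_by_def lless_def R_simps(1,2) le_R)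
qed

text \<open>This is what makes the orbit a distributive lattice.\<close>

lemma orb_meet:
  assumes "x \<in> orb" "y \<in> orb"
  shows "\<exists>m\<in>orb. \<forall>j. cf j m = min (cf j x) (cf j y)"
  using assms
proof (induction "nat \<lfloor>\<Sum>j\<in>UNIV. max 0 (cf j (x - y))\<rfloor>" arbitrary: x y rule: less_induct)
  case less
  let ?N = "\<lambda>x y. \<Sum>j\<in>UNIV. max 0 (cf j (x - y))"
  show ?case
  proof (cases "\<exists>i. cf i (x - y) > 0")
    case False
    then have "cf j x \<le> cf j y" for j by (simp add: cf_diff not_less)
    then show ?thesis using less.prems by (intro bexI[of _ x]) (auto simp: min_def)
  next
    case True
    then obtain i where i: "cf i (x - y) > 0" "(x - y) \<bullet> \<alpha> i > 0"
      using exists_pos_cf_pos_inner by blast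
    then have "pr i (x - y) > 0" by (simp add: inner_coroot)
    then have "pr i y < pr i x" by (simp add: inner_diff_left)
    then consider "pr i x = 1" | "pr i y = - 1"
      using pr_orb[OF less.prems(1), of i] pr_orb[OF less.prems(2), of i] by auto
    moreover
    have c1: "cf i (x - y) \<ge> 1"
      using i(1) cf_diff_int[OF less.prems, of i] by (auto elim!: Ints_cases)
    \<comment> \<open>Lowering \<open>x\<close> or raising \<open>y\<close> by
      \<open>\<alpha> i\<close> takes exactly 1 from the positive part of \<open>x - y\<close>,
      since its \<open>i\<close>-th coordinate is at least 1.\<close>
    have N: "nat \<lfloor>?N x' y'\<rfloor> < nat \<lfloor>?N x y\<rfloor>" if "x' - y' = x - y - \<alpha> i" for x' y'
    proof -
      have "max 0 (cf j (x' - y')) = max 0 (cf j (x - y)) - (if j = i then 1 else 0)" for j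
        unfolding that cf_diff[of _ "x - y"] using c1 by simp
      then have "?N x' y' = ?N x y - 1" by (simp only: sum_subtractf) simp
      moreover have "?N x' y' \<ge> 0" by (simp add: sum_nonneg)
      ultimately show ?thesis by linarith
    qed
    ultimately show ?thesis
    proof cases
      case 1
      then have x': "x - \<alpha> i \<in> orb" using orb_down less.prems by blast
      then obtain m where "m \<in> orb" "\<And>j. cf j m = min (cf j (x - \<alpha> i)) (cf j y)"
        using less.hyps[OF N x' less.prems(2)] by (auto simp: algebra_simps)
      moreover have "min (cf j (x - \<alpha> i)) (cf j y) = min (cf j x) (cf j y)" for j
        using c1 by (auto simp: cf_diff)
      ultimately show ?thesis by auto
    next
      case 2
      then have y': "y + \<alpha> i \<in> orb" using orb_up less.prems by blast
      then obtain m where m: "m \<in> orb" "\<And>j. cf j m = min (cf j x) (cf j (y + \<alpha> i))"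
        using less.hyps[OF N less.prems(1) y'] by (auto simp: algebra_simps)
      \<comment> \<open>The minimum with the raised \<open>y\<close> is one too large in coordinate
        \<open>i\<close>. There \<open>m\<close> agrees with \<open>y + \<alpha> i\<close>, so its
        pairing is at least that of \<open>y + \<alpha> i\<close>, namely 1, and \<open>m\<close>
        can be lowered within the orbit.\<close>
      have "(y + \<alpha> i - m) \<bullet> \<alpha> i \<le> 0"
        by (rule inner_alpha_nonpos) (use c1 in \<open>auto simp: m(2) cf_simps\<close>)
      then have "pr i (y + \<alpha> i - m) \<le> 0" by (simp add: inner_coroot divide_le_0_iff)
      then have "pr i m \<ge> 1" using 2 by (simp add: inner_diff_left inner_add_left)
      then have "pr i m = 1" using pr_orb[OF m(1), of i] by auto
      then have "m - \<alpha> i \<in> orb" using orb_down m(1) by blast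
      moreover have "cf j (m - \<alpha> i) = min (cf j x) (cf j y)" for j
        using c1 by (auto simp: m(2) cf_simps)
      ultimately show ?thesis by blast
    qed
  qed
qed

section \<open>Birkhoff duality for the minuscule splitting lattice\<close>

lemma P_simps:
  "carrier P = {x \<in> orb. \<exists>!y. covered_by R y x}" "gorder.le P = gorder.le R"
  "vertex_color P x = edge_color R (THE y. covered_by R y x) x"
  by (simp_all add: minuscule_compression_poset_def join_irreducibles_def R_simps(1))

abbreviation col :: "real ^ 'n \<Rightarrow> 'i" where
  "col x \<equiv> vertex_color P x"

lemma covered_by_R_pr: "x \<in> orb \<Longrightarrow> covered_by R y x \<longleftrightarrow> (\<exists>i. pr i x = 1 \<and> y = x - \<alpha> i)"
proof -
  assume x: "x \<in> orb"
  show ?thesis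
    unfolding covered_by_R
  proof (safe, goal_cases)
    case (1 i)
    then have "pr i (y + \<alpha> i) = 1" using pr_up[of y i] by (simp add: inner_add_left)
    then show ?case by (intro exI[of _ i]) simp
  next
    case (2 i)
    then show ?case using orb_down[OF x] by simp
  next
    case (3 i)
    then show ?case using x by simp
  next
    case (4 i)
    show ?case by (rule exI[of _ i]) simp
  qed
qed

lemma P_iff: "x \<in> carrier P \<longleftrightarrow> x \<in> orb \<and> (\<exists>!i. pr i x = 1)"
proof -
  have "(\<exists>!y. covered_by R y x) \<longleftrightarrow> (\<exists>!i. pr i x = 1)" if "x \<in> orb"
    unfolding covered_by_R_pr[OF that]
  proof
    assume "\<exists>!y. \<exists>i. pr i x = 1 \<and> y = x - \<alpha> i"
    then obtain y where y: "\<exists>i. pr i x = 1 \<and> y = x - \<alpha> i"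
      "\<forall>z. (\<exists>i. pr i x = 1 \<and> z = x - \<alpha> i) \<longrightarrow> z = y" by (elim ex1E)
    then obtain i where i: "pr i x = 1" "y = x - \<alpha> i" by blast
    show "\<exists>!i. pr i x = 1"
    proof (rule ex1I[of _ i], rule i(1))
      fix j assume "pr j x = 1"
      then have "x - \<alpha> j = y" using y(2)[rule_format, of "x - \<alpha> j"] by blast
      then show "j = i" by (simp add: i(2))
    qed
  next
    assume "\<exists>!i. pr i x = 1"
    then obtain i where i: "pr i x = 1" "\<forall>j. pr j x = 1 \<longrightarrow> j = i" by (elim ex1E)
    show "\<exists>!y. \<exists>i. pr i x = 1 \<and> y = x - \<alpha> i"
    proof (rule ex1I[of _ "x - \<alpha> i"])
      show "\<exists>j. pr j x = 1 \<and> x - \<alpha> i = x - \<alpha> j" using i(1) by blast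
      fix y assume "\<exists>j. pr j x = 1 \<and> y = x - \<alpha> j"
      then obtain j where "pr j x = 1" "y = x - \<alpha> j" by blast
      then show "y = x - \<alpha> i" using i(2) by simp
    qed
  qed
  then show ?thesis unfolding P_simps by blast
qed

lemma P_orb: "p \<in> carrier P \<Longrightarrow> p \<in> orb"
  by (simp add: P_iff)

lemma P_col:
  assumes "p \<in> carrier P"
  shows "pr i p = 1 \<longleftrightarrow> i = col p"
proof -
  obtain j where j: "pr j p = 1" "\<And>k. pr k p = 1 \<Longrightarrow> k = j" using assms P_iff by blast
  have "covered_by R y p \<longleftrightarrow> y = p - \<alpha> j" for y
    using j covered_by_R_pr[OF P_orb[OF assms]] by blast
  then have "col p = (THE i. p - \<alpha> j + \<alpha> i = p)" by (simp add: P_simps(3) R_simps(4))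
  also have "\<dots> = j" by (rule the_equality) (auto simp: algebra_simps)
  finally have cp: "col p = j" .
  show ?thesis unfolding cp by (rule iffI, erule j(2), simp only: j(1))
qed

lemma P_down: "p \<in> carrier P \<Longrightarrow> p - \<alpha> (col p) \<in> orb"
  using orb_down[OF P_orb] P_col by blast

lemma le_P: "p \<in> carrier P \<Longrightarrow> q \<in> carrier P \<Longrightarrow> p \<sqsubseteq>\<^bsub>P\<^esub> q \<longleftrightarrow> p \<preceq> q"
  by (simp add: P_simps(2) le_R P_orb)

lemma finite_poset_P: "finite_poset P"
proof
  show "finite (carrier P)" by (rule finite_subset[OF _ finite_orb]) (auto simp: P_orb)
  fix x y z assume x: "x \<in> carrier P"
  show "x \<sqsubseteq>\<^bsub>P\<^esub> x" using le_P[OF x x] by simp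
  assume y: "y \<in> carrier P"
  show "x \<sqsubseteq>\<^bsub>P\<^esub> y \<Longrightarrow> y \<sqsubseteq>\<^bsub>P\<^esub> x \<Longrightarrow> x = y"
    using le_P[OF x y] le_P[OF y x] ple_antisym by simp
  assume z: "z \<in> carrier P"
  show "x \<sqsubseteq>\<^bsub>P\<^esub> y \<Longrightarrow> y \<sqsubseteq>\<^bsub>P\<^esub> z \<Longrightarrow> x \<sqsubseteq>\<^bsub>P\<^esub> z"
    using le_P[OF x y] le_P[OF y z] le_P[OF x z] ple_trans[of x y z] by simp
qed

sublocale P: finite_poset P
  by (rule finite_poset_P)

text \<open>If the coordinatewise minimum of \<open>p\<close> and \<open>x\<close> were strictly
  below \<open>p\<close>, it would lie below the unique lower neighbour of \<open>p\<close> and so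
  be smaller in coordinate \<open>col p\<close>.\<close>

lemma P_ple_iff:
  assumes p: "p \<in> carrier P" and x: "x \<in> orb"
  shows "p \<preceq> x \<longleftrightarrow> cf (col p) p \<le> cf (col p) x"
proof
  assume le: "cf (col p) p \<le> cf (col p) x"
  obtain m where m: "m \<in> orb" "\<And>j. cf j m = min (cf j p) (cf j x)"
    using orb_meet[OF P_orb[OF p] x] by blast
  have "m = p"
  proof (rule ccontr)
    assume ne: "m \<noteq> p"
    have "m \<preceq> p" by (simp add: ple_def m(2))
    then obtain i where i: "p - \<alpha> i \<in> orb" "m \<preceq> p - \<alpha> i"
      by (rule ple_last_step[OF m(1) P_orb[OF p] _ ne])
    then have "i = col p" using pr_down[OF P_orb[OF p]] P_col[OF p] by blast
    then have "cf (col p) m < cf (col p) p"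
      using i(2) by (auto simp: ple_def cf_diff dest: spec[of _ i])
    then show False using le m(2) by simp
  qed
  then show "p \<preceq> x" using m(2) by (intro ple_if_min) blast
qed (simp add: ple_def)

definition Idl :: "real ^ 'n \<Rightarrow> (real ^ 'n) set" where
  "Idl x = {p \<in> carrier P. p \<preceq> x}"

lemma Idl_ideal: "Idl x \<in> order_ideals P"
proof -
  have "q \<preceq> x" if "p \<in> carrier P" "p \<preceq> x" "q \<in> carrier P" "q \<sqsubseteq>\<^bsub>P\<^esub> p" for p q
    using that le_P[of q p] ple_trans[of q p x] by simp
  then show ?thesis unfolding order_ideals_def Idl_def by blast
qed

lemma finite_Idl: "finite (Idl x)"
  using P.finite_ideal Idl_ideal .

lemma Idl_mono: "x \<preceq> y \<Longrightarrow> Idl x \<subseteq> Idl y"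
  unfolding Idl_def by (blast intro: ple_trans)

text \<open>\<open>x\<close> and \<open>x + \<alpha> i\<close> differ only in coordinate
  \<open>i\<close>, so by \<open>P_ple_iff\<close> only the color \<open>i\<close> can distinguish
  them; integrality then fixes the coordinate of \<open>q\<close>.\<close>

lemma Idl_up_unique:
  assumes x: "x \<in> orb" "x + \<alpha> i \<in> orb" and q: "q \<in> Idl (x + \<alpha> i)" "q \<notin> Idl x"
  shows "col q = i" "cf i q = cf i x + 1"
proof -
  have qP: "q \<in> carrier P" using q by (simp add: Idl_def)
  have q1: "cf (col q) q \<le> cf (col q) (x + \<alpha> i)"
    using q qP P_ple_iff[OF qP x(2)] by (simp add: Idl_def)
  have q2: "\<not> cf (col q) q \<le> cf (col q) x"
    using q qP P_ple_iff[OF qP x(1)] by (simp add: Idl_def)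
  show col: "col q = i" using q1 q2 by (auto simp: cf_add split: if_splits)
  have "cf i (q - x) \<in> \<int>" by (rule cf_diff_int[OF P_orb[OF qP] x(1)])
  then have "cf i (q - x) = 0 \<or> cf i (q - x) = 1"
    by (rule Ints_between_0_1) (use q1 q2 col in \<open>simp_all add: cf_add cf_diff\<close>)
  then show "cf i q = cf i x + 1"
    using q2 unfolding col by (auto simp: cf_diff)
qed

text \<open>The new join irreducible is an element \<open>q\<close> of least height among those
  below \<open>x + \<alpha> i\<close> that have the full \<open>i\<close>-th coordinate. A descent
  from \<open>q\<close> in another direction would contradict minimality.\<close>

lemma Idl_up:
  assumes x: "x \<in> orb" "pr i x = - 1"
  shows "\<exists>p\<in>carrier P. col p = i \<and> p \<notin> Idl x \<and> Idl (x + \<alpha> i) = insert p (Idl x)"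
proof -
  have x': "x + \<alpha> i \<in> orb" using orb_up x by blast
  define D where "D = {q \<in> orb. q \<preceq> x + \<alpha> i \<and> cf i q = cf i x + 1}"
  have D: "finite D" "x + \<alpha> i \<in> D" using finite_orb x' by (auto simp: D_def cf_add)
  then have "Min (ht ` D) \<in> ht ` D" by (intro Min_in) auto
  then obtain q where q: "q \<in> D" "ht q = Min (ht ` D)" by auto
  have qo: "q \<in> orb" "q \<preceq> x + \<alpha> i" "cf i q = cf i x + 1" using q(1) by (auto simp: D_def)
  have min: "j = i" if "pr j q = 1" for j
  proof (rule ccontr)
    assume "j \<noteq> i"
    have "q - \<alpha> j \<preceq> q" using ple_add_alpha[of "q - \<alpha> j" j] by simp
    then have "q - \<alpha> j \<in> D"
      using orb_down[OF qo(1) that] qo(3) \<open>j \<noteq> i\<close> ple_trans[OF _ qo(2), of "q - \<alpha> j"]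
      by (simp add: D_def cf_diff)
    then have "ht q \<le> ht (q - \<alpha> j)" unfolding q(2) using D(1) by simp
    then show False by (simp add: ht_diff)
  qed
  \<comment> \<open>\<open>q\<close> exceeds \<open>x\<close> in coordinate \<open>i\<close>, so it
    lies strictly above their minimum and has some edge below it.\<close>
  have "\<exists>j. pr j q = 1"
  proof -
    obtain m where m: "m \<in> orb" "\<And>j. cf j m = min (cf j q) (cf j x)"
      using orb_meet[OF qo(1) x(1)] by blast
    have ne: "m \<noteq> q" using m(2)[of i] qo(3) by auto
    have "m \<preceq> q" by (simp add: ple_def m(2))
    then obtain j where "q - \<alpha> j \<in> orb" "m \<preceq> q - \<alpha> j"
      by (rule ple_last_step[OF m(1) qo(1) _ ne])
    then show ?thesis using pr_down[OF qo(1)] by blast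
  qed
  then have "pr i q = 1" using min by blast
  then have "\<exists>!i. pr i q = 1" using min by (rule ex1I)
  then have qP: "q \<in> carrier P" using qo(1) P_iff by blast
  have col: "col q = i" using P_col[OF qP, of i] \<open>pr i q = 1\<close> by simp
  have qI: "q \<in> Idl (x + \<alpha> i)" "q \<notin> Idl x"
  proof -
    have "\<not> q \<preceq> x" using qo(3) by (auto simp: ple_def intro!: exI[of _ i])
    then show "q \<in> Idl (x + \<alpha> i)" "q \<notin> Idl x" using qP qo(2) by (auto simp: Idl_def)
  qed
  \<comment> \<open>Join irreducibles with the same color and the same coordinate for it lie below
    each other.\<close>
  have "q' = q" if q': "q' \<in> Idl (x + \<alpha> i)" "q' \<notin> Idl x" for q'
  proof -
    have q'P: "q' \<in> carrier P" using q' by (simp add: Idl_def)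
    note u = Idl_up_unique[OF x(1) x' q']
    have "q' \<preceq> q" "q \<preceq> q'"
      using P_ple_iff[OF q'P qo(1)] P_ple_iff[OF qP P_orb[OF q'P]] u col qo(3) by auto
    then show ?thesis using ple_antisym by blast
  qed
  moreover have "Idl x \<subseteq> Idl (x + \<alpha> i)" by (rule Idl_mono[OF ple_add_alpha])
  ultimately have "Idl (x + \<alpha> i) = insert q (Idl x)" using qI(1) by blast
  then show ?thesis using qP col qI(2) by blast
qed

text \<open>If the minimum \<open>m\<close> of \<open>x\<close> and \<open>y\<close> were not
  \<open>x\<close>, some lower neighbour of \<open>x\<close> would lie above \<open>m\<close>. The
  join irreducible gained between this neighbour and \<open>x\<close> lies below \<open>x\<close>
  and \<open>y\<close>, hence below \<open>m\<close> and the neighbour, a contradiction.\<close>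

lemma Idl_subset_iff:
  assumes x: "x \<in> orb" and y: "y \<in> orb"
  shows "Idl x \<subseteq> Idl y \<longleftrightarrow> x \<preceq> y"
proof
  assume sub: "Idl x \<subseteq> Idl y"
  obtain m where m: "m \<in> orb" "\<And>j. cf j m = min (cf j x) (cf j y)"
    using orb_meet[OF x y] by blast
  have "m = x"
  proof (rule ccontr)
    assume ne: "m \<noteq> x"
    have "m \<preceq> x" by (simp add: ple_def m(2))
    then obtain i where i: "x - \<alpha> i \<in> orb" "m \<preceq> x - \<alpha> i"
      by (rule ple_last_step[OF m(1) x _ ne])
    have "pr i (x - \<alpha> i) = - 1" using pr_up[OF i(1), of i] x by simp
    then obtain p where p: "p \<in> carrier P" "p \<notin> Idl (x - \<alpha> i)" "p \<in> Idl x"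
      using Idl_up[OF i(1), of i] by auto
    then have "p \<preceq> m" using sub by (auto simp: Idl_def ple_def m(2))
    then have "p \<preceq> x - \<alpha> i" using i(2) by (rule ple_trans)
    then show False using p by (simp add: Idl_def)
  qed
  then show "x \<preceq> y" using m(2) by (intro ple_if_min) blast
qed (rule Idl_mono)

section \<open>The least weight and the inverse of the ideal map\<close>

definition bot_weight :: "real ^ 'n" where
  "bot_weight = (SOME b. b \<in> orb \<and> (\<forall>x\<in>orb. b \<preceq> x))"

text \<open>An element of least height equals its minimum with any other element.\<close>

lemma bot_weight: "bot_weight \<in> orb" "x \<in> orb \<Longrightarrow> bot_weight \<preceq> x"
proof -
  have "Min (ht ` orb) \<in> ht ` orb" using finite_orb omega_orb by (intro Min_in) auto
  then obtain b where b: "b \<in> orb" "ht b = Min (ht ` orb)" by auto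
  have "b \<preceq> x" if xo: "x \<in> orb" for x
  proof -
    obtain m where m: "m \<in> orb" "\<And>j. cf j m = min (cf j b) (cf j x)"
      using orb_meet[OF b(1) xo] by blast
    have "m = b"
    proof (rule ccontr)
      assume ne: "m \<noteq> b"
      have "m \<preceq> b" by (simp add: ple_def m(2))
      then obtain i where "b - \<alpha> i \<in> orb" "m \<preceq> b - \<alpha> i"
        by (rule ple_last_step[OF m(1) b(1) _ ne])
      then have "ht b \<le> ht (b - \<alpha> i)" unfolding b(2) using finite_orb by simp
      then show False by (simp add: ht_diff)
    qed
    then show ?thesis using m(2) by (intro ple_if_min) blast
  qed
  then have "bot_weight \<in> orb \<and> (\<forall>x\<in>orb. bot_weight \<preceq> x)"
    unfolding bot_weight_def using b(1)
    by - (rule someI[of "\<lambda>b. b \<in> orb \<and> (\<forall>x\<in>orb. b \<preceq> x)" b], blast)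
  then show "bot_weight \<in> orb" "x \<in> orb \<Longrightarrow> bot_weight \<preceq> x" by auto
qed

lemma Idl_bot: "Idl bot_weight = {}"
proof -
  have False if p: "p \<in> carrier P" "p \<preceq> bot_weight" for p
  proof -
    have "bot_weight \<preceq> p - \<alpha> (col p)" using bot_weight(2) P_down[OF p(1)] .
    then have "ht p \<le> ht (p - \<alpha> (col p))" by (rule ht_mono[OF ple_trans[OF p(2)]])
    then show False by (simp add: ht_diff)
  qed
  then show ?thesis by (auto simp: Idl_def)
qed

text \<open>The inverse of \<open>Idl\<close>, by \<open>wt_Idl\<close> and
  \<open>wt_ideal\<close>.\<close>

definition wt :: "(real ^ 'n) set \<Rightarrow> real ^ 'n" where
  "wt X = bot_weight + (\<Sum>p\<in>X. \<alpha> (col p))"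

lemma wt_insert: "finite X \<Longrightarrow> p \<notin> X \<Longrightarrow> wt (insert p X) = wt X + \<alpha> (col p)"
  by (simp add: wt_def add_ac)

lemma wt_Idl:
  assumes "x \<in> orb"
  shows "wt (Idl x) = x"
proof -
  have "bot_weight \<sqsubseteq>\<^bsub>R\<^esub> x" using le_R bot_weight assms by blast
  then show ?thesis
    unfolding R_simps(3)
  proof (induction rule: rtranclp_induct)
    case base
    show ?case by (simp add: Idl_bot wt_def)
  next
    case (step y z)
    then obtain i where i: "y \<in> orb" "z = y + \<alpha> i" "z \<in> orb" by blast
    then have "pr i y = - 1" using pr_up by blast
    then obtain p where "col p = i" "p \<notin> Idl y" "Idl z = insert p (Idl y)"
      using Idl_up[OF i(1)] i(2) by blast
    then show ?case using step.IH i(2) by (simp add: wt_insert finite_Idl)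
  qed
qed

text \<open>When \<open>p\<close> of color \<open>i\<close> joins \<open>X\<close>, the weight
  \<open>x\<close> of \<open>X\<close> is above \<open>p - \<alpha> i\<close> but not above
  \<open>p\<close>. This places its \<open>i\<close>-th coordinate exactly one below that of
  \<open>p\<close> and forces pairing -1, so \<open>x + \<alpha> i\<close> is in the orbit and gains
  precisely \<open>p\<close>.\<close>

lemma wt_ideal:
  assumes "X \<in> order_ideals P"
  shows "wt X \<in> orb \<and> Idl (wt X) = X"
  using assms
proof (induction rule: P.ideal_induct)
  case empty
  have "wt {} = bot_weight" by (simp add: wt_def)
  then show ?case using bot_weight(1) Idl_bot by simp
next
  case (insert p X)
  define x where "x = wt X"
  have x: "x \<in> orb" "Idl x = X" using insert.IH by (simp_all add: x_def)
  define i where "i = col p"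
  have pP: "p \<in> carrier P" using P.ideal_subset[OF insert.hyps(3)] by blast
  have pd: "p - \<alpha> i \<in> orb" using P_down[OF pP] by (simp add: i_def)
  \<comment> \<open>Whatever lies strictly below \<open>p\<close> already belongs to
    \<open>X\<close>, because \<open>insert p X\<close> is an ideal.\<close>
  have "Idl (p - \<alpha> i) \<subseteq> Idl x"
  proof
    fix q assume "q \<in> Idl (p - \<alpha> i)"
    then have q: "q \<in> carrier P" "q \<preceq> p - \<alpha> i" by (auto simp: Idl_def)
    then have "cf i q < cf i p" by (auto simp: ple_def cf_diff dest: spec[of _ i])
    then have "q \<noteq> p" by auto
    moreover have "q \<preceq> p" using ple_trans[OF q(2) ple_add_alpha[of _ i]] by simp
    then have "q \<in> insert p X"
      using P.ideal_closed[OF insert.hyps(3), of p q] q(1) pP le_P by blast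
    ultimately show "q \<in> Idl x" using x(2) by blast
  qed
  then have le: "p - \<alpha> i \<preceq> x" using Idl_subset_iff pd x(1) by blast
  have "\<not> p \<preceq> x" using insert.hyps(2) x(2) pP by (auto simp: Idl_def)
  then have "cf i p > cf i x" using P_ple_iff[OF pP x(1)] by (simp add: i_def)
  moreover have "cf i (p - \<alpha> i) \<le> cf i x" using le by (simp add: ple_def)
  moreover have "cf i (p - x) = 0 \<or> cf i (p - x) = 1"
    by (rule Ints_between_0_1[OF cf_diff_int[OF P_orb[OF pP] x(1)]])
       (use calculation in \<open>simp_all add: cf_diff\<close>)
  ultimately have c: "cf i x = cf i p - 1" by (auto simp: cf_diff)
  \<comment> \<open>Equal \<open>i\<close>-th coordinates bound the pairing of \<open>x\<close> by
    that of \<open>p - \<alpha> i\<close>, which is -1.\<close>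
  have "(x - (p - \<alpha> i)) \<bullet> \<alpha> i \<le> 0"
    by (rule inner_alpha_nonpos) (use le c in \<open>auto simp: ple_def cf_diff\<close>)
  then have "pr i (x - (p - \<alpha> i)) \<le> 0" by (simp add: inner_coroot divide_le_0_iff)
  moreover have "pr i p = 1" using P_col[OF pP] i_def by blast
  ultimately have "pr i x \<le> - 1" by (simp add: inner_diff_left)
  then have pr: "pr i x = - 1" using pr_orb[OF x(1), of i] by auto
  obtain p' where p': "p' \<notin> Idl x" "Idl (x + \<alpha> i) = insert p' (Idl x)"
    using Idl_up[OF x(1) pr] by blast
  have "p \<preceq> x + \<alpha> i" using le ple_add_mono[of "p - \<alpha> i" "\<alpha> i" x] by simp
  then have "p \<in> Idl (x + \<alpha> i)" using pP by (simp add: Idl_def)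
  then have "p' = p" using p' \<open>\<not> p \<preceq> x\<close> by (auto simp: Idl_def)
  moreover have "wt (insert p X) = x + \<alpha> i"
    using wt_insert P.finite_ideal insert.hyps by (simp add: x_def i_def)
  ultimately show ?case using p'(2) x orb_up[OF x(1) pr] by simp
qed

lemma wt_subset_iff:
  "X \<in> order_ideals P \<Longrightarrow> Y \<in> order_ideals P \<Longrightarrow> X \<subseteq> Y \<longleftrightarrow> wt X \<preceq> wt Y"
  using wt_ideal[of X] wt_ideal[of Y] Idl_subset_iff[of "wt X" "wt Y"] by simp

end

section \<open>Order ideals of the product with a chain\<close>

context minuscule_orbit
begin

abbreviation Q :: "nat \<Rightarrow> ((real ^ 'n) \<times> nat, 'i) vertex_colored_poset" where
  "Q M \<equiv> colored_prod_chain P M"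

lemma finite_poset_Q: "finite_poset (Q M)"
proof
  show "finite (carrier (Q M))" using P.finite_carrier by simp
  fix x y z assume x: "x \<in> carrier (Q M)"
  show "x \<sqsubseteq>\<^bsub>Q M\<^esub> x" using x P.le_refl by (cases x) simp
  assume y: "y \<in> carrier (Q M)"
  show "x \<sqsubseteq>\<^bsub>Q M\<^esub> y \<Longrightarrow> y \<sqsubseteq>\<^bsub>Q M\<^esub> x \<Longrightarrow> x = y"
    using x y P.le_antisym by (cases x; cases y) simp
  assume z: "z \<in> carrier (Q M)"
  show "x \<sqsubseteq>\<^bsub>Q M\<^esub> y \<Longrightarrow> y \<sqsubseteq>\<^bsub>Q M\<^esub> z \<Longrightarrow> x \<sqsubseteq>\<^bsub>Q M\<^esub> z"
    using x y z P.le_trans[of "fst x" "fst y" "fst z"] by (cases x; cases y; cases z) simp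
qed

definition slice :: "((real ^ 'n) \<times> nat) set \<Rightarrow> nat \<Rightarrow> (real ^ 'n) set" where
  "slice X k = {p. (p, k) \<in> X}"

lemma mem_slice [simp]: "p \<in> slice X k \<longleftrightarrow> (p, k) \<in> X"
  by (simp add: slice_def)

lemma Q_ideal_iff:
  "X \<in> order_ideals (Q M) \<longleftrightarrow>
    (\<forall>(p, k)\<in>X. p \<in> carrier P \<and> k < M \<and>
      (\<forall>q\<in>carrier P. \<forall>l\<le>k. q \<preceq> p \<longrightarrow> (q, l) \<in> X))"
proof -
  have "X \<in> order_ideals (Q M) \<longleftrightarrow>
    (\<forall>(p, k)\<in>X. p \<in> carrier P \<and> k < M \<and>
      (\<forall>q\<in>carrier P. \<forall>l<M. q \<sqsubseteq>\<^bsub>P\<^esub> p \<and> l \<le> k \<longrightarrow> (q, l) \<in> X))"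
    unfolding order_ideals_def by fastforce
  also have "\<dots> \<longleftrightarrow> (\<forall>(p, k)\<in>X. p \<in> carrier P \<and> k < M \<and>
      (\<forall>q\<in>carrier P. \<forall>l\<le>k. q \<preceq> p \<longrightarrow> (q, l) \<in> X))"
    using le_P by (auto simp: le_less_trans)
  finally show ?thesis .
qed

lemma Q_idealD:
  assumes "X \<in> order_ideals (Q M)" "(p, k) \<in> X"
  shows "p \<in> carrier P" "k < M" "q \<in> carrier P \<Longrightarrow> l \<le> k \<Longrightarrow> q \<preceq> p \<Longrightarrow> (q, l) \<in> X"
  using assms unfolding Q_ideal_iff by blast+

lemma Q_idealI:
  assumes "\<And>p k. (p, k) \<in> X \<Longrightarrow> p \<in> carrier P" "\<And>p k. (p, k) \<in> X \<Longrightarrow> k < M"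
    and "\<And>p k q l. (p, k) \<in> X \<Longrightarrow> q \<in> carrier P \<Longrightarrow> l \<le> k \<Longrightarrow> q \<preceq> p \<Longrightarrow> (q, l) \<in> X"
  shows "X \<in> order_ideals (Q M)"
  using assms unfolding Q_ideal_iff by blast

lemma slice_ideal:
  assumes X: "X \<in> order_ideals (Q M)"
  shows "slice X k \<in> order_ideals P"
  unfolding order_ideals_def
proof (intro CollectI conjI subsetI ballI impI)
  fix p assume p: "p \<in> slice X k"
  then show "p \<in> carrier P" using Q_idealD(1)[OF X] by simp
  fix q assume "q \<in> carrier P" "q \<sqsubseteq>\<^bsub>P\<^esub> p"
  then show "q \<in> slice X k"
    using Q_idealD(3)[OF X _ _ order_refl, of p k q] p \<open>p \<in> carrier P\<close> le_P by simp
qed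

lemma slice_antimono:
  assumes X: "X \<in> order_ideals (Q M)" and "k \<le> l"
  shows "slice X l \<subseteq> slice X k"
  using Q_idealD(1)[OF X] Q_idealD(3)[OF X _ _ \<open>k \<le> l\<close> ple_refl] by auto

text \<open>The multichain encoded by an ideal, listed from the greatest to the least element
  because slices shrink as \<open>k\<close> grows.\<close>

definition wts :: "((real ^ 'n) \<times> nat) set \<Rightarrow> nat \<Rightarrow> real ^ 'n" where
  "wts X k = wt (slice X k)"

lemma wts_orb: "X \<in> order_ideals (Q M) \<Longrightarrow> wts X k \<in> orb"
  and Idl_wts: "X \<in> order_ideals (Q M) \<Longrightarrow> Idl (wts X k) = slice X k"
  using wt_ideal[OF slice_ideal] by (auto simp: wts_def)

lemma mem_iff_ple_wts:
  assumes "X \<in> order_ideals (Q M)" "p \<in> carrier P"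
  shows "(p, k) \<in> X \<longleftrightarrow> p \<preceq> wts X k"
proof -
  have "p \<in> Idl (wts X k) \<longleftrightarrow> p \<in> slice X k" by (simp only: Idl_wts[OF assms(1)])
  then show ?thesis using assms(2) by (simp add: Idl_def)
qed

lemma wts_antimono:
  assumes "X \<in> order_ideals (Q M)" "k \<le> l"
  shows "wts X l \<preceq> wts X k"
  using slice_antimono[OF assms] wt_subset_iff[OF slice_ideal slice_ideal] assms(1)
  by (simp add: wts_def)

definition total_wt :: "nat \<Rightarrow> ((real ^ 'n) \<times> nat) set \<Rightarrow> real ^ 'n" where
  "total_wt M X = (\<Sum>k<M. wts X k)"

lemma wts_insert:
  assumes X: "X \<in> order_ideals (Q M)" and p: "(p, k) \<notin> X"
  shows "wts (insert (p, k) X) l = (if l = k then wts X k + \<alpha> (col p) else wts X l)"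
proof (cases "l = k")
  case True
  have "slice (insert (p, k) X) k = insert p (slice X k)" by (auto simp: slice_def)
  then show ?thesis
    using True wt_insert[OF P.finite_ideal[OF slice_ideal[OF X]], of p k] p by (simp add: wts_def)
next
  case False
  then have "slice (insert (p, k) X) l = slice X l" by (auto simp: slice_def)
  then show ?thesis using False by (simp add: wts_def)
qed

section \<open>Edges and color masses of the lattice of ideals\<close>

abbreviation L :: "nat \<Rightarrow> (((real ^ 'n) \<times> nat) set, 'i) edge_colored_poset" where
  "L M \<equiv> minuscule_multiple_lattice \<Phi> \<alpha> \<omega> M"

lemma colored_edge_L:
  "colored_edge (L M) i X Y \<longleftrightarrow> X \<in> order_ideals (Q M) \<and> Y \<in> order_ideals (Q M) \<and>
    (\<exists>p k. (p, k) \<notin> X \<and> Y = insert (p, k) X \<and> col p = i)"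
  unfolding minuscule_multiple_lattice_def colored_edge_ideal_lattice[OF finite_poset_Q]
  by auto

text \<open>The cardinalities for \<open>c = 1\<close> and \<open>c = - 1\<close> count the steps
  down and up that color \<open>i\<close> permits; they are the two functions passed to
  \<open>color_mass_eq\<close>.\<close>

definition level_set :: "nat \<Rightarrow> 'i \<Rightarrow> real \<Rightarrow> ((real ^ 'n) \<times> nat) set \<Rightarrow> nat set" where
  "level_set M i c X = {k. k < M \<and> pr i (wts X k) = c}"

lemma finite_level_set [simp]: "finite (level_set M i c X)"
  by (simp add: level_set_def)

lemma edge_level_set:
  assumes "colored_edge (L M) i X Y"
  shows "card (level_set M i 1 Y) = Suc (card (level_set M i 1 X)) \<and>
    card (level_set M i (- 1) X) = Suc (card (level_set M i (- 1) Y))"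
proof -
  obtain p k where X: "X \<in> order_ideals (Q M)" and Y: "Y \<in> order_ideals (Q M)"
    and p: "(p, k) \<notin> X" "Y = insert (p, k) X" "col p = i"
    using assms unfolding colored_edge_L by blast
  have k: "k < M" by (rule Q_idealD(2)[OF Y, of p]) (simp add: p(2))
  have w: "wts Y l = (if l = k then wts X k + \<alpha> i else wts X l)" for l
    using wts_insert[OF X p(1)] p(2,3) by simp
  have "wts X k + \<alpha> i \<in> orb" using wts_orb[OF Y, of k] w by simp
  then have pr: "pr i (wts X k) = - 1" by (rule pr_up[OF wts_orb[OF X]])
  then have pr': "pr i (wts Y k) = 1" by (simp add: w inner_add_left)
  have "level_set M i 1 Y = insert k (level_set M i 1 X)" "k \<notin> level_set M i 1 X"
    "level_set M i (- 1) X = insert k (level_set M i (- 1) Y)" "k \<notin> level_set M i (- 1) Y"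
    using k pr pr' by (auto simp: level_set_def w)
  then show ?thesis by simp
qed

text \<open>The last level \<open>k\<close> with pairing 1 can be lowered: at later levels the
  pairing is smaller, so \<open>ple_down\<close> places their weights below
  \<open>wts X k - \<alpha> i\<close>, and no later element of \<open>X\<close> lies above the
  removed one.\<close>

lemma edge_down:
  assumes X: "X \<in> order_ideals (Q M)" and ne: "level_set M i 1 X \<noteq> {}"
  shows "\<exists>Y. colored_edge (L M) i Y X"
proof -
  define k where "k = Max (level_set M i 1 X)"
  have "k \<in> level_set M i 1 X" unfolding k_def using ne by (intro Max_in) auto
  then have k: "k < M" "pr i (wts X k) = 1" by (auto simp: level_set_def)
  define y where "y = wts X k - \<alpha> i"
  have y: "y \<in> orb" "pr i y = - 1" "wts X k = y + \<alpha> i"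
    using orb_down[OF wts_orb[OF X] k(2)] k(2) by (simp_all add: y_def inner_diff_left)
  obtain p where p: "p \<in> carrier P" "col p = i" "p \<notin> Idl y" "Idl (wts X k) = insert p (Idl y)"
    using Idl_up[OF y(1,2)] y(3) by auto
  have "p \<in> Idl (wts X k)" unfolding p(4) by simp
  then have pX: "(p, k) \<in> X" using mem_iff_ple_wts[OF X p(1)] by (simp add: Idl_def)
  have only: "(q, l) = (p, k)" if ql: "(q, l) \<in> X" "p \<preceq> q" "k \<le> l" for q l
  proof (rule ccontr)
    assume ne: "(q, l) \<noteq> (p, k)"
    have q: "q \<in> carrier P" "l < M" by (rule Q_idealD[OF X ql(1)])+
    have "q \<preceq> y"
    proof (cases "l = k")
      case True
      then have "q \<in> Idl (wts X k)" "q \<noteq> p"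
        using ql(1) mem_iff_ple_wts[OF X q(1)] q(1) ne by (auto simp: Idl_def)
      then have "q \<in> Idl y" unfolding p(4) by simp
      then show ?thesis by (simp add: Idl_def)
    next
      case False
      have "l \<le> k" if "l \<in> level_set M i 1 X"
        unfolding k_def by (rule Max_ge[OF finite_level_set that])
      then have "l \<notin> level_set M i 1 X" using False ql(3) by auto
      then have "pr i (wts X l) < pr i (wts X k)"
        using q(2) k(2) pr_orb[OF wts_orb[OF X], of l i] by (auto simp: level_set_def)
      then have "wts X l \<preceq> y"
        unfolding y_def by (rule ple_down[OF wts_orb[OF X] wts_orb[OF X] wts_antimono[OF X ql(3)]])
      moreover have "q \<preceq> wts X l" using mem_iff_ple_wts[OF X q(1)] ql(1) by simp
      ultimately show ?thesis using ple_trans[of q "wts X l" y] by simp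
    qed
    then have "p \<preceq> y" by (rule ple_trans[OF ql(2)])
    then show False using p by (simp add: Idl_def)
  qed
  have "X - {(p, k)} \<in> order_ideals (Q M)"
  proof (rule Q_idealI)
    fix q l assume "(q, l) \<in> X - {(p, k)}"
    then have ql: "(q, l) \<in> X" "(q, l) \<noteq> (p, k)" by auto
    show "q \<in> carrier P" "l < M" by (rule Q_idealD[OF X ql(1)])+
    fix q' l' assume q': "q' \<in> carrier P" "l' \<le> l" "q' \<preceq> q"
    have "(q', l') \<in> X" by (rule Q_idealD(3)[OF X ql(1) q'])
    moreover have "(q', l') \<noteq> (p, k)" using only[OF ql(1)] ql(2) q' by auto
    ultimately show "(q', l') \<in> X - {(p, k)}" by simp
  qed
  then have "colored_edge (L M) i (X - {(p, k)}) X"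
    unfolding colored_edge_L using X pX p(2) by (intro conjI exI[of _ p] exI[of _ k]) auto
  then show ?thesis by blast
qed

text \<open>Dually, the first level with pairing -1 can be raised: earlier levels have a larger
  pairing, so by \<open>ple_up\<close> they already lie above the raised weight.\<close>

lemma edge_up:
  assumes X: "X \<in> order_ideals (Q M)" and ne: "level_set M i (- 1) X \<noteq> {}"
  shows "\<exists>Y. colored_edge (L M) i X Y"
proof -
  define k where "k = Min (level_set M i (- 1) X)"
  have "k \<in> level_set M i (- 1) X" unfolding k_def using ne by (intro Min_in) auto
  then have k: "k < M" "pr i (wts X k) = - 1" by (auto simp: level_set_def)
  obtain p where p: "p \<in> carrier P" "col p = i" "p \<notin> Idl (wts X k)"
      "Idl (wts X k + \<alpha> i) = insert p (Idl (wts X k))"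
    using Idl_up[OF wts_orb[OF X] k(2)] by auto
  have pX: "(p, k) \<notin> X" using p(3) mem_iff_ple_wts[OF X p(1)] p(1) by (simp add: Idl_def)
  have p_le: "p \<preceq> wts X k + \<alpha> i" using p(4) by (auto simp: Idl_def)
  have new: "(q, l) \<in> insert (p, k) X" if q: "q \<in> carrier P" "l \<le> k" "q \<preceq> p" for q l
  proof (cases "l = k")
    case True
    have "q \<in> Idl (wts X k + \<alpha> i)" using q ple_trans[OF q(3) p_le] by (simp add: Idl_def)
    then have "q = p \<or> q \<in> Idl (wts X k)" unfolding p(4) by simp
    then show ?thesis using True mem_iff_ple_wts[OF X q(1)] by (auto simp: Idl_def)
  next
    case False
    have "k \<le> l" if "l \<in> level_set M i (- 1) X"
      unfolding k_def by (rule Min_le[OF finite_level_set that])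
    then have "l \<notin> level_set M i (- 1) X" using False q(2) by auto
    then have "pr i (wts X k) < pr i (wts X l)"
      using q(2) k pr_orb[OF wts_orb[OF X], of l i] by (auto simp: level_set_def)
    then have "wts X k + \<alpha> i \<preceq> wts X l"
      by (rule ple_up[OF wts_orb[OF X] wts_orb[OF X] wts_antimono[OF X q(2)]])
    then have "q \<preceq> wts X l" by (rule ple_trans[OF ple_trans[OF q(3) p_le]])
    then show ?thesis using mem_iff_ple_wts[OF X q(1)] by simp
  qed
  have "insert (p, k) X \<in> order_ideals (Q M)"
  proof (rule Q_idealI)
    fix q l assume "(q, l) \<in> insert (p, k) X"
    then consider "q = p" "l = k" | "(q, l) \<in> X" by auto
    note ql = this
    show "q \<in> carrier P" using ql p(1) Q_idealD(1)[OF X] by cases auto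
    show "l < M" using ql k(1) Q_idealD(2)[OF X] by cases auto
    fix q' l' assume q': "q' \<in> carrier P" "l' \<le> l" "q' \<preceq> q"
    show "(q', l') \<in> insert (p, k) X"
      using ql
    proof cases
      case 1
      then show ?thesis using new q' by simp
    next
      case 2
      then show ?thesis using Q_idealD(3)[OF X 2 q'] by simp
    qed
  qed
  then have "colored_edge (L M) i X (insert (p, k) X)"
    unfolding colored_edge_L using X pX p(2) by blast
  then show ?thesis by blast
qed

text \<open>All pairings are -1, 0 or 1, so the difference of the two counts is the sum of the
  pairings over the levels.\<close>

lemma color_mass_L:
  assumes X: "X \<in> order_ideals (Q M)"
  shows "of_int (color_mass (L M) i X) = pr i (total_wt M X)"
proof -
  have "color_mass (L M) i X = int (card (level_set M i 1 X)) - int (card (level_set M i (- 1) X))"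
  proof (rule color_mass_eq)
    fix Y assume "Y \<in> carrier (L M)"
    then have Y: "Y \<in> order_ideals (Q M)" by (simp add: minuscule_multiple_lattice_def)
    show "0 < card (level_set M i 1 Y) \<Longrightarrow> \<exists>Z. colored_edge (L M) i Z Y"
      using edge_down[OF Y, of i] by (auto simp: card_gt_0_iff)
    show "0 < card (level_set M i (- 1) Y) \<Longrightarrow> \<exists>Z. colored_edge (L M) i Y Z"
      using edge_up[OF Y, of i] by (auto simp: card_gt_0_iff)
  next
    show "X \<in> carrier (L M)" using X by (simp add: minuscule_multiple_lattice_def)
  qed (rule edge_level_set)
  then have mass: "of_int (color_mass (L M) i X) =
      real (card (level_set M i 1 X)) - real (card (level_set M i (- 1) X))"
    by simp
  have card: "real (card (level_set M i c X)) = (\<Sum>k<M. if pr i (wts X k) = c then 1 else 0)" for c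
  proof -
    have "real (card (level_set M i c X)) = (\<Sum>k\<in>{k \<in> {..<M}. pr i (wts X k) = c}. 1)"
      by (simp add: level_set_def)
    also have "\<dots> = (\<Sum>k<M. if pr i (wts X k) = c then 1 else 0)"
      by (rule sum.inter_filter) simp
    finally show ?thesis .
  qed
  have "real (card (level_set M i 1 X)) - real (card (level_set M i (- 1) X)) =
      (\<Sum>k<M. (if pr i (wts X k) = 1 then 1 else 0) - (if pr i (wts X k) = - 1 then 1 else 0))"
    unfolding card sum_subtractf by (rule refl)
  also have "\<dots> = (\<Sum>k<M. pr i (wts X k))"
  proof (rule sum.cong[OF refl])
    fix k
    show "(if pr i (wts X k) = 1 then 1 else 0) - (if pr i (wts X k) = - 1 then 1 else 0) = pr i (wts X k)"
      using pr_orb[OF wts_orb[OF X], of k i] by auto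
  qed
  also have "\<dots> = pr i (total_wt M X)" by (simp add: total_wt_def inner_sum_left)
  finally show ?thesis unfolding mass .
qed

lemma poset_weight_L:
  assumes "X \<in> order_ideals (Q M)"
  shows "poset_weight \<alpha> (L M) X = total_wt M X"
  unfolding poset_weight_def color_mass_L[OF assms] by (rule weight_expansion)

lemma edge_weight_L:
  assumes "colored_edge (L M) i X Y"
  shows "poset_weight \<alpha> (L M) X + \<alpha> i = poset_weight \<alpha> (L M) Y"
proof -
  obtain p k where X: "X \<in> order_ideals (Q M)" and Y: "Y \<in> order_ideals (Q M)"
    and p: "(p, k) \<notin> X" "Y = insert (p, k) X" "col p = i"
    using assms unfolding colored_edge_L by blast
  have k: "k < M" by (rule Q_idealD(2)[OF Y, of p]) (simp add: p(2))
  have "wts Y l = wts X l + (if l = k then \<alpha> i else 0)" for l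
    using wts_insert[OF X p(1)] p(2,3) by simp
  then have "total_wt M Y = total_wt M X + \<alpha> i"
    using k by (simp add: total_wt_def sum.distrib)
  then show ?thesis by (simp add: poset_weight_L X Y)
qed

section \<open>Summing over ideals level by level\<close>

definition ideals_above :: "nat \<Rightarrow> real ^ 'n \<Rightarrow> ((real ^ 'n) \<times> nat) set set" where
  "ideals_above M x = {X \<in> order_ideals (Q M). \<forall>k<M. x \<preceq> wts X k}"

lemma finite_ideals_above: "finite (ideals_above M x)"
  using finite_poset.finite_ideals[OF finite_poset_Q] by (simp add: ideals_above_def)

lemma slice_glue:
  assumes "X \<in> order_ideals (Q M)"
  shows "slice (X \<union> Idl y \<times> {M}) k = (if k = M then Idl y else slice X k)"
  using Q_idealD(2)[OF assms] by (auto simp: slice_def)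

text \<open>The added level \<open>M\<close> comes last and therefore carries the least weight,
  which is why all levels of \<open>X\<close> must lie above \<open>y\<close>.\<close>

lemma glue_ideal:
  assumes y: "y \<in> orb" and X: "X \<in> ideals_above M y"
  shows "X \<union> Idl y \<times> {M} \<in> order_ideals (Q (Suc M))"
proof -
  have XI: "X \<in> order_ideals (Q M)" and ab: "\<And>k. k < M \<Longrightarrow> y \<preceq> wts X k"
    using X by (auto simp: ideals_above_def)
  have "(q, l) \<in> X \<union> Idl y \<times> {M}" if "p \<preceq> y" "q \<in> carrier P" "l \<le> M" "q \<preceq> p" for p q l
  proof (cases "l = M")
    case True
    then show ?thesis using that ple_trans[of q p y] by (auto simp: Idl_def)
  next
    case False
    then have "q \<preceq> wts X l" using that ab[of l] ple_trans[of q p y] ple_trans[of q y "wts X l"] by simp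
    then show ?thesis using mem_iff_ple_wts[OF XI that(2)] by simp
  qed
  note new = this
  show ?thesis
  proof (rule Q_idealI)
    fix p k assume "(p, k) \<in> X \<union> Idl y \<times> {M}"
    then consider "(p, k) \<in> X" | "p \<in> carrier P" "p \<preceq> y" "k = M" by (auto simp: Idl_def)
    note pk = this
    show "p \<in> carrier P" using pk Q_idealD(1)[OF XI] by cases auto
    show "k < Suc M" using pk Q_idealD(2)[OF XI, of p k] by cases auto
    fix q l assume q: "q \<in> carrier P" "l \<le> k" "q \<preceq> p"
    show "(q, l) \<in> X \<union> Idl y \<times> {M}"
      using pk
    proof cases
      case 1
      then show ?thesis using Q_idealD(3)[OF XI 1 q] by simp
    next
      case 2
      then show ?thesis using new[OF 2(2) q(1) _ q(3)] q(2) by simp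
    qed
  qed
qed

text \<open>Splitting off the last level, whose weight \<open>y\<close> bounds all the others from
  below, reproduces the recursion of \<open>chain_sum\<close>.\<close>

lemma sum_ideals_above:
  "x \<in> orb \<Longrightarrow> (\<Sum>X\<in>ideals_above M x. exp (total_wt M X \<bullet> v)) = chain_sum M x v"
proof (induction M arbitrary: x)
  case 0
  have "ideals_above 0 x = {{}}"
    using Q_idealD(2)[of _ 0] finite_poset.empty_ideal[OF finite_poset_Q] by (fastforce simp: ideals_above_def)
  then show ?case by (simp add: total_wt_def)
next
  case (Suc M)
  let ?S = "SIGMA y:{y \<in> orb. x \<preceq> y}. ideals_above M y"
  let ?glue = "\<lambda>(y, X). X \<union> Idl y \<times> {M}"
  let ?cut = "\<lambda>X. (wts X M, {(p, k) \<in> X. k < M})"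
  have glue: "?glue (y, X) \<in> ideals_above (Suc M) x" "?cut (?glue (y, X)) = (y, X)"
    "total_wt (Suc M) (?glue (y, X)) = y + total_wt M X"
    if "(y, X) \<in> ?S" for y X
  proof -
    have y: "y \<in> orb" "x \<preceq> y" and X: "X \<in> ideals_above M y" using that by auto
    then have XI: "X \<in> order_ideals (Q M)" and ab: "\<And>k. k < M \<Longrightarrow> y \<preceq> wts X k"
      by (auto simp: ideals_above_def)
    have w: "wts (X \<union> Idl y \<times> {M}) k = (if k = M then y else wts X k)" for k
      by (simp add: wts_def slice_glue[OF XI] wt_Idl[OF y(1)])
    have "x \<preceq> (if k = M then y else wts X k)" if "k < Suc M" for k
      using that y(2) ab[of k] ple_trans[of x y "wts X k"] by auto
    then show "?glue (y, X) \<in> ideals_above (Suc M) x"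
      using glue_ideal[OF y(1) X] by (simp add: ideals_above_def w)
    have "{(p, k) \<in> X \<union> Idl y \<times> {M}. k < M} = X"
      using Q_idealD(2)[OF XI] by auto
    then show "?cut (?glue (y, X)) = (y, X)" by (simp add: w)
    show "total_wt (Suc M) (?glue (y, X)) = y + total_wt M X"
      by (simp add: total_wt_def w)
  qed
  have cut: "?cut X \<in> ?S" "?glue (?cut X) = X" if "X \<in> ideals_above (Suc M) x" for X
  proof -
    have X: "X \<in> order_ideals (Q (Suc M))" and ab: "\<And>k. k < Suc M \<Longrightarrow> x \<preceq> wts X k"
      using that by (auto simp: ideals_above_def)
    let ?X = "{(p, k) \<in> X. k < M}"
    have XI: "?X \<in> order_ideals (Q M)"
    proof (rule Q_idealI)
      fix p k assume "(p, k) \<in> ?X"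
      then have pk: "(p, k) \<in> X" "k < M" by auto
      show "p \<in> carrier P" by (rule Q_idealD(1)[OF X pk(1)])
      show "k < M" by (rule pk(2))
      fix q l assume q: "q \<in> carrier P" "l \<le> k" "q \<preceq> p"
      show "(q, l) \<in> ?X" using Q_idealD(3)[OF X pk(1) q] q(2) pk(2) by simp
    qed
    have "slice ?X k = slice X k" if "k < M" for k using that by (auto simp: slice_def)
    then have "wts X M \<preceq> wts ?X k" if "k < M" for k
      using that wts_antimono[OF X, of k M] by (simp add: wts_def)
    then show "?cut X \<in> ?S"
      using XI wts_orb[OF X] ab[of M] by (simp add: ideals_above_def)
    have "Idl (wts X M) = slice X M" by (rule Idl_wts[OF X])
    moreover have "k < M \<or> k = M" if "(p, k) \<in> X" for p k
      using Q_idealD(2)[OF X that] by auto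
    ultimately show "?glue (?cut X) = X" by (auto simp: slice_def)
  qed
  have "(\<Sum>X\<in>ideals_above (Suc M) x. exp (total_wt (Suc M) X \<bullet> v))
      = (\<Sum>(y, X)\<in>?S. exp (y \<bullet> v) * exp (total_wt M X \<bullet> v))"
  proof (rule sum.reindex_bij_witness[of _ ?glue ?cut])
    fix X assume X: "X \<in> ideals_above (Suc M) x"
    show "?glue (?cut X) = X" "?cut X \<in> ?S" by (rule cut[OF X])+
    have "total_wt (Suc M) (?glue (?cut X)) = wts X M + total_wt M {(p, k) \<in> X. k < M}"
      by (rule glue(3)) (rule cut(1)[OF X])
    then have "total_wt (Suc M) X = wts X M + total_wt M {(p, k) \<in> X. k < M}"
      unfolding cut(2)[OF X] .
    then show "(case ?cut X of (y, X) \<Rightarrow> exp (y \<bullet> v) * exp (total_wt M X \<bullet> v)) = exp (total_wt (Suc M) X \<bullet> v)"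
      by (simp add: inner_add_left exp_add)
  next
    fix yX assume yX: "yX \<in> ?S"
    then show "?cut (?glue yX) = yX" "?glue yX \<in> ideals_above (Suc M) x"
      using glue(1,2)[of "fst yX" "snd yX"] by (simp_all only: prod.collapse)
  qed
  also have "\<dots> = (\<Sum>y\<in>{y \<in> orb. x \<preceq> y}. \<Sum>X\<in>ideals_above M y. exp (y \<bullet> v) * exp (total_wt M X \<bullet> v))"
    by (rule sum.Sigma[symmetric]) (simp_all add: finite_orb finite_ideals_above)
  also have "\<dots> = chain_sum (Suc M) x v"
    by (simp add: Suc.IH flip: sum_distrib_left)
  finally show ?case .
qed

text \<open>The bound \<open>bot_weight\<close> is vacuous, so the outermost step of
  \<open>chain_sum\<close> ranges over the whole orbit.\<close>

lemma sum_ideals: "(\<Sum>X\<in>order_ideals (Q (Suc m)). exp (total_wt (Suc m) X \<bullet> v)) = multichain_sum m v"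
proof -
  have "ideals_above (Suc m) bot_weight = order_ideals (Q (Suc m))"
    using bot_weight(2)[OF wts_orb] by (auto simp: ideals_above_def)
  then have "(\<Sum>X\<in>order_ideals (Q (Suc m)). exp (total_wt (Suc m) X \<bullet> v)) = chain_sum (Suc m) bot_weight v"
    using sum_ideals_above[OF bot_weight(1), of "Suc m" v] by simp
  moreover have "{y \<in> orb. bot_weight \<preceq> y} = orb" using bot_weight(2) by blast
  ultimately show ?thesis by (simp add: multichain_sum_def)
qed

text \<open>Every simple root has pairing 1 with \<open>\<rho>v\<close>. Evaluating the character
  along \<open>\<rho>v\<close> thus counts ideals by cardinality, up to a monomial factor.\<close>

lemma \<rho>v_total_wt:
  assumes X: "X \<in> order_ideals (Q M)"
  shows "\<rho>v \<bullet> total_wt M X = real M * (\<rho>v \<bullet> bot_weight) + real (card X)"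
proof -
  have fin: "finite (slice X k)" for k by (rule P.finite_ideal[OF slice_ideal[OF X]])
  have "\<rho>v \<bullet> wts X k = \<rho>v \<bullet> bot_weight + real (card (slice X k))" for k
    by (simp add: wts_def wt_def inner_add_right inner_sum_right \<rho>v_alpha)
  then have "\<rho>v \<bullet> total_wt M X = real M * (\<rho>v \<bullet> bot_weight) + real (\<Sum>k<M. card (slice X k))"
    by (simp add: total_wt_def inner_sum_right sum.distrib)
  moreover have "(\<Sum>k<M. card (slice X k)) = card (SIGMA k:{..<M}. slice X k)"
    using fin by (simp add: card_SigmaI)
  moreover have "card (SIGMA k:{..<M}. slice X k) = card X"
  proof (rule bij_betw_same_card[of prod.swap])
    show "bij_betw prod.swap (SIGMA k:{..<M}. slice X k) X"
      by (rule bij_betw_byWitness[where f' = prod.swap])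
         (use Q_idealD(2)[OF X] in \<open>auto simp: slice_def\<close>)
  qed
  ultimately show ?thesis by simp
qed

end

section \<open>The splitting property\<close>

context minuscule_orbit
begin

lemma L_structure: "ideal_lattice_structure (Q M) (L M)"
  unfolding minuscule_multiple_lattice_def
  by (rule colored_ideal_lattice_structure[OF finite_poset_Q])

lemma carrier_L: "carrier (L M) = order_ideals (Q M)"
  by (simp add: minuscule_multiple_lattice_def)

lemma pr_total_wt_int:
  assumes "X \<in> order_ideals (Q M)"
  shows "pr i (total_wt M X) \<in> \<int>"
  by (metis color_mass_L[OF assms] Ints_of_int)

lemma character_L:
  assumes "M > 0"
  shows "(\<Sum>X\<in>order_ideals (Q M). group_ring_exp (total_wt M X)) = weyl_bialternant \<Phi> \<alpha> (real M *\<^sub>R \<omega>)"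
proof (rule sym, rule weyl_bialternant_eqI)
  obtain m where M: "M = Suc m" using assms gr0_implies_Suc by blast
  let ?f = "\<Sum>X\<in>order_ideals (Q M). group_ring_exp (total_wt M X)"
  show "Poly_Mapping.keys ?f \<subseteq> weight_lattice \<alpha>"
    by (rule subset_trans[OF keys_sum])
       (auto simp: group_ring_exp_def weight_lattice_iff pr_total_wt_int)
  show "alternant \<Phi> (weyl_vector \<alpha>) * ?f = alternant \<Phi> (real M *\<^sub>R \<omega> + weyl_vector \<alpha>)"
  proof (rule expsum_inject)
    fix v
    have "expsum ?f v = multichain_sum m v"
      unfolding sum_ideals[symmetric] M by (simp add: expsum_sum group_ring_exp_def expsum_single)
    then show "expsum (alternant \<Phi> (weyl_vector \<alpha>) * ?f) v =
        expsum (alternant \<Phi> (real M *\<^sub>R \<omega> + weyl_vector \<alpha>)) v"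
      unfolding expsum_mult expsum_alternant M using multichain_sum_character[of v m] by simp
  qed
qed

lemma splitting_L:
  assumes "M > 0"
  shows "splitting_distributive_lattice \<Phi> \<alpha> (real M *\<^sub>R \<omega>) (L M)"
proof -
  interpret LM: ideal_lattice_structure "Q M" "L M" by (rule L_structure)
  have "(\<Sum>X\<in>carrier (L M). group_ring_exp (poset_weight \<alpha> (L M) X)) =
      (\<Sum>X\<in>order_ideals (Q M). group_ring_exp (total_wt M X))"
    unfolding carrier_L by (rule sum.cong[OF refl]) (simp add: poset_weight_L)
  then show ?thesis
    unfolding splitting_distributive_lattice_def splitting_poset_def
    using LM.L_ranked LM.L_distributive edge_weight_L character_L[OF assms] by auto
qed

section \<open>The Gaussian property\<close>

lemma pr_weyl_int:
  assumes "w \<in> W" "\<And>i. pr i x \<in> \<int>"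
  shows "pr i (w x) \<in> \<int>"
proof -
  have "\<forall>i. pr i (wd l x) \<in> \<int>" for l
  proof (induction l)
    case (Cons j l)
    have "pr i (wd (j # l) x) = pr i (wd l x) - pr j (wd l x) * pr i (\<alpha> j)" for i
      by (simp add: root_reflection_def inner_diff_left)
    then show ?case using Cons crystallographic[OF alpha_root alpha_root] by auto
  qed (use assms(2) in simp)
  then show ?thesis using weyl_eq_wd[OF assms(1)] by blast
qed

text \<open>Every positive coroot is conjugate to a simple one, and the conjugating element
  preserves integrality on simple coroots.\<close>

lemma weight_coroot_int:
  assumes "\<And>i. pr i x \<in> \<int>" "\<beta> \<in> pos_roots"
  shows "x \<bullet> coroot \<beta> \<in> \<int>"
proof -
  obtain l j where \<beta>: "\<beta> = wd l (\<alpha> j)" using pos_root_eq_wd[OF assms(2)] by blast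
  have "x \<bullet> coroot \<beta> = wd l (coroot (\<alpha> j)) \<bullet> x"
    by (simp add: \<beta> coroot_orthogonal[OF weyl_orthogonal[OF wd_weyl]] inner_commute)
  also have "\<dots> = coroot (\<alpha> j) \<bullet> inv (wd l) x"
    by (rule weyl_inv_inner[OF wd_weyl])
  also have "\<dots> = pr j (inv (wd l) x)"
    by (rule inner_commute)
  finally show ?thesis using pr_weyl_int[OF weyl_inv[OF wd_weyl] assms(1)] by simp
qed

text \<open>The height of the coroot of \<open>\<beta>\<close> in the dual root system; on positive
  roots the floor is only a cast.\<close>

definition cht :: "real ^ 'n \<Rightarrow> nat" where
  "cht \<beta> = nat \<lfloor>weyl_vector \<alpha> \<bullet> coroot \<beta>\<rfloor>"

lemma weyl_vector_coroot_pos: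
  assumes "\<beta> \<in> pos_roots"
  shows "weyl_vector \<alpha> \<bullet> coroot \<beta> > 0"
proof -
  obtain i where i: "cf i \<beta> > 0" using pos_root_exists_cf[OF assms] by blast
  then have "\<beta> \<noteq> 0" by auto
  then have "cf i (coroot \<beta>) > 0" using i by (simp add: coroot_cf)
  then have "0 < (\<Sum>j\<in>UNIV. cf j (coroot \<beta>) * (weyl_vector \<alpha> \<bullet> \<alpha> j))"
    using weyl_vector_pos coroot_cf_nonneg[OF assms]
    by (intro sum_pos2[of _ i]) (auto intro!: mult_nonneg_nonneg less_imp_le[OF weyl_vector_pos])
  then show ?thesis by (subst inner_expansion)
qed

lemma cht:
  assumes "\<beta> \<in> pos_roots"
  shows "weyl_vector \<alpha> \<bullet> coroot \<beta> = real (cht \<beta>)" "cht \<beta> > 0"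
proof -
  have "weyl_vector \<alpha> \<bullet> coroot \<beta> \<in> \<int>"
    by (rule weight_coroot_int[OF _ assms]) (simp add: weyl_vector_coroot)
  then show "weyl_vector \<alpha> \<bullet> coroot \<beta> = real (cht \<beta>)"
    using weyl_vector_coroot_pos[OF assms] by (auto simp: cht_def elim!: Ints_cases)
  then show "cht \<beta> > 0" using weyl_vector_coroot_pos[OF assms] by simp
qed

section \<open>Principal specialisation and the product formula\<close>

definition active :: "(real ^ 'n) set" where
  "active = {\<beta> \<in> pos_roots. \<omega> \<bullet> coroot \<beta> = 1}"

lemma finite_active: "finite active"
  using finite_pos_roots by (simp add: active_def)

lemma omega_coroot: "\<beta> \<in> pos_roots \<Longrightarrow> \<omega> \<bullet> coroot \<beta> = (if \<beta> \<in> active then 1 else 0)"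
proof -
  assume \<beta>: "\<beta> \<in> pos_roots"
  have "\<omega> \<bullet> \<alpha> i \<ge> 0" for i
    using dominant by (subst inner_alpha) (simp add: dominant_weight_def)
  then have "\<omega> \<bullet> coroot \<beta> \<ge> 0" using coroot_cf_nonneg[OF \<beta>] by (rule inner_nonneg_if_cf[rotated])
  then show ?thesis
    using minuscule \<beta> pos_roots_root[OF \<beta>] by (auto simp: minuscule_weight_def active_def)
qed

lemma active_nonempty: "active \<noteq> {}"
proof
  assume "active = {}"
  then have "pr i \<omega> = pr i 0" for i using omega_coroot[OF alpha_pos[of i]] by simp
  then have "\<omega> = 0" by (rule eq_if_coroot_inner)
  then show False using minuscule by (simp add: minuscule_weight_def)
qed

text \<open>Exchanging exponent and argument turns the alternant of \<open>x\<close> at a multiple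
  of \<open>\<rho>v\<close> into that of \<open>\<rho>v\<close> at the same multiple of
  \<open>x\<close>, which the denominator formula factors.\<close>

lemma alt_sum_\<rho>v: "alt_sum (\<lambda>u. exp (x \<bullet> u)) (t *\<^sub>R \<rho>v) = denominator (t *\<^sub>R x)"
proof -
  have "alt_sum (\<lambda>u. exp (x \<bullet> u)) (t *\<^sub>R \<rho>v) = (\<Sum>w\<in>W. sg w * exp ((t *\<^sub>R \<rho>v) \<bullet> w x))"
    unfolding alt_sum_exp_commute[of x] by (simp add: alt_sum_def)
  also have "\<dots> = (\<Sum>w\<in>W. sg w * exp (\<rho>v \<bullet> w (t *\<^sub>R x)))"
    by (rule sum.cong[OF refl]) (simp add: linear_scale[OF weyl_linear])
  also have "\<dots> = denominator (t *\<^sub>R x)"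
    unfolding weyl_denominator[symmetric] by (simp add: alt_sum_def)
  finally show ?thesis .
qed

text \<open>The principal specialisation, up to a monomial factor that is removed below.\<close>

lemma specialisation:
  assumes t: "t \<noteq> 0" and M: "M > 0"
  shows "(\<Prod>\<beta>\<in>active. 1 - exp (t * real (cht \<beta>))) * (\<Sum>X\<in>order_ideals (Q M). exp (t * real (card X))) =
    exp (- (real M * (real (card active) / 2 + \<rho>v \<bullet> bot_weight)) * t) *
    (\<Prod>\<beta>\<in>active. 1 - exp (t * real (M + cht \<beta>)))"
proof -
  obtain m where m: "M = Suc m" using M gr0_implies_Suc by blast
  define \<phi> where "\<phi> = (\<lambda>x::real. exp (x / 2) - exp (- (x / 2)))"
  have \<phi>_eq: "\<phi> x = - exp (- (x / 2)) * (1 - exp x)" for x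
    by (simp add: \<phi>_def algebra_simps flip: exp_add)
  have \<phi>_nz: "\<phi> x \<noteq> 0" if "x \<noteq> 0" for x using that by (simp add: \<phi>_eq)
  have den: "denominator (t *\<^sub>R (c *\<^sub>R \<omega> + weyl_vector \<alpha>)) =
      (\<Prod>\<beta>\<in>active. \<phi> (t * (c + cht \<beta>))) * (\<Prod>\<beta>\<in>pos_roots - active. \<phi> (t * cht \<beta>))" for c
  proof -
    have "denominator (t *\<^sub>R (c *\<^sub>R \<omega> + weyl_vector \<alpha>)) =
        (\<Prod>\<beta>\<in>pos_roots. \<phi> (t * ((if \<beta> \<in> active then c else 0) + cht \<beta>)))"
      unfolding denominator_def
      by (rule prod.cong[OF refl])
         (simp add: \<phi>_def inner_add_right inner_commute[of "coroot _"] omega_coroot cht(1))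
    also have "\<dots> = (\<Prod>\<beta>\<in>pos_roots - active. \<phi> (t * ((if \<beta> \<in> active then c else 0) + cht \<beta>))) *
        (\<Prod>\<beta>\<in>active. \<phi> (t * ((if \<beta> \<in> active then c else 0) + cht \<beta>)))"
      by (rule prod.subset_diff[OF _ finite_pos_roots]) (auto simp: active_def)
    finally show ?thesis by (simp add: mult.commute)
  qed
  have sum: "multichain_sum m (t *\<^sub>R \<rho>v) =
      exp (t * (M * (\<rho>v \<bullet> bot_weight))) * (\<Sum>X\<in>order_ideals (Q M). exp (t * card X))"
    unfolding sum_ideals[symmetric] sum_distrib_left m
    by (rule sum.cong[OF refl])
       (simp add: inner_commute[of _ \<rho>v] \<rho>v_total_wt distrib_left flip: exp_add)
  have "denominator (t *\<^sub>R (0 *\<^sub>R \<omega> + weyl_vector \<alpha>)) * multichain_sum m (t *\<^sub>R \<rho>v) =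
      denominator (t *\<^sub>R (real M *\<^sub>R \<omega> + weyl_vector \<alpha>))"
    using multichain_sum_character[of "t *\<^sub>R \<rho>v" m] unfolding alt_sum_\<rho>v m by simp
  \<comment> \<open>The factors outside \<open>active\<close> are the same on both sides and can be
    cancelled, as coroot heights are positive and \<open>t\<close> is nonzero.\<close>
  moreover have "(\<Prod>\<beta>\<in>pos_roots - active. \<phi> (t * cht \<beta>)) \<noteq> 0"
  proof -
    have "\<phi> (t * cht \<beta>) \<noteq> 0" if "\<beta> \<in> pos_roots" for \<beta>
      using t cht(2)[OF that] by (intro \<phi>_nz) simp
    then show ?thesis using finite_pos_roots by simp
  qed
  ultimately have 1: "(\<Prod>\<beta>\<in>active. \<phi> (t * cht \<beta>)) * multichain_sum m (t *\<^sub>R \<rho>v) =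
      (\<Prod>\<beta>\<in>active. \<phi> (t * (real M + cht \<beta>)))"
    unfolding den by simp
  define E where "E = (\<Prod>\<beta>\<in>active. - exp (- (t * cht \<beta> / 2)))"
  have E: "E \<noteq> 0" using finite_active by (simp add: E_def)
  have 2: "(\<Prod>\<beta>\<in>active. \<phi> (t * cht \<beta>)) = E * (\<Prod>\<beta>\<in>active. 1 - exp (t * real (cht \<beta>)))"
    unfolding \<phi>_eq prod.distrib E_def by (rule refl)
  \<comment> \<open>Each active root leaves a factor \<open>exp (- (t * M / 2))\<close>; this is the
    source of \<open>card active / 2\<close> in the exponent.\<close>
  have "\<phi> (t * (real M + cht \<beta>)) =
      exp (- (t * M / 2)) * (- exp (- (t * cht \<beta> / 2))) * (1 - exp (t * real (M + cht \<beta>)))" for \<beta>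
    unfolding \<phi>_eq by (simp add: algebra_simps add_divide_distrib flip: exp_add)
  then have 3: "(\<Prod>\<beta>\<in>active. \<phi> (t * (real M + cht \<beta>))) =
      exp (- (t * M / 2)) ^ card active * E * (\<Prod>\<beta>\<in>active. 1 - exp (t * real (M + cht \<beta>)))"
    by (simp only: prod.distrib E_def prod_constant)
  have "(\<Prod>\<beta>\<in>active. 1 - exp (t * real (cht \<beta>))) * multichain_sum m (t *\<^sub>R \<rho>v) =
      exp (- (t * M / 2)) ^ card active * (\<Prod>\<beta>\<in>active. 1 - exp (t * real (M + cht \<beta>)))"
    using 1 E unfolding 2 3 by simp
  then have 4: "(\<Prod>\<beta>\<in>active. 1 - exp (t * real (cht \<beta>))) * (\<Sum>X\<in>order_ideals (Q M). exp (t * card X)) =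
      exp (- (t * (M * (\<rho>v \<bullet> bot_weight)))) * exp (- (t * M / 2)) ^ card active *
        (\<Prod>\<beta>\<in>active. 1 - exp (t * real (M + cht \<beta>)))"
    unfolding sum by (simp add: exp_minus field_simps)
  have "exp (- (t * (M * (\<rho>v \<bullet> bot_weight)))) * exp (- (t * M / 2)) ^ card active =
      exp (- (real M * (real (card active) / 2 + \<rho>v \<bullet> bot_weight)) * t)"
    by (simp add: algebra_simps flip: exp_of_nat_mult exp_add)
  then show ?thesis using 4 by simp
qed

text \<open>Letting the variable tend to 0 shows that the exponent of the monomial factor vanishes.\<close>

lemma specialisation_exponent:
  assumes M: "M > 0"
  shows "real M * (real (card active) / 2 + \<rho>v \<bullet> bot_weight) = 0"
proof -
  define \<kappa> where "\<kappa> = real M * (real (card active) / 2 + \<rho>v \<bullet> bot_weight)"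
  interpret Q: finite_poset "Q M" by (rule finite_poset_Q)
  \<comment> \<open>With \<open>t = - (n + 1)\<close> the variable \<open>exp t\<close> tends to 0,
    and in the sum over ideals only the empty ideal survives.\<close>
  have lim: "(\<lambda>n. exp (- real (Suc n) * real k)) \<longlonglongrightarrow> (if k = 0 then 1 else 0)" for k
  proof (cases "k = 0")
    case False
    have "(\<lambda>n. exp (- real k) ^ Suc n) \<longlonglongrightarrow> 0"
      by (rule LIMSEQ_Suc[OF LIMSEQ_power_zero]) (use False in simp)
    moreover have "exp (- real k) ^ Suc n = exp (- real (Suc n) * real k)" for n
      by (simp only: exp_of_nat_mult[symmetric]) (simp add: algebra_simps)
    ultimately have "(\<lambda>n. exp (- real (Suc n) * real k)) \<longlonglongrightarrow> 0" by (simp only:)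
    then show ?thesis using False by (simp only: if_False)
  qed simp
  have lim_prod: "(\<lambda>n. \<Prod>\<beta>\<in>active. 1 - exp (- real (Suc n) * real (f \<beta>))) \<longlonglongrightarrow> 1"
    if "\<And>\<beta>. \<beta> \<in> active \<Longrightarrow> f \<beta> > 0" for f :: "real ^ 'n \<Rightarrow> nat"
  proof -
    have "(\<lambda>n. \<Prod>\<beta>\<in>active. 1 - exp (- real (Suc n) * real (f \<beta>))) \<longlonglongrightarrow> (\<Prod>\<beta>\<in>active. 1 - (if f \<beta> = 0 then 1 else 0))"
      by (intro tendsto_prod tendsto_diff tendsto_const lim)
    then show ?thesis using that by (simp add: prod.neutral)
  qed
  have cht_active: "cht \<beta> > 0" if "\<beta> \<in> active" for \<beta>
    using that cht(2) by (simp add: active_def)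
  have "(\<lambda>n. \<Sum>X\<in>order_ideals (Q M). exp (- real (Suc n) * real (card X)))
      \<longlonglongrightarrow> (\<Sum>X\<in>order_ideals (Q M). if card X = 0 then 1 else 0)"
    by (intro tendsto_sum lim)
  moreover have "(\<Sum>X\<in>order_ideals (Q M). if card X = 0 then 1 else (0::real)) = 1"
  proof -
    have "(\<Sum>X\<in>order_ideals (Q M). if card X = 0 then 1 else (0::real)) =
        (\<Sum>X\<in>order_ideals (Q M). if X = {} then 1 else 0)"
      using Q.finite_ideal by (intro sum.cong) auto
    then show ?thesis by (simp add: Q.finite_ideals)
  qed
  ultimately have "(\<lambda>n. \<Sum>X\<in>order_ideals (Q M). exp (- real (Suc n) * real (card X))) \<longlonglongrightarrow> 1"
    by simp
  then have "(\<lambda>n. (\<Prod>\<beta>\<in>active. 1 - exp (- real (Suc n) * real (cht \<beta>))) *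
      (\<Sum>X\<in>order_ideals (Q M). exp (- real (Suc n) * real (card X))) /
      (\<Prod>\<beta>\<in>active. 1 - exp (- real (Suc n) * real (M + cht \<beta>)))) \<longlonglongrightarrow> 1 * 1 / 1"
    by (intro tendsto_divide tendsto_mult lim_prod) (use cht_active in simp_all)
  moreover have "(\<Prod>\<beta>\<in>active. 1 - exp (- real (Suc n) * real (cht \<beta>))) *
      (\<Sum>X\<in>order_ideals (Q M). exp (- real (Suc n) * real (card X))) /
      (\<Prod>\<beta>\<in>active. 1 - exp (- real (Suc n) * real (M + cht \<beta>))) = exp (\<kappa> * real (Suc n))" for n
  proof -
    have nz: "(\<Prod>\<beta>\<in>active. 1 - exp (- real (Suc n) * real (M + cht \<beta>))) \<noteq> 0"
      using finite_active M by (simp add: prod_zero_iff)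
    have "- real (Suc n) \<noteq> 0" by simp
    note eq = specialisation[OF this M, folded \<kappa>_def, unfolded minus_mult_minus]
    show ?thesis unfolding eq by (rule nonzero_mult_div_cancel_right[OF nz])
  qed
  ultimately have x: "(\<lambda>n. exp (\<kappa> * real (Suc n))) \<longlonglongrightarrow> 1" by simp
  \<comment> \<open>Shifting the index multiplies the sequence by \<open>exp \<kappa>\<close>
    without changing its limit 1.\<close>
  have "(\<lambda>n. exp \<kappa> * exp (\<kappa> * real (Suc n))) \<longlonglongrightarrow> exp \<kappa> * 1"
    by (intro tendsto_mult tendsto_const x)
  moreover have "exp \<kappa> * exp (\<kappa> * real (Suc n)) = exp (\<kappa> * real (Suc (Suc n)))" for n
    by (simp add: algebra_simps flip: exp_add)
  ultimately have y: "(\<lambda>n. exp (\<kappa> * real (Suc (Suc n)))) \<longlonglongrightarrow> exp \<kappa>" by (simp only: mult_1_right)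
  have "exp \<kappa> = 1" by (rule LIMSEQ_unique[OF y LIMSEQ_Suc[OF x]])
  then show ?thesis by (simp add: \<kappa>_def)
qed

lemma order_ideals_prod: "order_ideals (prod_poset P (chain_poset M)) = order_ideals (Q M)"
  by (simp add: order_ideals_def colored_prod_chain_def prod_poset_def chain_poset_def gorder.defs)

lemma finite_poset_prod: "finite_poset (prod_poset P (chain_poset M))"
proof -
  have eq: "carrier (prod_poset P (chain_poset M)) = carrier (Q M)"
    "gorder.le (prod_poset P (chain_poset M)) = gorder.le (Q M)"
    by (simp_all add: colored_prod_chain_def gorder.defs)
  show ?thesis using finite_poset_Q[of M] unfolding finite_poset_def eq .
qed

lemma RGF_prod:
  "RGF (ideal_lattice (prod_poset P (chain_poset M))) = (\<Sum>X\<in>order_ideals (Q M). monom 1 (card X))"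
proof -
  interpret B: ideal_lattice_structure "prod_poset P (chain_poset M)"
    "ideal_lattice (prod_poset P (chain_poset M))"
    by (rule finite_poset.ideal_lattice_structure[OF finite_poset_prod])
  show ?thesis
    unfolding RGF_def B.L_carrier order_ideals_prod
    by (rule sum.cong[OF refl]) (simp add: B.poset_rank_L order_ideals_prod)
qed

text \<open>At \<open>t = ln n\<close> the specialisation becomes an identity between the values at
  \<open>n\<close> of two integer polynomials. It holds for all \<open>n \<ge> 2\<close>, where
  \<open>t\<close> is nonzero, so the polynomials agree.\<close>

lemma RGF_product:
  assumes M: "M > 0"
  shows "RGF (ideal_lattice (prod_poset P (chain_poset M))) * (\<Prod>\<beta>\<in>active. 1 - monom 1 (cht \<beta>)) =
    (\<Prod>\<beta>\<in>active. 1 - monom 1 (M + cht \<beta>))"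
    (is "?G * ?A = ?B")
proof -
  have "poly (?G * ?A - ?B) (int n) = 0" if "n \<ge> 2" for n
  proof -
    define t where "t = ln (real n)"
    have t: "t \<noteq> 0" using that by (simp add: t_def)
    have pw: "exp (t * real k) = real n ^ k" for k
      using that by (simp add: t_def mult.commute[of "ln _"] exp_of_nat_mult)
    have "real_of_int (poly ?A (int n) * poly ?G (int n)) = real_of_int (poly ?B (int n))"
      using specialisation[OF t M, unfolded specialisation_exponent[OF M] pw minus_zero
          mult_zero_left exp_zero mult_1]
      by (simp add: RGF_prod poly_sum poly_prod poly_monom)
    then show ?thesis by (simp only: of_int_eq_iff) (simp add: mult.commute)
  qed
  then have "int ` {2..} \<subseteq> {x. poly (?G * ?A - ?B) x = 0}" by auto
  moreover have "infinite (int ` {2..})"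
    by (simp add: finite_image_iff infinite_Ici)
  ultimately have "?G * ?A - ?B = 0"
    using poly_roots_finite finite_subset by blast
  then show ?thesis by simp
qed

lemma prod_Fract:
  fixes a b :: "'k \<Rightarrow> 'a :: idom"
  shows "(\<Prod>i\<in>A. Fract (a i) (b i)) = Fract (\<Prod>i\<in>A. a i) (\<Prod>i\<in>A. b i)"
  by (induction A rule: infinite_finite_induct) (simp_all add: One_fract_def)

lemma gaussian_P: "gaussian_poset P"
  unfolding gaussian_poset_def
proof (intro conjI)
  have eq: "eq P = (=)"
    by (simp add: minuscule_compression_poset_def join_irreducibles_def)
  show "partial_order P"
    by unfold_locales (auto simp: eq P.le_refl intro: P.le_antisym P.le_trans)
  show "finite (carrier P)" by (rule P.finite_carrier)
  obtain g where g: "bij_betw g {1..card active} active"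
    using ex_bij_betw_nat_finite_1[OF finite_active] by blast
  have h: "cht (g i) > 0" if "i \<in> {1..card active}" for i
    using cht(2) bij_betwE[OF g] that by (auto simp: active_def)
  have r: "card active > 0" using active_nonempty finite_active by (simp add: card_gt_0_iff)
  have G: "Fract (RGF (ideal_lattice (prod_poset P (chain_poset M)))) 1 =
      (\<Prod>i = 1..card active. Fract (1 - monom 1 (M + cht (g i))) (1 - monom 1 (cht (g i))))" if M: "M > 0" for M
  proof -
    have "1 - monom 1 (cht \<beta>) \<noteq> (0 :: int poly)" if "\<beta> \<in> active" for \<beta>
    proof
      assume "1 - monom 1 (cht \<beta>) = (0 :: int poly)"
      then have "coeff (1 - monom 1 (cht \<beta>)) 0 = (0 :: int)" by simp
      then show False using that cht(2)[of \<beta>] by (simp add: active_def)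
    qed
    then have nz: "(\<Prod>\<beta>\<in>active. 1 - monom 1 (cht \<beta>)) \<noteq> (0 :: int poly)"
      using finite_active by simp
    have "(\<Prod>i = 1..card active. Fract (1 - monom 1 (M + cht (g i))) (1 - monom 1 (cht (g i)))) =
        (\<Prod>\<beta>\<in>active. Fract (1 - monom 1 (M + cht \<beta>)) (1 - monom (1 :: int) (cht \<beta>)))"
      by (rule prod.reindex_bij_betw[OF g])
    also have "\<dots> = Fract (\<Prod>\<beta>\<in>active. 1 - monom 1 (M + cht \<beta>)) (\<Prod>\<beta>\<in>active. 1 - monom 1 (cht \<beta>))"
      by (rule prod_Fract)
    also have "\<dots> = Fract (RGF (ideal_lattice (prod_poset P (chain_poset M)))) 1"
      using RGF_product[OF M] nz by (subst eq_fract) simp_all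
    finally show ?thesis ..
  qed
  show "\<exists>(r :: nat) (h :: nat \<Rightarrow> nat). 0 < r \<and> (\<forall>i\<in>{1..r}. 0 < h i) \<and>
      (\<forall>M>0. Fract (RGF (ideal_lattice (prod_poset P (chain_poset M)))) 1 =
        (\<Prod>i = 1..r. Fract (1 - monom 1 (M + h i)) (1 - monom 1 (h i))))"
    by (rule exI[of _ "card active"], rule exI[of _ "\<lambda>i. cht (g i)"]) (intro conjI ballI allI impI r h G)
qed

end

theorem corollary9p5:
  fixes \<Phi> :: "(real ^ 'n) set"
    and \<alpha> :: "'i::finite \<Rightarrow> real ^ 'n"
    and \<omega> :: "real ^ 'n"
  assumes "irreducible_root_system \<Phi>"
    and "simple_system \<Phi> \<alpha>"
    and "dominant_weight \<alpha> \<omega>"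
    and "minuscule_weight \<Phi> \<alpha> \<omega>"
  shows "(\<forall>M>0.
            diamond_colored (minuscule_multiple_lattice \<Phi> \<alpha> \<omega> M) \<and>
            splitting_distributive_lattice \<Phi> \<alpha> (real M *\<^sub>R \<omega>)
              (minuscule_multiple_lattice \<Phi> \<alpha> \<omega> M)) \<and>
         gaussian_poset (minuscule_compression_poset \<Phi> \<alpha> \<omega>)"
proof -
  interpret minuscule_orbit \<Phi> \<alpha> \<omega>
    by unfold_locales (use assms in \<open>auto simp: irreducible_root_system_def\<close>)
  have "diamond_colored (L M)" for M
    unfolding minuscule_multiple_lattice_def
    by (rule diamond_colored_ideal_lattice[OF finite_poset_Q])
  then show ?thesis using splitting_L gaussian_P by blast
qed

end
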